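(* Let $(\mathcal{T},\mathcal{G})$ be a tree of finite groups with completion $\mathcal{G}_\mathcal{T}$, and let $(\mathcal{T},\mathcal{F},\mathcal{S})$ be a tree of fusion systems induced by $(\mathcal{T},\mathcal{G})$ which satisfies Hypothesis $(H)$ with distinguished vertex $v_*$, so that it has completion $\mathcal{F}_\mathcal{T}$ on $\mathcal{S}(v_* )$. Then: (a) $\mathcal{S}(v_* )$ (viewed as a subgroup of $\mathcal{G}(v_* )\le\mathcal{G}_\mathcal{T}$) is a Sylow $p$-subgroup of $\mathcal{G}_\mathcal{T}$, i.e. every finite $p$-subgroup of $\mathcal{G}_\mathcal{T}$ is $\mathcal{G}_\mathcal{T}$-conjugate to a subgroup of $\mathcal{S}(v_* )$. (b) $\mathcal{F}_{\mathcal{S}(v_* )}(\mathcal{G}_\mathcal{T})=\mathcal{F}_\mathcal{T}$. In particular $\mathcal{F}_\mathcal{T}$ does not depend on the choice of the tree of fusion systems induced by $(\mathcal{T},\mathcal{G})$.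
   Context: Conventions: maps act on the right; $x^g=g^{-1}xg$; $c_g$ is conjugation by $g$. A finite tree $\mathcal{T}$ is viewed as a category with objects its vertices and edges and a morphism $f_{ev}:e\to v$ for each vertex $v$ incident on edge $e$. A tree of groups $(\mathcal{T},\mathcal{G})$ is a functor $\mathcal{G}$ from $\mathcal{T}$ to groups sending each $f_{ev}$ to a monomorphism; its completion $\mathcal{G}_\mathcal{T}$ is the colimit (iterated amalgamated free product), into which all $\mathcal{G}(v),\mathcal{G}(e)$ embed. For a group $G$ with finite $p$-subgroup $S$ that is Sylow (every finite $p$-subgroup of $G$ is conjugate into $S$), $\mathcal{F}_S(G)$ is the fusion system on $S$ with $\operatorname{Hom}(P,Q)$ the conjugation maps $c_g:P\to Q$, $g\in G$, $P^g\le Q$. A tree of fusion systems induced by $(\mathcal{T},\mathcal{G})$: choose $\mathcal{S}(v)\in\operatorname{Syl}_p(\mathcal{G}(v))$, $\mathcal{S}(e)\in\operatorname{Syl}_p(\mathcal{G}(e))$ and for $v$ incident on $e$ an element $g_{ev}\in\mathcal{G}(v)$ with $(\mathcal{S}(e)\mathcal{G}(f_{ev}))^{g_{ev}}\le\mathcal{S}(v)$; put $\mathcal{S}(f_{ev}):=\mathcal{G}(f_{ev})\circ c_{g_{ev}}|_{\mathcal{S}(e)}$, $\mathcal{F}(v)=\mathcal{F}_{\mathcal{S}(v)}(\mathcal{G}(v))$, $\mathcal{F}(e)=\mathcal{F}_{\mathcal{S}(e)}(\mathcal{G}(e))$. Hypothesis $(H)$: there is a vertex $v_*$ such that for each vertex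 $v\ne v_*$, with $e$ the edge at $v$ on the minimal path from $v$ to $v_*$, $\mathcal{S}(f_{ev})$ is an isomorphism $\mathcal{S}(e)\to\mathcal{S}(v)$. Under $(H)$, all $\mathcal{S}(v),\mathcal{S}(e)$ are identified with subgroups of $S=\mathcal{S}(v_* )$ via these isomorphisms and the maps $\mathcal{S}(f_{ev})$ (which become inclusions), and the completion is $\mathcal{F}_\mathcal{T}=\langle\operatorname{Hom}_{\mathcal{F}(v)}(P,\mathcal{S}(v))\mid P\le\mathcal{S}(v),v\in V(\mathcal{T})\rangle_S$, the smallest fusion system on $S$ containing every $\mathcal{F}(v)$. *)

theory Defs
  imports "HOL-Algebra.Algebra"
begin

definition gpath :: "'v set \<Rightarrow> 'v set set \<Rightarrow> 'v \<Rightarrow> 'v \<Rightarrow> 'v list \<Rightarrow> bool" where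
  "gpath V E a b xs \<longleftrightarrow> xs \<noteq> [] \<and> hd xs = a \<and> last xs = b \<and> distinct xs \<and> set xs \<subseteq> V \<and>
     (\<forall>i. Suc i < length xs \<longrightarrow> {xs ! i, xs ! Suc i} \<in> E)"

definition is_tree :: "'v set \<Rightarrow> 'v set set \<Rightarrow> bool" where
  "is_tree V E \<longleftrightarrow> finite V \<and> V \<noteq> {} \<and>
     (\<forall>e\<in>E. \<exists>v w. v \<in> V \<and> w \<in> V \<and> v \<noteq> w \<and> e = {v, w}) \<and>
     (\<forall>a\<in>V. \<forall>b\<in>V. \<exists>xs. gpath V E a b xs) \<and>
     \<not> (\<exists>xs. 3 \<le> length xs \<and> gpath V E (hd xs) (last xs) xs \<and> {last xs, hd xs} \<in> E)"

definition path_to :: "'v set \<Rightarrow> 'v set set \<Rightarrow> 'v \<Rightarrow> 'v \<Rightarrow> 'v list" where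
  "path_to V E v vs = (THE xs. gpath V E v vs xs)"

definition tree_of_groups ::
  "'v set \<Rightarrow> 'v set set \<Rightarrow> ('v \<Rightarrow> 'a monoid) \<Rightarrow> ('v set \<Rightarrow> 'a monoid)
     \<Rightarrow> ('v set \<Rightarrow> 'v \<Rightarrow> 'a \<Rightarrow> 'a) \<Rightarrow> bool" where
  "tree_of_groups V E Gv Ge phi \<longleftrightarrow> is_tree V E \<and>
     (\<forall>v\<in>V. group (Gv v)) \<and> (\<forall>e\<in>E. group (Ge e)) \<and>
     (\<forall>e\<in>E. \<forall>v\<in>e. phi e v \<in> hom (Ge e) (Gv v) \<and> inj_on (phi e v) (carrier (Ge e)))"

definition finite_groups :: "'v set \<Rightarrow> 'v set set \<Rightarrow> ('v \<Rightarrow> 'a monoid) \<Rightarrow> ('v set \<Rightarrow> 'a monoid) \<Rightarrow> bool" where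
  "finite_groups V E Gv Ge \<longleftrightarrow> (\<forall>v\<in>V. finite (carrier (Gv v))) \<and> (\<forall>e\<in>E. finite (carrier (Ge e)))"

definition valid_word :: "'v set \<Rightarrow> ('v \<Rightarrow> 'a monoid) \<Rightarrow> ('v \<times> 'a) list \<Rightarrow> bool" where
  "valid_word V Gv w \<longleftrightarrow> (\<forall>(v, g) \<in> set w. v \<in> V \<and> g \<in> carrier (Gv v))"

text \<open>The congruence defining the colimit (presentation of the iterated amalgamated
  free product): generators are the elements of all vertex groups, relations are
  the multiplication tables of the vertex groups and the identifications
  \<open>x \<G>(f_ev) = x \<G>(f_ew)\<close> for x in an edge group.\<close>

inductive amalg_eq for V :: "'v set" and E :: "'v set set" and Gv :: "'v \<Rightarrow> 'a monoid"
    and Ge :: "'v set \<Rightarrow> 'a monoid" and phi :: "'v set \<Rightarrow> 'v \<Rightarrow> 'a \<Rightarrow> 'a" where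
  ae_refl: "valid_word V Gv w \<Longrightarrow> amalg_eq V E Gv Ge phi w w"
| ae_sym: "amalg_eq V E Gv Ge phi w w' \<Longrightarrow> amalg_eq V E Gv Ge phi w' w"
| ae_trans: "amalg_eq V E Gv Ge phi w w' \<Longrightarrow> amalg_eq V E Gv Ge phi w' w''
     \<Longrightarrow> amalg_eq V E Gv Ge phi w w''"
| ae_ctx: "amalg_eq V E Gv Ge phi w w' \<Longrightarrow> valid_word V Gv u \<Longrightarrow> valid_word V Gv z
     \<Longrightarrow> amalg_eq V E Gv Ge phi (u @ w @ z) (u @ w' @ z)"
| ae_mult: "v \<in> V \<Longrightarrow> g \<in> carrier (Gv v) \<Longrightarrow> h \<in> carrier (Gv v)
     \<Longrightarrow> amalg_eq V E Gv Ge phi [(v, g), (v, h)] [(v, g \<otimes>\<^bsub>Gv v\<^esub> h)]"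
| ae_one: "v \<in> V \<Longrightarrow> amalg_eq V E Gv Ge phi [(v, \<one>\<^bsub>Gv v\<^esub>)] []"
| ae_edge: "e \<in> E \<Longrightarrow> v \<in> e \<Longrightarrow> w \<in> e \<Longrightarrow> x \<in> carrier (Ge e)
     \<Longrightarrow> amalg_eq V E Gv Ge phi [(v, phi e v x)] [(w, phi e w x)]"

definition completion ::
  "'v set \<Rightarrow> 'v set set \<Rightarrow> ('v \<Rightarrow> 'a monoid) \<Rightarrow> ('v set \<Rightarrow> 'a monoid)
     \<Rightarrow> ('v set \<Rightarrow> 'v \<Rightarrow> 'a \<Rightarrow> 'a) \<Rightarrow> ('v \<times> 'a) list set monoid" where
  "completion V E Gv Ge phi =
     \<lparr> carrier = {Collect (amalg_eq V E Gv Ge phi w) | w. valid_word V Gv w},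
       monoid.mult = (\<lambda>A B. {w. \<exists>a\<in>A. \<exists>b\<in>B. amalg_eq V E Gv Ge phi (a @ b) w}),
       monoid.one = Collect (amalg_eq V E Gv Ge phi []) \<rparr>"

definition completion_emb ::
  "'v set \<Rightarrow> 'v set set \<Rightarrow> ('v \<Rightarrow> 'a monoid) \<Rightarrow> ('v set \<Rightarrow> 'a monoid)
     \<Rightarrow> ('v set \<Rightarrow> 'v \<Rightarrow> 'a \<Rightarrow> 'a) \<Rightarrow> 'v \<Rightarrow> 'a \<Rightarrow> ('v \<times> 'a) list set" where
  "completion_emb V E Gv Ge phi v g = Collect (amalg_eq V E Gv Ge phi [(v, g)])"

definition conj :: "('a, 'b) monoid_scheme \<Rightarrow> 'a \<Rightarrow> 'a \<Rightarrow> 'a" where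
  "conj G g x = inv\<^bsub>G\<^esub> g \<otimes>\<^bsub>G\<^esub> x \<otimes>\<^bsub>G\<^esub> g"

definition finite_p_subgroup :: "('a, 'b) monoid_scheme \<Rightarrow> nat \<Rightarrow> 'a set \<Rightarrow> bool" where
  "finite_p_subgroup G p P \<longleftrightarrow> subgroup P G \<and> finite P \<and> (\<exists>n. card P = p ^ n)"

definition sylow_finite :: "('a, 'b) monoid_scheme \<Rightarrow> nat \<Rightarrow> 'a set \<Rightarrow> bool" where
  "sylow_finite G p P \<longleftrightarrow> subgroup P G \<and> (\<exists>n. card P = p ^ n) \<and> \<not> p dvd (order G div card P)"

definition sylow_gen :: "('a, 'b) monoid_scheme \<Rightarrow> nat \<Rightarrow> 'a set \<Rightarrow> bool" where
  "sylow_gen G p S \<longleftrightarrow> finite_p_subgroup G p S \<and>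
     (\<forall>P. finite_p_subgroup G p P \<longrightarrow> (\<exists>g\<in>carrier G. conj G g ` P \<subseteq> S))"

text \<open>A fusion system on a subgroup S of an ambient group H is represented as a set of
  triples (P, Q, phi), phi a morphism P \<rightarrow> Q (extensional: undefined outside P).\<close>

type_synonym 'a fmor = "'a set \<times> 'a set \<times> ('a \<Rightarrow> 'a)"

definition fusion_system :: "('a, 'b) monoid_scheme \<Rightarrow> 'a set \<Rightarrow> 'a fmor set \<Rightarrow> bool" where
  "fusion_system H S F \<longleftrightarrow>
     (\<forall>(P, Q, f) \<in> F. subgroup P H \<and> P \<subseteq> S \<and> subgroup Q H \<and> Q \<subseteq> S \<and>
        f ` P \<subseteq> Q \<and> inj_on f P \<and> (\<forall>x\<in>P. \<forall>y\<in>P. f (x \<otimes>\<^bsub>H\<^esub> y) = f x \<otimes>\<^bsub>H\<^esub> f y) \<and>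
        f = restrict f P) \<and>
     (\<forall>P Q s. subgroup P H \<and> P \<subseteq> S \<and> subgroup Q H \<and> Q \<subseteq> S \<and> s \<in> S \<and> conj H s ` P \<subseteq> Q
        \<longrightarrow> (P, Q, restrict (conj H s) P) \<in> F) \<and>
     (\<forall>P Q R f g. (P, Q, f) \<in> F \<and> (Q, R, g) \<in> F \<longrightarrow> (P, R, restrict (g \<circ> f) P) \<in> F) \<and>
     (\<forall>P Q f P' Q'. (P, Q, f) \<in> F \<and> subgroup P' H \<and> P' \<subseteq> P \<and> subgroup Q' H \<and> Q' \<subseteq> S \<and>
        f ` P' \<subseteq> Q' \<longrightarrow> (P', Q', restrict f P') \<in> F) \<and>
     (\<forall>P Q f. (P, Q, f) \<in> F \<longrightarrow> (f ` P, P, restrict (inv_into P f) (f ` P)) \<in> F)"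

definition gen_fusion :: "('a, 'b) monoid_scheme \<Rightarrow> 'a set \<Rightarrow> 'a fmor set \<Rightarrow> 'a fmor set" where
  "gen_fusion H S Gens = Complete_Lattices.Inf {F. fusion_system H S F \<and> Gens \<subseteq> F}"

definition fusion_of :: "('a, 'b) monoid_scheme \<Rightarrow> 'a set \<Rightarrow> 'a fmor set" where
  "fusion_of G S = {(P, Q, restrict (conj G g) P) | P Q g.
      subgroup P G \<and> P \<subseteq> S \<and> subgroup Q G \<and> Q \<subseteq> S \<and> g \<in> carrier G \<and> conj G g ` P \<subseteq> Q}"

definition map_fusion :: "('a \<Rightarrow> 'c) \<Rightarrow> 'a fmor set \<Rightarrow> 'c fmor set" where
  "map_fusion i F = {(i ` P, i ` Q, restrict (i \<circ> f \<circ> inv_into P i) (i ` P)) | P Q f. (P, Q, f) \<in> F}"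

definition Sf :: "('v \<Rightarrow> 'a monoid) \<Rightarrow> ('v set \<Rightarrow> 'v \<Rightarrow> 'a \<Rightarrow> 'a) \<Rightarrow> ('v set \<Rightarrow> 'a set)
     \<Rightarrow> ('v set \<Rightarrow> 'v \<Rightarrow> 'a) \<Rightarrow> 'v set \<Rightarrow> 'v \<Rightarrow> 'a \<Rightarrow> 'a" where
  "Sf Gv phi Se gg e v = restrict (\<lambda>x. conj (Gv v) (gg e v) (phi e v x)) (Se e)"

definition induced_tree_fusion ::
  "nat \<Rightarrow> 'v set \<Rightarrow> 'v set set \<Rightarrow> ('v \<Rightarrow> 'a monoid) \<Rightarrow> ('v set \<Rightarrow> 'a monoid)
     \<Rightarrow> ('v set \<Rightarrow> 'v \<Rightarrow> 'a \<Rightarrow> 'a) \<Rightarrow> ('v \<Rightarrow> 'a set) \<Rightarrow> ('v set \<Rightarrow> 'a set)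
     \<Rightarrow> ('v set \<Rightarrow> 'v \<Rightarrow> 'a) \<Rightarrow> bool" where
  "induced_tree_fusion p V E Gv Ge phi Sv Se gg \<longleftrightarrow>
     (\<forall>v\<in>V. sylow_finite (Gv v) p (Sv v)) \<and> (\<forall>e\<in>E. sylow_finite (Ge e) p (Se e)) \<and>
     (\<forall>e\<in>E. \<forall>v\<in>e. gg e v \<in> carrier (Gv v) \<and>
        (\<lambda>x. conj (Gv v) (gg e v) (phi e v x)) ` Se e \<subseteq> Sv v)"

definition hypH ::
  "'v set \<Rightarrow> 'v set set \<Rightarrow> ('v \<Rightarrow> 'a monoid) \<Rightarrow> ('v set \<Rightarrow> 'v \<Rightarrow> 'a \<Rightarrow> 'a)
     \<Rightarrow> ('v \<Rightarrow> 'a set) \<Rightarrow> ('v set \<Rightarrow> 'a set) \<Rightarrow> ('v set \<Rightarrow> 'v \<Rightarrow> 'a) \<Rightarrow> 'v \<Rightarrow> bool" where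
  "hypH V E Gv phi Sv Se gg vs \<longleftrightarrow> vs \<in> V \<and>
     (\<forall>v\<in>V. v \<noteq> vs \<longrightarrow>
        (let e = {path_to V E v vs ! 0, path_to V E v vs ! 1}
         in bij_betw (Sf Gv phi Se gg e v) (Se e) (Sv v)))"

text \<open>Identification of \<open>\<S>(v)\<close> with a subgroup of \<open>\<S>(v_*)\<close>: walk along the path
  from v to v_*, at each edge e = {x,y} (x nearer to v) applying
  \<open>\<S>(f_ex)\<^sup>-\<^sup>1\<close> followed by \<open>\<S>(f_ey)\<close>.\<close>

fun transport :: "('v \<Rightarrow> 'a monoid) \<Rightarrow> ('v set \<Rightarrow> 'v \<Rightarrow> 'a \<Rightarrow> 'a) \<Rightarrow> ('v set \<Rightarrow> 'a set)
     \<Rightarrow> ('v set \<Rightarrow> 'v \<Rightarrow> 'a) \<Rightarrow> 'v list \<Rightarrow> 'a \<Rightarrow> 'a" where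
  "transport Gv phi Se gg (x # y # rest) s =
     transport Gv phi Se gg (y # rest)
       (Sf Gv phi Se gg {x, y} y (inv_into (Se {x, y}) (Sf Gv phi Se gg {x, y} x) s))"
| "transport Gv phi Se gg xs s = s"

definition ident :: "'v set \<Rightarrow> 'v set set \<Rightarrow> ('v \<Rightarrow> 'a monoid) \<Rightarrow> ('v set \<Rightarrow> 'v \<Rightarrow> 'a \<Rightarrow> 'a)
     \<Rightarrow> ('v set \<Rightarrow> 'a set) \<Rightarrow> ('v set \<Rightarrow> 'v \<Rightarrow> 'a) \<Rightarrow> 'v \<Rightarrow> 'v \<Rightarrow> 'a \<Rightarrow> 'a" where
  "ident V E Gv phi Se gg vs v = transport Gv phi Se gg (path_to V E v vs)"

definition tree_fusion_gens ::
  "'v set \<Rightarrow> 'v set set \<Rightarrow> ('v \<Rightarrow> 'a monoid) \<Rightarrow> ('v set \<Rightarrow> 'v \<Rightarrow> 'a \<Rightarrow> 'a)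
     \<Rightarrow> ('v \<Rightarrow> 'a set) \<Rightarrow> ('v set \<Rightarrow> 'a set) \<Rightarrow> ('v set \<Rightarrow> 'v \<Rightarrow> 'a) \<Rightarrow> 'v \<Rightarrow> 'a fmor set" where
  "tree_fusion_gens V E Gv phi Sv Se gg vs =
     {(let psi = ident V E Gv phi Se gg vs v in
        (psi ` P, psi ` Sv v, restrict (psi \<circ> conj (Gv v) g \<circ> inv_into (Sv v) psi) (psi ` P)))
      | v P g. v \<in> V \<and> subgroup P (Gv v) \<and> P \<subseteq> Sv v \<and> g \<in> carrier (Gv v) \<and>
               conj (Gv v) g ` P \<subseteq> Sv v}"

definition tree_fusion_completion ::
  "'v set \<Rightarrow> 'v set set \<Rightarrow> ('v \<Rightarrow> 'a monoid) \<Rightarrow> ('v set \<Rightarrow> 'v \<Rightarrow> 'a \<Rightarrow> 'a)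
     \<Rightarrow> ('v \<Rightarrow> 'a set) \<Rightarrow> ('v set \<Rightarrow> 'a set) \<Rightarrow> ('v set \<Rightarrow> 'v \<Rightarrow> 'a) \<Rightarrow> 'v \<Rightarrow> 'a fmor set" where
  "tree_fusion_completion V E Gv phi Sv Se gg vs =
     gen_fusion (Gv vs) (Sv vs) (tree_fusion_gens V E Gv phi Sv Se gg vs)"

end

theory Submission
  imports Defs
begin

text \<open>
  Remove the vertices of the tree one at a time, a deepest one first: the completion is then an iterated
  amalgam of the completion of the smaller tree with one finite vertex group \<open>B\<close> over the edge group \<open>C\<close>.
  Van der Waerden's action on normal forms gives every amalgam a length function for reduced words, and this
  replaces the Bass-Serre tree. A finite subgroup is conjugate into a factor, because conjugating by
  the first letter of a longest element shortens it as long as elements of length at least two occur. If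
  a reduced word conjugates a subgroup of one factor into a factor, then all intermediate conjugates lie in \<open>C\<close>;
  moving them into a Sylow subgroup of \<open>C\<close> by elements of \<open>C\<close> writes the conjugation map as a
  composite of conjugations inside the two factors. Under the hypothesis \<open>(H)\<close> the Sylow subgroup of the removed
  vertex group is conjugate to that of \<open>C\<close>, so the Sylow subgroup of the root is never enlarged.
\<close>

section \<open>Conjugation and Sylow subgroups\<close>

text \<open>The completion is given only as a congruence on words, so even the injectivity of the
  vertex groups has to be proved. The induction therefore carries three statements at once
  (\<open>good\<close>): embedding of the vertex groups, the Sylow property and control of fusion.
  Write S for the Sylow subgroup at the root. Inside the completion another \<open>Sv v\<close> need
  not lie in S: the elements \<open>gg\<close> built into the tree of fusion systems make its
  identification with a subgroup of S a conjugation by some t (\<open>psi_conj\<close>), and an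
  element k of the vertex group acts on S as t^-1 k t. This is why the fusion argument for amalgams
  carries an extra element \<open>u\<close>, which moves a Sylow subgroup of the amalgamated
  subgroup into S. Control of fusion is stated for every fusion system on S containing the
  generators of the current subtree. In this form the statement for a smaller subtree can be used in
  a larger one, and intersecting all these systems gives the generated one. The opposite inclusion
  holds because conjugation maps of the completion between subgroups of S themselves form a fusion
  system containing the generators.\<close>

context group
begin

lemma inv_cancel_left [simp]:
  "g \<in> carrier G \<Longrightarrow> x \<in> carrier G \<Longrightarrow> g \<otimes> (inv g \<otimes> x) = x"
  "g \<in> carrier G \<Longrightarrow> x \<in> carrier G \<Longrightarrow> inv g \<otimes> (g \<otimes> x) = x"
  by (simp_all flip: m_assoc)

lemma conj_closed [simp]: "g \<in> carrier G \<Longrightarrow> x \<in> carrier G \<Longrightarrow> conj G g x \<in> carrier G"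
  by (simp add: conj_def)

lemma conj_one [simp]: "x \<in> carrier G \<Longrightarrow> conj G \<one> x = x"
  by (simp add: conj_def)

lemma conj_mult: "g \<in> carrier G \<Longrightarrow> h \<in> carrier G \<Longrightarrow> x \<in> carrier G
  \<Longrightarrow> conj G (g \<otimes> h) x = conj G h (conj G g x)"
  by (simp add: conj_def inv_mult_group m_assoc)

lemma conj_inv_cancel [simp]: "g \<in> carrier G \<Longrightarrow> x \<in> carrier G \<Longrightarrow> conj G (inv g) (conj G g x) = x"
  "g \<in> carrier G \<Longrightarrow> x \<in> carrier G \<Longrightarrow> conj G g (conj G (inv g) x) = x"
  by (simp_all flip: conj_mult)

lemma conj_distrib: "g \<in> carrier G \<Longrightarrow> x \<in> carrier G \<Longrightarrow> y \<in> carrier G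
  \<Longrightarrow> conj G g (x \<otimes> y) = conj G g x \<otimes> conj G g y"
  by (simp add: conj_def m_assoc inv_cancel_left)

lemma conj_hom: "g \<in> carrier G \<Longrightarrow> conj G g \<in> hom G G"
  by (auto intro!: homI simp: conj_distrib)

lemma inj_on_conj: "g \<in> carrier G \<Longrightarrow> inj_on (conj G g) (carrier G)"
  by (metis conj_inv_cancel(1) inj_on_inverseI)

lemma conj_image_mult: "g \<in> carrier G \<Longrightarrow> h \<in> carrier G \<Longrightarrow> A \<subseteq> carrier G
  \<Longrightarrow> conj G (g \<otimes> h) ` A = conj G h ` conj G g ` A"
  by (auto simp: conj_mult subset_eq image_iff)

lemma conj_image_one [simp]: "A \<subseteq> carrier G \<Longrightarrow> conj G \<one> ` A = A"
  by (auto simp: subset_eq image_iff)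

lemma conj_image_subset_carrier: "g \<in> carrier G \<Longrightarrow> A \<subseteq> carrier G \<Longrightarrow> conj G g ` A \<subseteq> carrier G"
  by auto

lemma conj_mem_subgroup: "subgroup K G \<Longrightarrow> g \<in> K \<Longrightarrow> x \<in> K \<Longrightarrow> conj G g x \<in> K"
  by (simp add: conj_def subgroup.m_closed subgroup.m_inv_closed)

lemma subgroup_conj: "subgroup P G \<Longrightarrow> g \<in> carrier G \<Longrightarrow> subgroup (conj G g ` P) G"
  by (rule group_hom.subgroup_img_is_subgroup) (simp_all add: conj_hom group_hom_def group_hom_axioms_def)

lemma finite_p_subgroup_conj:
  assumes "finite_p_subgroup G p P" "g \<in> carrier G"
  shows "finite_p_subgroup G p (conj G g ` P)"
  using assms
  by (auto simp: finite_p_subgroup_def subgroup_conj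
      card_image[OF inj_on_subset[OF inj_on_conj subgroup.subset]])

end

lemma hom_conj:
  assumes "group H" "group G" "f \<in> hom H G" "g \<in> carrier H" "x \<in> carrier H"
  shows "f (conj H g x) = conj G (f g) (f x)"
proof -
  interpret group_hom H G f using assms by (simp add: group_hom_def group_hom_axioms_def)
  show ?thesis using assms by (simp add: conj_def)
qed

text \<open>\<open>BijGroup\<close> consists of extensional bijections, hence the
  \<open>restrict\<close>; bijectivity is automatic because the inverse element acts as the inverse
  map.\<close>

lemma group_actionI:
  assumes "group G"
    and closed: "\<And>g x. g \<in> carrier G \<Longrightarrow> x \<in> A \<Longrightarrow> a g x \<in> A"
    and one: "\<And>x. x \<in> A \<Longrightarrow> a \<one>\<^bsub>G\<^esub> x = x"
    and mult: "\<And>g h x. g \<in> carrier G \<Longrightarrow> h \<in> carrier G \<Longrightarrow> x \<in> A \<Longrightarrow> a (g \<otimes>\<^bsub>G\<^esub> h) x = a g (a h x)"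
  shows "group_action G A (\<lambda>g. restrict (a g) A)"
proof -
  interpret group G by fact
  have bij: "restrict (a g) A \<in> Bij A" if g: "g \<in> carrier G" for g
  proof -
    have "bij_betw (a g) A A"
      using g closed one
      by (intro bij_betw_byWitness[where f' = "a (inv\<^bsub>G\<^esub> g)"]) (auto simp flip: mult)
    then show ?thesis by (simp add: Bij_def)
  qed
  have "(\<lambda>g. restrict (a g) A) \<in> hom G (BijGroup A)"
    by (rule homI) (auto simp: BijGroup_def bij compose_def mult closed)
  then show ?thesis
    by (simp add: group_action_def group_hom_def group_hom_axioms_def group_BijGroup is_group)
qed

lemma finite_p_subgroup_vimage:
  assumes "group H" "group G" "f \<in> hom H G" "inj_on f (carrier H)"
    and P: "finite_p_subgroup G p P" "P \<subseteq> f ` carrier H"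
  obtains Q where "finite_p_subgroup H p Q" "P = f ` Q"
proof -
  interpret group_hom H G f using assms by (simp add: group_hom_def group_hom_axioms_def)
  define Q where "Q = {x \<in> carrier H. f x \<in> P}"
  have sub: "subgroup P G" using P(1) by (simp add: finite_p_subgroup_def)
  have fQ: "P = f ` Q" using P(2) by (auto simp: Q_def)
  have inj: "inj_on f Q" using assms(4) by (auto simp: Q_def inj_on_def)
  have "subgroup Q H"
    using sub by unfold_locales (auto simp: Q_def subgroup.m_closed subgroup.one_closed subgroup.m_inv_closed)
  moreover have "finite Q" using inj P(1) fQ by (auto simp: finite_p_subgroup_def dest: finite_imageD)
  moreover have "\<exists>n. card Q = p ^ n" using P(1) fQ card_image[OF inj] by (auto simp: finite_p_subgroup_def)
  ultimately show thesis using fQ that by (simp add: finite_p_subgroup_def)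
qed

lemma finite_p_subgroup_image:
  assumes "group H" "group G" "f \<in> hom H G" "inj_on f (carrier H)" "finite_p_subgroup H p P"
  shows "finite_p_subgroup G p (f ` P)"
proof -
  interpret group_hom H G f using assms by (simp add: group_hom_def group_hom_axioms_def)
  have "inj_on f P" using assms(4,5) by (meson finite_p_subgroup_def inj_on_subset subgroup.subset)
  then show ?thesis using assms(5) by (simp add: finite_p_subgroup_def subgroup_img_is_subgroup card_image)
qed

text \<open>Imports the Sylow property of a group known only through an embedding: the removed
  vertex group, the completion of a subtree and the edge group all enter an amalgam this
  way.\<close>

lemma sylow_gen_image:
  assumes H: "group H" and G: "group G" and f: "f \<in> hom H G" "inj_on f (carrier H)"
    and T: "sylow_gen H p T" and P: "finite_p_subgroup G p P" "P \<subseteq> f ` carrier H"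
  obtains g where "g \<in> carrier H" "conj G (f g) ` P \<subseteq> f ` T"
proof -
  obtain Q where Q: "finite_p_subgroup H p Q" "P = f ` Q"
    using finite_p_subgroup_vimage[OF H G f P] .
  have "\<exists>g\<in>carrier H. conj H g ` Q \<subseteq> T" using T Q(1) unfolding sylow_gen_def by blast
  then obtain g where g: "g \<in> carrier H" "conj H g ` Q \<subseteq> T" by blast
  have QH: "x \<in> carrier H" if "x \<in> Q" for x
    using that Q(1) unfolding finite_p_subgroup_def by (meson subgroup.mem_carrier)
  have "conj G (f g) (f x) \<in> f ` T" if "x \<in> Q" for x
    using g(2) that hom_conj[OF H G f(1) g(1) QH[OF that]] by (metis image_subset_iff imageI)
  then have "conj G (f g) ` P \<subseteq> f ` T" unfolding Q(2) by blast
  then show thesis by (rule that[OF g(1)])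
qed

text \<open>A \<open>p\<close>-group acting on the cosets of a Sylow subgroup has a fixed point, because the number of cosets
  is prime to \<open>p\<close> while every nontrivial orbit has size divisible by \<open>p\<close>.\<close>
lemma (in group) sylow_finite_imp_sylow_gen:
  assumes fin: "finite (carrier G)" and p: "Factorial_Ring.prime p" and S: "sylow_finite G p S"
  shows "sylow_gen G p S"
  unfolding sylow_gen_def
proof (intro conjI allI impI)
  have subS: "subgroup S G" using S by (simp add: sylow_finite_def)
  show "finite_p_subgroup G p S"
    using S fin by (auto simp: sylow_finite_def finite_p_subgroup_def intro: finite_subset dest: subgroup.subset)
  fix P assume P: "finite_p_subgroup G p P"
  then have subP: "subgroup P G" by (simp add: finite_p_subgroup_def)
  have SG: "S \<subseteq> carrier G" and PG: "P \<subseteq> carrier G" using subS subP by (auto dest: subgroup.subset)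
  let ?X = "rcosets S" and ?P = "G\<lparr>carrier := P\<rparr>"
  \<comment> \<open>Right cosets carry a natural right action; multiplying by \<open>inv y\<close>
    turns it into a left one.\<close>
  define a where "a = (\<lambda>y C. C #> inv y)"
  have Xsub: "C \<subseteq> carrier G" if "C \<in> ?X" for C using that rcosets_part_G[OF subS] by blast
  have a_closed: "a y C \<in> ?X" if y: "y \<in> P" and C: "C \<in> ?X" for y C
  proof -
    obtain x where x: "x \<in> carrier G" "C = S #> x" using C by (auto simp: RCOSETS_def)
    have yG: "y \<in> carrier G" using y PG by blast
    have "a y C = S #> (x \<otimes> inv y)" using x yG SG by (simp add: a_def coset_mult_assoc)
    then show ?thesis using rcosetsI[OF SG, of "x \<otimes> inv y"] x(1) yG by simp
  qed
  interpret act: group_action ?P ?X "\<lambda>y. restrict (a y) ?X"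
  proof (rule group_actionI)
    show "group ?P" using subP by (rule subgroup.subgroup_is_group) (rule is_group)
    show "a (g \<otimes>\<^bsub>?P\<^esub> h) C = a g (a h C)" if "g \<in> carrier ?P" "h \<in> carrier ?P" "C \<in> ?X" for g h C
    proof -
      have "g \<in> carrier G" "h \<in> carrier G" using that PG by auto
      then show ?thesis using Xsub[OF that(3)] by (simp add: a_def coset_mult_assoc inv_mult_group)
    qed
    show "a g C \<in> ?X" if "g \<in> carrier ?P" "C \<in> ?X" for g C using that a_closed by simp
    show "a \<one>\<^bsub>?P\<^esub> C = C" if "C \<in> ?X" for C using Xsub[OF that] by (simp add: a_def)
  qed
  have finX: "finite ?X" using fin by (simp add: RCOSETS_def)
  have cardX: "\<not> p dvd card ?X"
  proof -
    have "card ?X * card S = order G" using lagrange[OF subS] by simp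
    moreover have "card S \<noteq> 0"
      using finite_subset[OF SG fin] subgroup.one_closed[OF subS] by auto
    ultimately have "order G div card S = card ?X" by (metis nonzero_mult_div_cancel_right)
    then show ?thesis using S by (simp add: sylow_finite_def)
  qed
  obtain n where n: "card P = p ^ n" using P by (auto simp: finite_p_subgroup_def)
  have "\<exists>orb \<in> orbits ?P ?X (\<lambda>y. restrict (a y) ?X). \<not> p dvd card orb"
  proof (rule ccontr)
    assume "\<not> ?thesis"
    then have "p dvd (\<Sum>orb\<in>orbits ?P ?X (\<lambda>y. restrict (a y) ?X). card orb)"
      by (intro dvd_sum) blast
    also have "\<dots> = card ?X" using act.disjoint_sum[OF finX, of "\<lambda>_. 1::nat"] by simp
    finally show False using cardX by blast
  qed
  then obtain C where C: "C \<in> ?X" "\<not> p dvd card (orbit ?P (\<lambda>y. restrict (a y) ?X) C)"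
    unfolding orbits_def by blast
  define ob where "ob = orbit ?P (\<lambda>y. restrict (a y) ?X) C"
  have "card ob * card (stabilizer ?P (\<lambda>y. restrict (a y) ?X) C) = card P"
    using act.orbit_stabilizer_theorem[OF C(1)] by (simp add: order_def ob_def)
  then have "card ob dvd p ^ n" unfolding n by (metis dvd_triv_left)
  then obtain k where k: "card ob = p ^ k" using divides_primepow_nat[OF p] by blast
  have "\<not> p dvd p ^ k" using C(2) k by (simp add: ob_def)
  then have "k = 0" by (cases k) auto
  then obtain z where z: "ob = {z}" using k by (metis card_1_singletonE power_0)
  have fix_C: "a y C = C" if "y \<in> P" for y
  proof -
    have "C \<in> ob" unfolding ob_def by (rule act.orbit_refl[OF C(1)])
    moreover have "a y C \<in> ob"
      unfolding ob_def orbit_def using that C(1) by (intro CollectI exI[of _ y]) simp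
    ultimately show ?thesis using z by simp
  qed
  obtain x where x: "x \<in> carrier G" "C = S #> x" using C(1) by (auto simp: RCOSETS_def)
  \<comment> \<open>Fixing the coset \<open>S #> x\<close> means that \<open>x \<otimes> y\<close>
    lies in it, that is, x y x^-1 is in S; in the present convention this is conjugation by
    \<open>inv x\<close>.\<close>
  have "conj G (inv x) y \<in> S" if y: "y \<in> P" for y
  proof -
    have yG: "y \<in> carrier G" using y PG by blast
    have iy: "inv y \<in> P" using subP y by (simp add: subgroup.m_inv_closed)
    have "C #> y = C" using fix_C[OF iy] yG by (simp add: a_def)
    then have "S #> (x \<otimes> y) = S #> x" using x yG SG by (simp add: coset_mult_assoc)
    moreover have "x \<otimes> y \<in> S #> (x \<otimes> y)" using subS x yG by (simp add: rcos_self)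
    ultimately obtain s where "s \<in> S" "x \<otimes> y = s \<otimes> x" by (auto simp: r_coset_def)
    then have "x \<otimes> y \<otimes> inv x = s" using x SG by (metis inv_solve_right' m_closed subsetD yG)
    then show ?thesis using x \<open>s \<in> S\<close> by (simp add: conj_def)
  qed
  then show "\<exists>g\<in>carrier G. conj G g ` P \<subseteq> S" using x by blast
qed

lemma (in group) finite_p_subgroup_subset:
  assumes T: "finite_p_subgroup G p T" and P: "subgroup P G" "P \<subseteq> T" and p: "Factorial_Ring.prime p"
  shows "finite_p_subgroup G p P"
proof -
  have T': "subgroup T G" "finite T" using T by (auto simp: finite_p_subgroup_def)
  obtain n where n: "card T = p ^ n" using T by (auto simp: finite_p_subgroup_def)
  have "group (G\<lparr>carrier := T\<rparr>)" by (rule subgroup.subgroup_is_group[OF T'(1) is_group])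
  moreover have "subgroup P (G\<lparr>carrier := T\<rparr>)" by (rule subgroup_incl[OF P(1) T'(1) P(2)])
  ultimately have "card (rcosets\<^bsub>G\<lparr>carrier := T\<rparr>\<^esub> P) * card P = card T"
    using group.lagrange by (fastforce simp: order_def)
  then have "card P dvd p ^ n" unfolding n by (metis dvd_triv_right)
  then show ?thesis
    using P T'(2) divides_primepow_nat[OF p] by (auto simp: finite_p_subgroup_def intro: finite_subset)
qed

text \<open>Followed by the injective \<open>i\<close>, the map \<open>h\<close> becomes
  \<open>k\<close> followed by a conjugation, so it inherits the properties of a homomorphism
  without being given as one. Used with \<open>K\<close> and \<open>H\<close> both the root group
  for morphisms, and with \<open>K\<close> another vertex group for the identifications
  \<open>psi v\<close>.\<close>

lemma conj_pullback:
  assumes K: "group K" and H: "group H" and G: "group G"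
    and i: "i \<in> hom H G" "inj_on i (carrier H)" and k: "k \<in> hom K G" and t: "t \<in> carrier G"
    and P: "subgroup P K" and h: "\<And>x. x \<in> P \<Longrightarrow> h x \<in> carrier H" "\<And>x. x \<in> P \<Longrightarrow> i (h x) = conj G t (k x)"
  shows "x \<in> P \<Longrightarrow> y \<in> P \<Longrightarrow> h (x \<otimes>\<^bsub>K\<^esub> y) = h x \<otimes>\<^bsub>H\<^esub> h y"
    and "subgroup (h ` P) H"
    and "inj_on k (carrier K) \<Longrightarrow> inj_on h P"
proof -
  interpret K: group K by fact
  interpret H: group H by fact
  interpret G: group G by fact
  have Pc: "x \<in> carrier K" if "x \<in> P" for x using that subgroup.mem_carrier[OF P] by blast
  have kc: "k x \<in> carrier G" if "x \<in> P" for x using hom_in_carrier[OF k Pc[OF that]] .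
  show mult: "h (x \<otimes>\<^bsub>K\<^esub> y) = h x \<otimes>\<^bsub>H\<^esub> h y" if x: "x \<in> P" and y: "y \<in> P" for x y
  proof (rule inj_onD[OF i(2)])
    have xy: "x \<otimes>\<^bsub>K\<^esub> y \<in> P" using subgroup.m_closed[OF P x y] .
    show "h (x \<otimes>\<^bsub>K\<^esub> y) \<in> carrier H" using h(1)[OF xy] .
    show "h x \<otimes>\<^bsub>H\<^esub> h y \<in> carrier H" using h(1) x y by simp
    show "i (h (x \<otimes>\<^bsub>K\<^esub> y)) = i (h x \<otimes>\<^bsub>H\<^esub> h y)"
      using h(2)[OF xy] hom_mult[OF k Pc[OF x] Pc[OF y]] hom_mult[OF i(1) h(1)[OF x] h(1)[OF y]] h(2) x y t kc
      by (simp add: G.conj_distrib)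
  qed
  interpret hh: group_hom "K\<lparr>carrier := P\<rparr>" H h
    using mult h(1) subgroup.subgroup_is_group[OF P K]
    by (auto simp: group_hom_def group_hom_axioms_def hom_def H)
  show "subgroup (h ` P) H" using hh.img_is_subgroup by simp
  show "inj_on h P" if "inj_on k (carrier K)"
  proof (rule inj_onI)
    fix x y assume xy: "x \<in> P" "y \<in> P" "h x = h y"
    then have "conj G t (k x) = conj G t (k y)" using h(2) by metis
    then have "k x = k y" using inj_onD[OF G.inj_on_conj[OF t]] kc xy by blast
    then show "x = y" using inj_onD[OF that] Pc xy by blast
  qed
qed


section \<open>Normal forms in amalgams of two groups\<close>

text \<open>Indexing the two factors by \<open>bool\<close> lets each argument be written once, with
  \<open>\<not> b\<close> for the opposite factor. The price is a common element type, so a vertex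
  group must later be copied into the type of word classes.\<close>

locale amalgam_factors =
  fixes H :: "bool \<Rightarrow> 'x monoid" and C :: "'c monoid" and \<kappa> :: "bool \<Rightarrow> 'c \<Rightarrow> 'x"
  assumes H_group: "group (H b)" and C_group: "group C"
    and \<kappa>_hom: "\<kappa> b \<in> hom C (H b)" and \<kappa>_inj: "inj_on (\<kappa> b) (carrier C)"
begin

definition core :: "bool \<Rightarrow> 'x set" where
  "core b = \<kappa> b ` carrier C"

text \<open>\<open>SOME\<close> sees only the coset, so the representative is constant on right
  cosets of the core. The core itself is represented by the identity, so that core elements
  contribute no letter to a normal word.\<close>

definition transversal :: "bool \<Rightarrow> 'x \<Rightarrow> 'x" where
  "transversal b x = (if x \<in> core b then \<one>\<^bsub>H b\<^esub> else SOME y. y \<in> core b #>\<^bsub>H b\<^esub> x)"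

text \<open>The component in \<open>C\<close> when \<open>x\<close> is factored into a core element
  and its coset representative; see \<open>coeff_eq\<close>.\<close>

definition coeff :: "bool \<Rightarrow> 'x \<Rightarrow> 'c" where
  "coeff b x = inv_into (carrier C) (\<kappa> b) (x \<otimes>\<^bsub>H b\<^esub> inv\<^bsub>H b\<^esub> transversal b x)"

lemma group_hom_\<kappa>: "group_hom C (H b) (\<kappa> b)"
  by (simp add: group_hom_def group_hom_axioms_def H_group C_group \<kappa>_hom)

lemma \<kappa>_closed [simp]: "c \<in> carrier C \<Longrightarrow> \<kappa> b c \<in> carrier (H b)"
  using \<kappa>_hom by (auto simp: hom_def)

lemma \<kappa>_mult: "c \<in> carrier C \<Longrightarrow> d \<in> carrier C \<Longrightarrow> \<kappa> b (c \<otimes>\<^bsub>C\<^esub> d) = \<kappa> b c \<otimes>\<^bsub>H b\<^esub> \<kappa> b d"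
  using \<kappa>_hom by (auto simp: hom_def)

lemma \<kappa>_one [simp]: "\<kappa> b \<one>\<^bsub>C\<^esub> = \<one>\<^bsub>H b\<^esub>"
  by (rule group_hom.hom_one[OF group_hom_\<kappa>])

lemma subgroup_core: "subgroup (core b) (H b)"
  unfolding core_def
  by (rule group_hom.subgroup_img_is_subgroup[OF group_hom_\<kappa>]) (rule group.subgroup_self[OF C_group])

lemma core_subset: "core b \<subseteq> carrier (H b)"
  by (rule subgroup.subset[OF subgroup_core])

lemma core_mult_iff:
  assumes "k \<in> core b" "x \<in> carrier (H b)"
  shows "k \<otimes>\<^bsub>H b\<^esub> x \<in> core b \<longleftrightarrow> x \<in> core b" "x \<otimes>\<^bsub>H b\<^esub> k \<in> core b \<longleftrightarrow> x \<in> core b"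
proof -
  interpret group "H b" by (rule H_group)
  have k: "k \<in> carrier (H b)" using assms core_subset by blast
  have "x = inv\<^bsub>H b\<^esub> k \<otimes>\<^bsub>H b\<^esub> (k \<otimes>\<^bsub>H b\<^esub> x)" "x = (x \<otimes>\<^bsub>H b\<^esub> k) \<otimes>\<^bsub>H b\<^esub> inv\<^bsub>H b\<^esub> k"
    using k assms by (simp_all add: m_assoc)
  then show "k \<otimes>\<^bsub>H b\<^esub> x \<in> core b \<longleftrightarrow> x \<in> core b" "x \<otimes>\<^bsub>H b\<^esub> k \<in> core b \<longleftrightarrow> x \<in> core b"
    using assms(1) subgroup_core[of b] by (metis subgroup.m_closed subgroup.m_inv_closed)+
qed

lemma transversal_mem:
  assumes "x \<in> carrier (H b)" shows "transversal b x \<in> core b #>\<^bsub>H b\<^esub> x"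
proof (cases "x \<in> core b")
  case True
  then have "core b #>\<^bsub>H b\<^esub> x = core b"
    using group.coset_join2[OF H_group _ subgroup_core] core_subset by blast
  then show ?thesis using True by (simp add: transversal_def subgroup.one_closed[OF subgroup_core])
next
  case False
  have "x \<in> core b #>\<^bsub>H b\<^esub> x" using group.rcos_self[OF H_group assms subgroup_core] .
  then show ?thesis using False by (simp add: transversal_def) (rule someI)
qed

lemma transversal_eq:
  assumes "x \<in> carrier (H b)"
  obtains k where "k \<in> core b" "transversal b x = k \<otimes>\<^bsub>H b\<^esub> x"
  using transversal_mem[OF assms] by (auto simp: r_coset_def)

lemma transversal_closed [simp]: "x \<in> carrier (H b) \<Longrightarrow> transversal b x \<in> carrier (H b)"
  by (metis transversal_eq core_subset subsetD H_group group.is_monoid monoid.m_closed)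

lemma transversal_core_mult:
  assumes "k \<in> core b" "x \<in> carrier (H b)"
  shows "transversal b (k \<otimes>\<^bsub>H b\<^esub> x) = transversal b x"
proof -
  interpret group "H b" by (rule H_group)
  have "core b #>\<^bsub>H b\<^esub> (k \<otimes>\<^bsub>H b\<^esub> x) = core b #>\<^bsub>H b\<^esub> x"
    using assms core_subset[of b] coset_join2[OF _ subgroup_core[of b], of k]
    by (metis coset_mult_assoc subsetD)
  then show ?thesis using assms by (simp add: transversal_def core_mult_iff)
qed

lemma transversal_core [simp]: "x \<in> core b \<Longrightarrow> transversal b x = \<one>\<^bsub>H b\<^esub>"
  by (simp add: transversal_def)

lemma transversal_idem [simp]: "x \<in> carrier (H b) \<Longrightarrow> transversal b (transversal b x) = transversal b x"
  by (metis transversal_eq transversal_core_mult)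

lemma transversal_in_core_iff: "x \<in> carrier (H b) \<Longrightarrow> transversal b x \<in> core b \<longleftrightarrow> x \<in> core b"
  by (metis transversal_eq core_mult_iff(1))

lemma coeff_unique:
  assumes "c \<in> carrier C" "x \<in> carrier (H b)" "x = \<kappa> b c \<otimes>\<^bsub>H b\<^esub> transversal b x"
  shows "coeff b x = c"
proof -
  interpret group "H b" by (rule H_group)
  have "x \<otimes>\<^bsub>H b\<^esub> inv\<^bsub>H b\<^esub> transversal b x = \<kappa> b c"
    using assms by (metis \<kappa>_closed inv_solve_right' transversal_closed)
  then show ?thesis using assms \<kappa>_inj by (simp add: coeff_def)
qed

lemma coeff_eq:
  assumes x: "x \<in> carrier (H b)"
  shows "coeff b x \<in> carrier C" "\<kappa> b (coeff b x) \<otimes>\<^bsub>H b\<^esub> transversal b x = x"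
proof -
  interpret group "H b" by (rule H_group)
  obtain k where k: "k \<in> core b" "transversal b x = k \<otimes>\<^bsub>H b\<^esub> x" using transversal_eq[OF x] .
  then have kG: "k \<in> carrier (H b)" using core_subset by blast
  have "inv\<^bsub>H b\<^esub> k \<in> core b" using k(1) subgroup_core by (simp add: subgroup.m_inv_closed)
  then obtain c where c: "c \<in> carrier C" "inv\<^bsub>H b\<^esub> k = \<kappa> b c" by (auto simp: core_def)
  have eq: "x = \<kappa> b c \<otimes>\<^bsub>H b\<^esub> transversal b x" using k kG x by (simp flip: c(2))
  have "coeff b x = c" by (rule coeff_unique[OF c(1) x eq])
  then show "coeff b x \<in> carrier C" "\<kappa> b (coeff b x) \<otimes>\<^bsub>H b\<^esub> transversal b x = x" using c(1) eq by auto
qed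

lemma \<kappa>_in_core [simp]: "c \<in> carrier C \<Longrightarrow> \<kappa> b c \<in> core b"
  by (simp add: core_def)

lemma coeff_mult:
  assumes "c \<in> carrier C" "x \<in> carrier (H b)"
  shows "coeff b (\<kappa> b c \<otimes>\<^bsub>H b\<^esub> x) = c \<otimes>\<^bsub>C\<^esub> coeff b x"
proof -
  interpret group "H b" by (rule H_group)
  interpret C: group C by (rule C_group)
  show ?thesis
    using assms coeff_eq[OF assms(2)]
    by (intro coeff_unique) (auto simp: transversal_core_mult \<kappa>_mult m_assoc)
qed

lemma coeff_\<kappa>: "c \<in> carrier C \<Longrightarrow> coeff b (\<kappa> b c) = c"
proof -
  interpret group "H b" by (rule H_group)
  show "c \<in> carrier C \<Longrightarrow> coeff b (\<kappa> b c) = c" by (rule coeff_unique) auto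
qed

lemma coeff_transversal:
  assumes "x \<in> carrier (H b)" "transversal b x = x" shows "coeff b x = \<one>\<^bsub>C\<^esub>"
proof -
  interpret group "H b" by (rule H_group)
  interpret C: group C by (rule C_group)
  show ?thesis using assms by (intro coeff_unique) auto
qed

definition starts :: "bool \<Rightarrow> (bool \<times> 'x) list \<Rightarrow> bool" where
  "starts b w \<longleftrightarrow> w \<noteq> [] \<and> fst (hd w) = b"

fun normal :: "(bool \<times> 'x) list \<Rightarrow> bool" where
  "normal [] = True"
| "normal ((b, t) # w) \<longleftrightarrow> t \<in> carrier (H b) \<and> t \<notin> core b \<and> transversal b t = t \<and> \<not> starts b w \<and> normal w"

text \<open>A pair \<open>(c, w)\<close> stands for the core element given by \<open>c\<close> times
  the letters of \<open>w\<close>. By the normal form theorem these are the elements of the amalgam;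
  here they are just a set on which the factors act.\<close>

definition states :: "('c \<times> (bool \<times> 'x) list) set" where
  "states = carrier C \<times> {w. normal w}"

definition join :: "bool \<Rightarrow> 'x \<Rightarrow> (bool \<times> 'x) list \<Rightarrow> 'c \<times> (bool \<times> 'x) list" where
  "join b x w = (coeff b x, if x \<in> core b then w else (b, transversal b x) # w)"

text \<open>Together with \<open>rest\<close> this inverts \<open>join b\<close>: it collects the
  part of a state, at its left end, that belongs to the factor \<open>b\<close>.\<close>

definition front :: "bool \<Rightarrow> 'c \<times> (bool \<times> 'x) list \<Rightarrow> 'x" where
  "front b s = (if starts b (snd s) then \<kappa> b (fst s) \<otimes>\<^bsub>H b\<^esub> snd (hd (snd s)) else \<kappa> b (fst s))"

definition rest :: "bool \<Rightarrow> 'c \<times> (bool \<times> 'x) list \<Rightarrow> (bool \<times> 'x) list" where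
  "rest b s = (if starts b (snd s) then tl (snd s) else snd s)"

text \<open>Van der Waerden's action on normal forms: \<open>join b\<close> identifies the set of all states with
  \<open>H b \<times> {normal words not starting in H b}\<close>, on which \<open>H b\<close> acts by left translation of the first factor.\<close>

definition act :: "bool \<Rightarrow> 'x \<Rightarrow> 'c \<times> (bool \<times> 'x) list \<Rightarrow> 'c \<times> (bool \<times> 'x) list" where
  "act b h s = join b (h \<otimes>\<^bsub>H b\<^esub> front b s) (rest b s)"

lemma front_closed: "s \<in> states \<Longrightarrow> front b s \<in> carrier (H b)"
  using monoid.m_closed[OF group.is_monoid[OF H_group]]
  by (cases s; cases "snd s") (auto simp: states_def front_def starts_def)

lemma rest_normal: "s \<in> states \<Longrightarrow> normal (rest b s) \<and> \<not> starts b (rest b s)"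
  by (cases s; cases "snd s") (auto simp: states_def rest_def starts_def)

lemma join_states: "x \<in> carrier (H b) \<Longrightarrow> normal w \<Longrightarrow> \<not> starts b w \<Longrightarrow> join b x w \<in> states"
  by (simp add: join_def states_def coeff_eq transversal_in_core_iff)

lemma front_join:
  assumes "x \<in> carrier (H b)" "\<not> starts b w"
  shows "front b (join b x w) = x" "rest b (join b x w) = w"
proof -
  interpret group "H b" by (rule H_group)
  show "rest b (join b x w) = w" using assms by (auto simp: rest_def join_def starts_def)
  show "front b (join b x w) = x"
  proof (cases "x \<in> core b")
    case True
    then obtain c where "c \<in> carrier C" "x = \<kappa> b c" by (auto simp: core_def)
    then show ?thesis using True assms(2) by (simp add: front_def join_def coeff_\<kappa>)
  next
    case False
    then show ?thesis using coeff_eq[OF assms(1)] by (simp add: front_def join_def starts_def)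
  qed
qed

lemma join_front:
  assumes "s \<in> states" shows "join b (front b s) (rest b s) = s"
proof -
  interpret group "H b" by (rule H_group)
  interpret C: group C by (rule C_group)
  obtain c w where s: "s = (c, w)" "c \<in> carrier C" "normal w" using assms by (auto simp: states_def)
  show ?thesis
  proof (cases "starts b w")
    case True
    then obtain t w' where w: "w = (b, t) # w'" by (cases w) (auto simp: starts_def)
    then show ?thesis using s
      by (simp add: front_def rest_def join_def starts_def core_mult_iff coeff_mult
          coeff_transversal transversal_core_mult)
  next
    case False
    then show ?thesis using s by (simp add: front_def rest_def join_def coeff_\<kappa>)
  qed
qed

lemma act_states: "h \<in> carrier (H b) \<Longrightarrow> s \<in> states \<Longrightarrow> act b h s \<in> states"
proof -
  interpret group "H b" by (rule H_group)
  show "h \<in> carrier (H b) \<Longrightarrow> s \<in> states \<Longrightarrow> act b h s \<in> states"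
    by (simp add: act_def join_states front_closed rest_normal)
qed

lemma act_one: "s \<in> states \<Longrightarrow> act b \<one>\<^bsub>H b\<^esub> s = s"
proof -
  interpret group "H b" by (rule H_group)
  show "s \<in> states \<Longrightarrow> act b \<one>\<^bsub>H b\<^esub> s = s" by (simp add: act_def front_closed join_front)
qed

lemma act_mult:
  "g \<in> carrier (H b) \<Longrightarrow> h \<in> carrier (H b) \<Longrightarrow> s \<in> states
    \<Longrightarrow> act b (g \<otimes>\<^bsub>H b\<^esub> h) s = act b g (act b h s)"
proof -
  interpret group "H b" by (rule H_group)
  show "g \<in> carrier (H b) \<Longrightarrow> h \<in> carrier (H b) \<Longrightarrow> s \<in> states
    \<Longrightarrow> act b (g \<otimes>\<^bsub>H b\<^esub> h) s = act b g (act b h s)"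
    by (simp add: act_def front_closed rest_normal front_join m_assoc)
qed

text \<open>The right side does not mention \<open>b\<close>: on the amalgamated subgroup the two
  actions agree, which is what gluing them to an action of the amalgam requires.\<close>

lemma act_\<kappa>:
  assumes "d \<in> carrier C" "s \<in> states"
  shows "act b (\<kappa> b d) s = (d \<otimes>\<^bsub>C\<^esub> fst s, snd s)"
proof -
  have "join b (\<kappa> b d \<otimes>\<^bsub>H b\<^esub> front b s) (rest b s)
    = (d \<otimes>\<^bsub>C\<^esub> fst (join b (front b s) (rest b s)), snd (join b (front b s) (rest b s)))"
    using assms front_closed[of s b]
    by (simp add: join_def coeff_mult core_mult_iff transversal_core_mult)
  then show ?thesis using assms by (simp add: act_def join_front)
qed

text \<open>With no letter of factor \<open>b\<close> in front, the front part is a core element;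
  its product with \<open>x\<close> stays outside the core and becomes a new letter. The letter
  count in \<open>alternating_Act\<close> rests on this.\<close>

lemma act_new_letter:
  assumes "x \<in> carrier (H b)" "x \<notin> core b" "s \<in> states" "\<not> starts b (snd s)"
  shows "\<exists>c t. act b x s = (c, (b, t) # snd s)"
  using assms by (auto simp: act_def front_def rest_def join_def core_mult_iff states_def)

lemma base_state: "(\<one>\<^bsub>C\<^esub>, []) \<in> states"
proof -
  interpret group C by (rule C_group)
  show ?thesis by (simp add: states_def)
qed

lemma act_base: "x \<in> carrier (H b) \<Longrightarrow> act b x (\<one>\<^bsub>C\<^esub>, []) = join b x []"
proof -
  interpret group "H b" by (rule H_group)
  show "x \<in> carrier (H b) \<Longrightarrow> act b x (\<one>\<^bsub>C\<^esub>, []) = join b x []"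
    by (simp add: act_def front_def rest_def starts_def)
qed

end

section \<open>Reduced words and the length function given by the action\<close>

definition (in monoid) word_prod :: "'a list \<Rightarrow> 'a" where
  "word_prod xs = foldr (\<otimes>) xs \<one>"

lemma (in monoid) word_prod_Nil [simp]: "word_prod [] = \<one>"
  by (simp add: word_prod_def)

lemma (in monoid) word_prod_Cons [simp]: "word_prod (x # xs) = x \<otimes> word_prod xs"
  by (simp add: word_prod_def)

lemma (in monoid) word_prod_closed [simp]: "set xs \<subseteq> carrier G \<Longrightarrow> word_prod xs \<in> carrier G"
  by (induction xs) auto

lemma (in monoid) word_prod_append:
  "set xs \<subseteq> carrier G \<Longrightarrow> set ys \<subseteq> carrier G \<Longrightarrow> word_prod (xs @ ys) = word_prod xs \<otimes> word_prod ys"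
  by (induction xs) (auto simp: m_assoc)

lemma (in group) word_prod_inv:
  "set xs \<subseteq> carrier G \<Longrightarrow> inv (word_prod xs) = word_prod (rev (map (m_inv G) xs))"
  by (induction xs) (auto simp: word_prod_append inv_mult_group subset_eq)

text \<open>Reduced words in the sense of amalgams: no letter lies in the amalgamated subgroup. The
  empty word counts as starting in either factor.\<close>

fun alternating :: "(bool \<Rightarrow> 'g set) \<Rightarrow> bool \<Rightarrow> 'g list \<Rightarrow> bool" where
  "alternating F b [] = True"
| "alternating F b (x # xs) \<longleftrightarrow> x \<in> F b \<and> x \<notin> F (\<not> b) \<and> alternating F (\<not> b) xs"

lemma alternating_subset: "alternating F b xs \<Longrightarrow> (\<And>b. F b \<subseteq> A) \<Longrightarrow> set xs \<subseteq> A"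
  by (induction xs arbitrary: b) auto

text \<open>A group that receives both factors and acts on the normal forms so as to extend both
  actions \<open>act b\<close>. For the completion such an action comes from the universal
  property.\<close>

locale amalgam_action = amalgam_factors H C \<kappa> + group G
  for H :: "bool \<Rightarrow> 'x monoid" and C :: "'c monoid" and \<kappa> and G :: "'g monoid" (structure) +
  fixes I :: "bool \<Rightarrow> 'x \<Rightarrow> 'g" and Act :: "'g \<Rightarrow> 'c \<times> (bool \<times> 'x) list \<Rightarrow> 'c \<times> (bool \<times> 'x) list"
  assumes I_hom: "I b \<in> hom (H b) G"
    and I_\<kappa>: "c \<in> carrier C \<Longrightarrow> I True (\<kappa> True c) = I False (\<kappa> False c)"
    and Act_mult: "x \<in> carrier G \<Longrightarrow> y \<in> carrier G \<Longrightarrow> s \<in> states \<Longrightarrow> Act (x \<otimes> y) s = Act x (Act y s)"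
    and Act_I: "h \<in> carrier (H b) \<Longrightarrow> s \<in> states \<Longrightarrow> Act (I b h) s = act b h s"
begin

definition factor :: "bool \<Rightarrow> 'g set" where
  "factor b = I b ` carrier (H b)"

text \<open>Defined for every element through the image of the base state, so that well-definedness
  does not presuppose uniqueness of normal forms.\<close>

definition len :: "'g \<Rightarrow> nat" where
  "len g = length (snd (Act g (\<one>\<^bsub>C\<^esub>, [])))"

lemma group_hom_I: "group_hom (H b) G (I b)"
  by (simp add: group_hom_def group_hom_axioms_def H_group is_group I_hom)

lemma I_closed [simp]: "h \<in> carrier (H b) \<Longrightarrow> I b h \<in> carrier G"
  using I_hom by (auto simp: hom_def)

text \<open>Acting on the base state, an element \<open>x\<close> of a factor produces
  \<open>join b x []\<close>, from which \<open>front\<close> recovers \<open>x\<close>.\<close>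

lemma I_inj: "inj_on (I b) (carrier (H b))"
proof (rule inj_onI)
  fix x y assume xy: "x \<in> carrier (H b)" "y \<in> carrier (H b)" "I b x = I b y"
  then have "join b x [] = join b y []" using Act_I[OF _ base_state] by (metis act_base)
  then show "x = y" using xy front_join(1)[of _ b "[]"] by (metis starts_def)
qed

text \<open>An element outside the core moves the base state to a one-letter word that records its
  factor; an element of the other factor can never produce that word.\<close>

lemma I_eq_imp_core:
  assumes x: "x \<in> carrier (H b)" and y: "y \<in> carrier (H (\<not> b))" and eq: "I b x = I (\<not> b) y"
  shows "x \<in> core b"
proof -
  have "join b x [] = join (\<not> b) y []"
    using Act_I[OF x base_state] Act_I[OF y base_state] x y eq by (simp add: act_base)
  then show ?thesis by (auto simp: join_def split: if_splits)
qed

lemma subgroup_factor: "subgroup (factor b) G"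
  unfolding factor_def
  by (rule group_hom.subgroup_img_is_subgroup[OF group_hom_I]) (rule group.subgroup_self[OF H_group])

lemma I_core: "I b ` core b = factor True \<inter> factor False"
proof -
  have eq: "I b ` core b = I True ` core True" for b
    using I_\<kappa> by (cases b) (auto simp: core_def image_image)
  have "I b ` core b \<subseteq> factor b" for b using core_subset by (auto simp: factor_def)
  then have "I True ` core True \<subseteq> factor True \<inter> factor False" using eq by (metis Int_greatest)
  moreover have "factor True \<inter> factor False \<subseteq> I True ` core True"
    using I_eq_imp_core[of _ True] by (auto simp: factor_def)
  ultimately show ?thesis using eq by blast
qed

text \<open>Letters act from right to left, and each one meets a state that does not start in its
  own factor. The trailing core element \<open>z\<close> only changes the coefficient of the base
  state.\<close>

lemma alternating_Act:
  assumes "alternating factor b xs" "z \<in> factor True \<inter> factor False"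
  shows "\<exists>c w. Act (word_prod xs \<otimes> z) (\<one>\<^bsub>C\<^esub>, []) = (c, w) \<and> (c, w) \<in> states \<and> length w = length xs
    \<and> (xs \<noteq> [] \<longrightarrow> starts b w)"
  using assms(1)
proof (induction xs arbitrary: b)
  case Nil
  interpret C: group C by (rule C_group)
  obtain d where d: "d \<in> carrier C" "z = I True (\<kappa> True d)" using assms(2) I_core[of True]
    by (auto simp: core_def)
  then have "Act z (\<one>\<^bsub>C\<^esub>, []) = (d, [])" using base_state by (simp add: Act_I act_\<kappa>)
  then show ?case using d by (auto simp: states_def)
next
  case (Cons x xs)
  have "x \<in> factor b" using Cons.prems by simp
  then obtain h where h: "h \<in> carrier (H b)" "x = I b h" by (auto simp: factor_def)
  have "h \<notin> core b"
  proof
    assume "h \<in> core b"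
    then have "x \<in> factor True \<inter> factor False" using h I_core[of b] by auto
    then show False using Cons.prems by (cases b) auto
  qed
  have xs: "set xs \<subseteq> carrier G"
    using Cons.prems by (auto intro: alternating_subset[THEN subsetD] subgroup.mem_carrier[OF subgroup_factor])
  have z: "z \<in> carrier G" using assms(2) subgroup.subset[OF subgroup_factor] by blast
  obtain c w where cw: "Act (word_prod xs \<otimes> z) (\<one>\<^bsub>C\<^esub>, []) = (c, w)" "(c, w) \<in> states"
    "length w = length xs" "xs \<noteq> [] \<longrightarrow> starts (\<not> b) w"
    using Cons.IH[of "\<not> b"] Cons.prems by auto
  have nb: "\<not> starts b w" using cw(3,4) by (cases "xs = []") (auto simp: starts_def)
  have "Act (word_prod (x # xs) \<otimes> z) (\<one>\<^bsub>C\<^esub>, []) = Act x (c, w)"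
    using xs z h base_state by (simp add: m_assoc Act_mult cw(1))
  also have "\<dots> = act b h (c, w)" using h cw(2) by (simp add: Act_I)
  finally have A: "Act (word_prod (x # xs) \<otimes> z) (\<one>\<^bsub>C\<^esub>, []) = act b h (c, w)" .
  obtain c' t where "act b h (c, w) = (c', (b, t) # w)"
    using act_new_letter[OF h(1) \<open>h \<notin> core b\<close> cw(2)] nb by auto
  then show ?case using A act_states[OF h(1) cw(2)] cw(3) by (auto simp: starts_def)
qed

lemma len_alternating:
  "alternating factor b xs \<Longrightarrow> z \<in> factor True \<inter> factor False \<Longrightarrow> len (word_prod xs \<otimes> z) = length xs"
  using alternating_Act unfolding len_def by fastforce

end

section \<open>Finite subgroups and fusion in an amalgam\<close>

lemma alternating_append:
  "alternating F b (xs @ ys) \<longleftrightarrow> alternating F b xs \<and> alternating F (b = even (length xs)) ys"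
proof (induction xs arbitrary: b)
  case (Cons x xs)
  have "((\<not> b) = even (length xs)) = (b = even (length (x # xs)))" by auto
  then show ?case using Cons.IH[of "\<not> b"] by simp
qed simp

text \<open>All that the following arguments use of an amalgam: two subgroups generating the group
  and a function counting the letters of reduced words. The amalgamated subgroup appears as the
  intersection of the two.\<close>

locale amalgam_length = group G for G (structure) +
  fixes F :: "bool \<Rightarrow> 'a set" and len :: "'a \<Rightarrow> nat"
  assumes F_subgroup: "subgroup (F b) G"
    and F_generate: "carrier G = generate G (F True \<union> F False)"
    and len_alternating: "alternating F b xs \<Longrightarrow> z \<in> F True \<inter> F False \<Longrightarrow> len (word_prod xs \<otimes> z) = length xs"
begin

abbreviation core :: "'a set" where
  "core \<equiv> F True \<inter> F False"

lemma F_carrier: "x \<in> F b \<Longrightarrow> x \<in> carrier G"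
  by (rule subgroup.mem_carrier[OF F_subgroup])

lemma core_carrier: "x \<in> core \<Longrightarrow> x \<in> carrier G"
  using F_carrier by blast

lemma core_iff: "x \<in> core \<longleftrightarrow> x \<in> F b \<and> x \<in> F (\<not> b)"
  by (cases b) auto

lemma F_mult: "x \<in> F b \<Longrightarrow> y \<in> F b \<Longrightarrow> x \<otimes> y \<in> F b"
  by (rule subgroup.m_closed[OF F_subgroup])

lemma F_inv: "x \<in> F b \<Longrightarrow> inv x \<in> F b"
  by (rule subgroup.m_inv_closed[OF F_subgroup])

lemma F_one [simp]: "\<one> \<in> F b"
  by (rule subgroup.one_closed[OF F_subgroup])

lemma F_inv_iff: "x \<in> carrier G \<Longrightarrow> inv x \<in> F b \<longleftrightarrow> x \<in> F b"
  using F_inv inv_inv by metis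

lemma F_mult_iff:
  assumes "y \<in> F b" "x \<in> carrier G"
  shows "x \<otimes> y \<in> F b \<longleftrightarrow> x \<in> F b" "y \<otimes> x \<in> F b \<longleftrightarrow> x \<in> F b"
proof -
  have y: "y \<in> carrier G" using F_carrier assms by blast
  have "x = x \<otimes> y \<otimes> inv y" "x = inv y \<otimes> (y \<otimes> x)" using assms(2) y by (simp_all add: m_assoc)
  then show "x \<otimes> y \<in> F b \<longleftrightarrow> x \<in> F b" "y \<otimes> x \<in> F b \<longleftrightarrow> x \<in> F b"
    using assms(1) F_mult F_inv by metis+
qed

lemma F_conj: "g \<in> F b \<Longrightarrow> x \<in> F b \<Longrightarrow> conj G g x \<in> F b"
  by (rule conj_mem_subgroup[OF F_subgroup])

lemma F_conj_iff: "g \<in> F b \<Longrightarrow> x \<in> carrier G \<Longrightarrow> conj G g x \<in> F b \<longleftrightarrow> x \<in> F b"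
  using F_conj F_inv F_carrier conj_inv_cancel(1) by metis

lemma alternating_carrier: "alternating F b xs \<Longrightarrow> set xs \<subseteq> carrier G"
  by (rule alternating_subset) (auto intro: F_carrier)

lemma word_prod_F_carrier: "alternating F b xs \<Longrightarrow> word_prod xs \<in> carrier G"
  by (simp add: alternating_carrier)

lemma len_word: "alternating F b xs \<Longrightarrow> len (word_prod xs) = length xs"
  using len_alternating[of b xs \<one>] by (simp add: word_prod_F_carrier)

lemma len_core: "z \<in> core \<Longrightarrow> len z = 0"
  using len_alternating[of True "[]" z] core_carrier by simp

definition nf :: "'a \<Rightarrow> nat \<Rightarrow> bool" where
  "nf g n \<longleftrightarrow> (\<exists>b xs z. alternating F b xs \<and> z \<in> core \<and> g = word_prod xs \<otimes> z \<and> length xs = n)"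

lemma nf_len: "nf g n \<Longrightarrow> len g = n"
  by (auto simp: nf_def len_alternating)

lemma nf_core_mult:
  assumes "c \<in> core" "nf g n" shows "nf (c \<otimes> g) n"
proof -
  obtain b xs z where g: "alternating F b xs" "z \<in> core" "g = word_prod xs \<otimes> z" "length xs = n"
    using assms by (auto simp: nf_def)
  have cz: "c \<in> carrier G" "z \<in> carrier G" using assms g core_carrier by auto
  show ?thesis
  proof (cases xs)
    case Nil
    then show ?thesis using g assms cz
      by (auto simp: nf_def F_mult intro!: exI[of _ "[]"] exI[of _ "c \<otimes> z"])
  next
    case (Cons y ys)
    have y: "y \<in> F b" "y \<notin> F (\<not> b)" "alternating F (\<not> b) ys" using g(1) Cons by auto
    then have "c \<otimes> y \<in> F b" "c \<otimes> y \<notin> F (\<not> b)"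
      using assms(1) F_carrier by (cases b; simp add: F_mult_iff F_mult)+
    then have "alternating F b ((c \<otimes> y) # ys)" using y by simp
    moreover have "c \<otimes> g = word_prod ((c \<otimes> y) # ys) \<otimes> z"
      using g(3) Cons cz F_carrier[OF y(1)] word_prod_F_carrier[OF y(3)] by (simp add: m_assoc)
    ultimately show ?thesis
      unfolding nf_def using g(2,4) Cons by (metis length_Cons)
  qed
qed

text \<open>The new element is absorbed as a core element, becomes a new first letter, merges with
  the first letter, or merges with it to a core element that the remaining word absorbs.\<close>

lemma nf_F_mult:
  assumes x: "x \<in> F d" and "nf g n" shows "\<exists>m \<le> Suc n. nf (x \<otimes> g) m"
proof (cases "x \<in> F (\<not> d)")
  case True
  then have "x \<in> core" using x core_iff by blast
  then show ?thesis using nf_core_mult assms(2) le_SucI by blast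
next
  case False
  obtain b xs z where g: "alternating F b xs" "z \<in> core" "g = word_prod xs \<otimes> z" "length xs = n"
    using assms by (auto simp: nf_def)
  have xz: "x \<in> carrier G" "z \<in> carrier G" using x g F_carrier by auto
  show ?thesis
  proof (cases "xs = [] \<or> b \<noteq> d")
    case True
    then have "alternating F d (x # xs)" using x False g(1) by auto
    moreover have "x \<otimes> g = word_prod (x # xs) \<otimes> z"
      using g xz word_prod_F_carrier[OF g(1)] by (simp add: m_assoc)
    ultimately show ?thesis unfolding nf_def using g(2,4) by (intro exI[of _ "Suc n"]) (metis le_refl length_Cons)
  next
    case False
    then obtain y ys where xs: "xs = y # ys" "b = d" by (cases xs) auto
    have y: "y \<in> F d" "y \<notin> F (\<not> d)" "alternating F (\<not> d) ys" using g(1) xs by auto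
    have eq: "x \<otimes> g = (x \<otimes> y) \<otimes> (word_prod ys \<otimes> z)"
      using g(3) xs xz F_carrier[OF y(1)] word_prod_F_carrier[OF y(3)] by (simp add: m_assoc)
    have ys: "nf (word_prod ys \<otimes> z) (n - 1)" unfolding nf_def using y(3) g(2,4) xs(1) by (metis diff_Suc_1 length_Cons)
    show ?thesis
    proof (cases "x \<otimes> y \<in> F (\<not> d)")
      case True
      then have "x \<otimes> y \<in> core" using F_mult[OF x y(1)] core_iff by blast
      from nf_core_mult[OF this ys] show ?thesis using eq by (metis diff_le_self le_SucI)
    next
      case False
      then have "alternating F d ((x \<otimes> y) # ys)" using y F_mult[OF x y(1)] by simp
      moreover have "x \<otimes> g = word_prod ((x \<otimes> y) # ys) \<otimes> z"
        using eq xz F_carrier[OF y(1)] word_prod_F_carrier[OF y(3)] by (simp add: m_assoc)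
      ultimately have "nf (x \<otimes> g) n" unfolding nf_def using g(2,4) xs by (metis length_Cons)
      then show ?thesis by (meson le_SucI le_refl)
    qed
  qed
qed

lemma nf_one: "nf \<one> 0"
  unfolding nf_def by (intro exI[of _ True] exI[of _ "[]"] exI[of _ \<one>]) simp

lemma nf_exists: "g \<in> carrier G \<Longrightarrow> \<exists>n. nf g n"
proof -
  have sub: "F True \<union> F False \<subseteq> carrier G" using F_carrier by blast
  have "\<exists>m. nf (g \<otimes> h) m" if "g \<in> generate G (F True \<union> F False)" "nf h n" "h \<in> carrier G" for g h n
    using that
  proof (induction arbitrary: h n rule: generate.induct)
    case one
    then show ?case by auto
  next
    case (incl x)
    then obtain d where "x \<in> F d" by blast
    then show ?case using nf_F_mult incl by blast
  next
    case (inv x)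
    then obtain d where "x \<in> F d" by blast
    then have "inv x \<in> F d" by (rule F_inv)
    then show ?case using nf_F_mult inv by blast
  next
    case (eng x y)
    have xy: "x \<in> carrier G" "y \<in> carrier G" using eng.hyps F_generate by auto
    obtain m where "nf (y \<otimes> h) m" using eng.IH(2) eng.prems by blast
    then have "\<exists>m. nf (x \<otimes> (y \<otimes> h)) m" using eng.IH(1) eng.prems xy by auto
    then show ?case using xy eng.prems by (simp add: m_assoc)
  qed
  then show "g \<in> carrier G \<Longrightarrow> \<exists>n. nf g n" using nf_one F_generate by (metis one_closed r_one)
qed

text \<open>The core element at the end of a normal form can be absorbed by the last letter; only
  elements without letters must be kept apart.\<close>

lemma word_cases:
  assumes "g \<in> carrier G"
  obtains (core) "g \<in> core" | (word) b xs where "xs \<noteq> []" "alternating F b xs" "g = word_prod xs"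
proof -
  obtain b xs z where g: "alternating F b xs" "z \<in> core" "g = word_prod xs \<otimes> z"
    using nf_exists[OF assms] by (auto simp: nf_def)
  have z: "z \<in> carrier G" using g core_carrier by auto
  show thesis
  proof (cases xs rule: rev_cases)
    case Nil
    then show thesis using core g z by simp
  next
    case (snoc ys y)
    let ?d = "b = even (length ys)"
    have y: "alternating F b ys" "y \<in> F ?d" "y \<notin> F (\<not> ?d)" using g(1) by (auto simp: snoc alternating_append)
    have yG: "y \<in> carrier G" using F_carrier[OF y(2)] .
    have zF: "z \<in> F d" for d using g(2) by (cases d) auto
    have "y \<otimes> z \<in> F ?d" "y \<otimes> z \<notin> F (\<not> ?d)"
      using y F_mult_iff(1)[OF zF yG] by blast+
    then have "alternating F b (ys @ [y \<otimes> z])" using y by (simp add: alternating_append)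
    moreover have "g = word_prod (ys @ [y \<otimes> z])"
      using g(3) snoc yG z alternating_carrier[OF y(1)] by (simp add: word_prod_append m_assoc)
    ultimately show thesis using word by blast
  qed
qed

lemma len_F_mult: "x \<in> F d \<Longrightarrow> g \<in> carrier G \<Longrightarrow> len (x \<otimes> g) \<le> Suc (len g)"
  using nf_exists nf_F_mult nf_len by metis

lemma len_core_mult: "c \<in> core \<Longrightarrow> g \<in> carrier G \<Longrightarrow> len (c \<otimes> g) = len g"
  using nf_exists nf_core_mult nf_len by metis

lemma len_word_prod_le: "set xs \<subseteq> F True \<union> F False \<Longrightarrow> len (word_prod xs) \<le> length xs"
proof (induction xs)
  case Nil
  then show ?case using len_core[of \<one>] by simp
next
  case (Cons x xs)
  then obtain d where d: "x \<in> F d" by auto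
  have "set xs \<subseteq> carrier G" using Cons.prems F_carrier by auto
  then show ?case using len_F_mult[OF d, of "word_prod xs"] Cons by simp
qed

lemma len_F: "x \<in> F b \<Longrightarrow> len x \<le> 1"
  using len_word_prod_le[of "[x]"] F_carrier by (cases b) auto

lemma len_le_1_imp_F:
  assumes "g \<in> carrier G" "len g \<le> 1" shows "g \<in> F True \<union> F False"
  using assms(1)
proof (cases rule: word_cases)
  case (word b xs)
  then have "length xs \<le> 1" using len_word assms(2) by metis
  then obtain x where "xs = [x]" using word(1) by (cases xs) auto
  then show ?thesis using word F_carrier by (cases b) auto
qed auto

text \<open>The classical reason why a group is not the union of two proper subgroups, in terms of
  length: an element outside \<open>F True\<close> and one outside \<open>F False\<close> multiply
  to a reduced word with two letters.\<close>

lemma subgroup_of_union: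
  assumes P: "subgroup P G" and "\<And>k. k \<in> P \<Longrightarrow> len k \<le> 1"
  shows "\<exists>b. P \<subseteq> F b"
proof (rule ccontr)
  assume "\<not> ?thesis"
  then obtain x y where xy: "x \<in> P" "x \<notin> F True" "y \<in> P" "y \<notin> F False" by blast
  then have "x \<in> F False" "y \<in> F True"
    using assms len_le_1_imp_F subgroup.mem_carrier[OF P] by blast+
  then have "alternating F False [x, y]" using xy by simp
  from len_word[OF this] have "len (x \<otimes> y) = 2"
    using xy subgroup.mem_carrier[OF P] by simp
  then show False using assms(2)[of "x \<otimes> y"] subgroup.m_closed[OF P] xy by force
qed

text \<open>The length bound on the products with the longest element \<open>h\<close> forces every element of length at least two
  to begin with the same coset \<open>y core\<close> as \<open>h\<close> and to end in the factor of \<open>y\<close>; conjugation by \<open>y\<close> shortens it.\<close>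
lemma conj_shortens:
  assumes P: "subgroup P G" and bound: "\<And>k. k \<in> P \<Longrightarrow> len k \<le> Suc M" and M: "M \<ge> 1"
    and h: "h \<in> P" "len h = Suc M"
  shows "\<exists>y\<in>carrier G. \<forall>k\<in>P. len (conj G y k) \<le> M"
proof -
  have PG: "k \<in> carrier G" if "k \<in> P" for k using subgroup.mem_carrier[OF P] that .
  obtain b xs where xs: "xs \<noteq> []" "alternating F b xs" "h = word_prod xs"
    using PG[OF h(1)]
  proof (cases rule: word_cases)
    case core
    then show thesis using len_core h(2) by simp
  qed (rule that)
  have lxs: "length xs = Suc M" using xs len_word h(2) by metis
  obtain us e where us: "xs = us @ [e]" using xs(1) by (cases xs rule: rev_cases) auto
  define d where "d = (b = even (length us))"
  have e: "e \<in> F d" "e \<notin> F (\<not> d)" "alternating F b us" using xs(2) by (auto simp: us alternating_append d_def)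
  have dxs: "d = (b \<noteq> even (length xs))" by (auto simp: d_def us)
  \<comment> \<open>If a member of \<open>P\<close> began in the factor other than that of
    \<open>e\<close>, the last letter of \<open>h\<close>, appending it to \<open>h\<close> would
    give a reduced word longer than the bound.\<close>
  have start: "d' = d" if zs: "zs \<noteq> []" "alternating F d' zs" "word_prod zs \<in> P" for d' zs
  proof (rule ccontr)
    assume "d' \<noteq> d"
    then have "(b = even (length xs)) = d'" using dxs by blast
    then have "alternating F b (xs @ zs)" using xs(2) zs(2) by (simp add: alternating_append)
    then have "len (h \<otimes> word_prod zs) = length xs + length zs"
      using len_word xs(3) alternating_carrier[OF xs(2)] alternating_carrier[OF zs(2)]
      by (metis length_append word_prod_append)
    moreover have "h \<otimes> word_prod zs \<in> P" using subgroup.m_closed[OF P] h zs by blast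
    ultimately show False using bound lxs zs(1) by fastforce
  qed
  have bd: "b = d" using start[OF xs(1,2)] xs(3) h(1) by simp
  have eG: "e \<in> carrier G" using F_carrier[OF e(1)] .
  \<comment> \<open>Otherwise \<open>e\<close> and \<open>z\<close> merge into one letter outside
    the core, and the product with \<open>h\<close> has \<open>length xs + length zs\<close>
    letters, more than \<open>Suc M\<close> because \<open>zs\<close> is nonempty.\<close>
  have middle: "e \<otimes> z \<in> core" if zs: "zs \<noteq> []" "alternating F d (z # zs)" "word_prod (z # zs) \<in> P" for z zs
  proof (rule ccontr)
    have z: "z \<in> F d" "z \<notin> F (\<not> d)" "alternating F (\<not> d) zs" "z \<in> carrier G" using zs(2) F_carrier by auto
    assume "e \<otimes> z \<notin> core"
    then have "e \<otimes> z \<notin> F (\<not> d)" using F_mult[OF e(1) z(1)] core_iff by blast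
    then have "alternating F b (us @ (e \<otimes> z) # zs)"
      using e(3) z(3) F_mult[OF e(1) z(1)] by (simp add: alternating_append flip: d_def)
    then have "len (word_prod (us @ (e \<otimes> z) # zs)) = length xs + length zs"
      using len_word us by fastforce
    moreover have "word_prod (us @ (e \<otimes> z) # zs) = h \<otimes> word_prod (z # zs)"
      using xs(3) us eG z(4) alternating_carrier[OF e(3)] alternating_carrier[OF z(3)]
      by (simp add: word_prod_append m_assoc)
    ultimately have "len (h \<otimes> word_prod (z # zs)) = length xs + length zs" by simp
    moreover have "h \<otimes> word_prod (z # zs) \<in> P" using subgroup.m_closed[OF P] h zs by blast
    ultimately show False using bound lxs zs(1) by fastforce
  qed
  \<comment> \<open>The mirror image of \<open>start\<close>: the word is now multiplied to
    \<open>h\<close> from the left, and \<open>bd\<close> tells in which factor \<open>h\<close>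
    begins.\<close>
  have finish: "d'' = d" if zs: "alternating F d (zs @ [z])" "word_prod (zs @ [z]) \<in> P" "z \<in> F d''" "z \<notin> F (\<not> d'')" for zs z d''
  proof (rule ccontr)
    assume ne: "d'' \<noteq> d"
    have z: "alternating F (d = even (length zs)) [z]" using zs(1) by (simp only: alternating_append)
    have "i = j" if "z \<in> F i" "z \<notin> F (\<not> i)" "z \<in> F j" for i j
      using that by (cases i; cases j) auto
    from this[OF zs(3,4)] have "d'' = (d = even (length zs))" using z by simp
    then have "(d = even (length (zs @ [z]))) = b" using bd ne by auto
    then have "alternating F d ((zs @ [z]) @ xs)" using xs(2) zs(1) by (simp only: alternating_append)
    from len_word[OF this] have "len (word_prod (zs @ [z]) \<otimes> h) = length (zs @ [z]) + length xs"
      using xs(3) alternating_carrier[OF xs(2)] alternating_carrier[OF zs(1)]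
      by (metis length_append word_prod_append)
    moreover have "word_prod (zs @ [z]) \<otimes> h \<in> P" using subgroup.m_closed[OF P] h zs by blast
    ultimately show False using bound lxs by fastforce
  qed
  obtain y ys where y: "xs = y # ys" "ys \<noteq> []" using lxs M by (cases xs; cases "tl xs") auto
  have yF: "y \<in> F d" using xs(2) y bd by simp
  have yG: "y \<in> carrier G" using F_carrier[OF yF] .
  \<comment> \<open>Applying \<open>middle\<close> to \<open>h\<close> itself puts its first letter
    into \<open>inv e\<close> times the core, where the first letters of all elements of length at
    least two lie.\<close>
  have ey: "e \<otimes> y \<in> core" using middle[OF y(2)] xs y bd h by simp
  have "len (conj G y k) \<le> M" if k: "k \<in> P" for k
    using PG[OF k]
  proof (cases rule: word_cases)
    case core
    then have "conj G y k \<in> F d" using F_conj[OF yF] by (cases d) auto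
    then show ?thesis using len_F M order_trans by blast
  next
    case (word d' zs)
    then have zs: "alternating F d zs" using start k by blast
    then obtain z zs' where z: "zs = z # zs'" using word(1) by (cases zs) auto
    show ?thesis
    proof (cases "zs' = []")
      case True
      then have "k \<in> F d" using word zs z by (auto simp: F_carrier)
      then show ?thesis using len_F[OF F_conj[OF yF]] M order_trans by blast
    next
      case False
      have zF: "z \<in> F d" "alternating F (\<not> d) zs'" using zs z by auto
      have zG: "z \<in> carrier G" using F_carrier[OF zF(1)] .
      have ez: "e \<otimes> z \<in> core" using middle[OF False] zs z word(3) k by simp
      have "inv y \<otimes> z = inv (e \<otimes> y) \<otimes> (e \<otimes> z)" using yG zG eG by (simp add: inv_mult_group m_assoc)
      then have yz: "inv y \<otimes> z \<in> core" using ez ey F_mult F_inv by simp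
      obtain ts t where t: "zs' = ts @ [t]" using False by (cases zs' rule: rev_cases) auto
      have tF: "t \<in> F d"
      proof -
        have "t \<in> F ((\<not> d) = even (length ts))" "t \<notin> F (\<not> ((\<not> d) = even (length ts)))"
          using zF(2) by (auto simp: t alternating_append)
        moreover have "alternating F d ((z # ts) @ [t])" "word_prod ((z # ts) @ [t]) \<in> P"
          using zs z t word(3) k by simp_all
        ultimately have "((\<not> d) = even (length ts)) = d" using finish by blast
        then show ?thesis using \<open>t \<in> F ((\<not> d) = even (length ts))\<close> by simp
      qed
      have tsG: "set ts \<subseteq> carrier G" "t \<in> carrier G" using alternating_carrier[OF zF(2)] t by auto
      \<comment> \<open>The first letter collapses into the core and the last one merges with
        \<open>y\<close>, so one letter is saved.\<close>
      have "conj G y k = (inv y \<otimes> z) \<otimes> word_prod (ts @ [t \<otimes> y])"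
        using word(3) z t yG zG tsG by (simp add: conj_def word_prod_append m_assoc)
      moreover have "word_prod (ts @ [t \<otimes> y]) \<in> carrier G" using tsG yG by simp
      ultimately have "len (conj G y k) = len (word_prod (ts @ [t \<otimes> y]))"
        using len_core_mult[OF yz] by simp
      also have "\<dots> \<le> length (ts @ [t \<otimes> y])"
      proof (rule len_word_prod_le)
        have "set ts \<subseteq> F True \<union> F False" 
          using zF(2) t alternating_subset[of F _ ts "F True \<union> F False"]
          by (metis (full_types) alternating_append Un_upper1 Un_upper2)
        moreover have "t \<otimes> y \<in> F True \<union> F False" using F_mult[OF tF yF] by (cases d) auto
        ultimately show "set (ts @ [t \<otimes> y]) \<subseteq> F True \<union> F False" by simp
      qed
      also have "\<dots> \<le> M"
      proof -
        have "length zs \<le> Suc M" using bound[OF k] len_word[OF zs] word(3) by simp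
        then show ?thesis using z t by simp
      qed
      finally show ?thesis .
    qed
  qed
  then show ?thesis using yG by blast
qed

text \<open>Finiteness serves only to bound the length. The induction lowers the bound to one, where
  \<open>subgroup_of_union\<close> takes over.\<close>

lemma finite_subgroup_conj_factor:
  assumes "subgroup P G" "finite P"
  shows "\<exists>g\<in>carrier G. \<exists>b. conj G g ` P \<subseteq> F b"
proof -
  have "\<exists>g\<in>carrier G. \<exists>b. conj G g ` P \<subseteq> F b" if "subgroup P G" "\<And>k. k \<in> P \<Longrightarrow> len k \<le> M" for M P
    using that
  proof (induction M arbitrary: P)
    case 0
    then obtain b where "P \<subseteq> F b" using subgroup_of_union[of P] by (metis le0 le_trans)
    then show ?case using subgroup.subset[OF 0(1)] by (intro bexI[of _ \<one>]) auto
  next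
    case (Suc M)
    consider "\<And>k. k \<in> P \<Longrightarrow> len k \<le> M" | "M = 0" | h where "h \<in> P" "len h = Suc M" "M \<ge> 1"
      using Suc.prems(2) by (metis One_nat_def le_SucE le_zero_eq not_less_eq_eq)
    then show ?case
    proof cases
      case 1
      then show ?thesis using Suc by blast
    next
      case 2
      then obtain b where "P \<subseteq> F b" using subgroup_of_union[of P] Suc.prems by auto
      then show ?thesis using subgroup.subset[OF Suc.prems(1)] by (intro bexI[of _ \<one>]) auto
    next
      case 3
      obtain y where y: "y \<in> carrier G" "\<And>k. k \<in> P \<Longrightarrow> len (conj G y k) \<le> M"
        using conj_shortens[OF Suc.prems 3(3,1,2)] by blast
      obtain g b where g: "g \<in> carrier G" "conj G g ` conj G y ` P \<subseteq> F b"
        using Suc.IH[OF subgroup_conj[OF Suc.prems(1) y(1)]] y(2) by blast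
      then show ?thesis
        using conj_image_mult[OF y(1) g(1) subgroup.subset[OF Suc.prems(1)]] y(1)
        by (metis m_closed)
    qed
  qed
  moreover have "len k \<le> Max (len ` P)" if "k \<in> P" for k using that assms(2) by simp
  ultimately show ?thesis using assms(1) by blast
qed

text \<open>If \<open>q\<close> were outside the core, the inverted word, \<open>q\<close> and the
  word would concatenate to a reduced word of length \<open>2 * length ys + 1\<close>, hence at
  least three, whereas elements of a factor have length at most one.\<close>

lemma conj_word_core:
  assumes ys: "alternating F b ys" "ys \<noteq> []" and q: "q \<in> F (\<not> b)"
    and z: "conj G (word_prod ys) q \<in> F d"
  shows "q \<in> core"
proof (rule ccontr)
  assume "q \<notin> core"
  then have qb: "q \<notin> F b" using q core_iff by blast
  have inv_alt: "alternating F c (map (m_inv G) xs) = alternating F c xs" if "set xs \<subseteq> carrier G" for c xs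
    using that by (induction xs arbitrary: c) (auto simp: F_inv_iff)
  \<comment> \<open>The reversal of a nonempty word starts in the factor of the former last letter,
    which is \<open>c\<close> exactly when the number of letters is odd.\<close>
  have rev_alt: "alternating F (c = odd (length xs)) (rev xs)" if "alternating F c xs" for c xs
    using that
  proof (induction xs arbitrary: c)
    case (Cons x xs)
    have "alternating F ((\<not> c) = odd (length xs)) (rev xs)" by (rule Cons.IH) (use Cons.prems in simp)
    moreover have "((\<not> c) = odd (length xs)) = (c = odd (length (x # xs)))" by auto
    moreover have "((c = odd (length (x # xs))) = even (length (rev xs))) = c" by auto
    ultimately show ?case using Cons.prems by (simp only: rev.simps alternating_append alternating.simps simp_thms)
  qed simp
  have ysG: "set ys \<subseteq> carrier G" and qG: "q \<in> carrier G" using alternating_carrier[OF ys(1)] F_carrier[OF q] .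
  let ?w = "rev (map (m_inv G) ys) @ q # ys"
  have "alternating F (b = odd (length ys)) (rev (map (m_inv G) ys))"
    using rev_alt[of b "map (m_inv G) ys"] inv_alt[OF ysG] ys(1) by simp
  then have "alternating F (b = odd (length ys)) ?w"
  proof -
    have eq: "((b = odd (length ys)) = even (length ys)) = (\<not> b)" by auto
    show "alternating F (b = odd (length ys)) (rev (map (m_inv G) ys)) \<Longrightarrow> ?thesis"
      using q qb ys(1) by (simp add: alternating_append eq)
  qed
  from len_word[OF this] have "len (word_prod ?w) = 2 * length ys + 1" by simp
  moreover have "word_prod ?w = conj G (word_prod ys) q"
    using ysG qG by (subst word_prod_append) (auto simp: conj_def word_prod_inv m_assoc subset_eq)
  ultimately show False using len_F[OF z] ys(2) by simp
qed

text \<open>Letters of \<open>F True\<close> at either end are split off, so that a nonempty inner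
  word begins and ends in \<open>F False\<close>, the latter being encoded by odd length. Conjugates
  of a subgroup of S then enter and leave the inner word inside \<open>F True\<close>, where S
  lies.\<close>

lemma sandwich_word:
  assumes "g \<in> carrier G"
  obtains a ys a' where "a \<in> F True" "a' \<in> F True" "alternating F False ys" "ys = [] \<or> odd (length ys)"
    "g = a \<otimes> word_prod ys \<otimes> a'"
proof -
  have "\<exists>a ys. a \<in> F True \<and> alternating F False ys \<and> g = a \<otimes> word_prod ys"
    using assms
  proof (cases rule: word_cases)
    case core
    then show ?thesis using assms by (intro exI[of _ g] exI[of _ "[]"]) auto
  next
    case (word b xs)
    show ?thesis
    proof (cases b)
      case True
      then obtain x ys where "xs = x # ys" using word by (cases xs) auto
      then show ?thesis using word True by (intro exI[of _ x] exI[of _ ys]) auto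
    next
      case False
      then show ?thesis using word assms by (intro exI[of _ \<one>] exI[of _ xs]) auto
    qed
  qed
  then obtain a ys where a: "a \<in> F True" "alternating F False ys" "g = a \<otimes> word_prod ys" by blast
  have aG: "a \<in> carrier G" using F_carrier a by blast
  show thesis
  proof (cases "ys = [] \<or> odd (length ys)")
    case True
    then show thesis using that[of a \<one> ys] a assms by simp
  next
    case False
    then obtain zs z where z: "ys = zs @ [z]" by (cases ys rule: rev_cases) auto
    then have "odd (length zs)" using False by simp
    then have zF: "alternating F False zs" "z \<in> F True" using a(2) z by (auto simp: alternating_append)
    have "g = a \<otimes> word_prod zs \<otimes> z"
      using a(3) z aG F_carrier[OF zF(2)] alternating_carrier[OF zF(1)] by (simp add: word_prod_append m_assoc)
    then show thesis using that[OF a(1) zF(2,1)] \<open>odd (length zs)\<close> by blast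
  qed
qed

end

text \<open>\<open>M P g\<close> abstracts from the statement that conjugation by \<open>g\<close>
  on \<open>P\<close> is already accounted for. For \<open>F True\<close> it is assumed between
  subgroups of \<open>S\<close>, for \<open>F False\<close> only after translation by
  \<open>u\<close> and between subgroups of the translate of \<open>T\<close>. In the application
  (H) makes this translate the whole identified Sylow group of the removed vertex.\<close>

locale amalgam_fusion = amalgam_length G F len for G (structure) and F len +
  fixes p :: nat and S T :: "'a set" and u :: 'a and M :: "'a set \<Rightarrow> 'a \<Rightarrow> bool"
  assumes S_F: "S \<subseteq> F True" and T_core: "T \<subseteq> core" and u_F: "u \<in> F True" and T_conj_S: "conj G u ` T \<subseteq> S"
    and sylow_core: "finite_p_subgroup G p Q \<Longrightarrow> Q \<subseteq> core \<Longrightarrow> \<exists>c\<in>core. conj G c ` Q \<subseteq> T"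
    and M_comp: "g \<in> carrier G \<Longrightarrow> h \<in> carrier G \<Longrightarrow> M P g \<Longrightarrow> M (conj G g ` P) h \<Longrightarrow> M P (g \<otimes> h)"
    and M_True: "a \<in> F True \<Longrightarrow> finite_p_subgroup G p P \<Longrightarrow> P \<subseteq> S \<Longrightarrow> conj G a ` P \<subseteq> S \<Longrightarrow> M P a"
    and M_False: "b \<in> F False \<Longrightarrow> finite_p_subgroup G p P \<Longrightarrow> P \<subseteq> conj G u ` T
      \<Longrightarrow> conj G (inv u \<otimes> b \<otimes> u) ` P \<subseteq> conj G u ` T \<Longrightarrow> M P (inv u \<otimes> b \<otimes> u)"
begin

lemma core_F: "x \<in> core \<Longrightarrow> x \<in> F b"
  by (cases b) auto

text \<open>A subgroup \<open>Q\<close> of the core has a copy in \<open>S\<close>, its conjugate by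
  \<open>c \<otimes> u\<close>, where \<open>c\<close> moves \<open>Q\<close> into \<open>T\<close>.
  The induction follows the conjugates of \<open>Q\<close> letter by letter and compares consecutive
  copies. The parity condition says that a nonempty word ends in \<open>F False\<close>.\<close>

lemma chain:
  assumes "alternating F b ys" "odd (length ys) \<longleftrightarrow> \<not> b" "a \<in> F True"
    and "finite_p_subgroup G p Q" "Q \<subseteq> core" "c \<in> core" "conj G c ` Q \<subseteq> T"
    and "conj G (word_prod ys \<otimes> a) ` Q \<subseteq> S"
  shows "M (conj G (c \<otimes> u) ` Q) (inv (c \<otimes> u) \<otimes> (word_prod ys \<otimes> a))"
  using assms
proof (induction ys arbitrary: b Q c)
  case Nil
  have uG: "u \<in> carrier G" and cG: "c \<in> carrier G" and aG: "a \<in> carrier G"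
    using u_F Nil F_carrier by auto
  have QG: "Q \<subseteq> carrier G" using Nil.prems(5) core_carrier by blast
  have "conj G (c \<otimes> u) ` Q \<subseteq> S"
    using conj_image_mult[OF cG uG QG] Nil.prems(7) T_conj_S by auto
  moreover have "conj G (inv (c \<otimes> u) \<otimes> a) ` conj G (c \<otimes> u) ` Q \<subseteq> S"
    using Nil.prems(8) cG uG aG QG conj_image_mult[of "c \<otimes> u" "inv (c \<otimes> u) \<otimes> a" Q]
    by (simp add: inv_mult_group m_assoc)
  moreover have "inv (c \<otimes> u) \<otimes> a \<in> F True" using Nil.prems u_F by (simp add: F_mult F_inv)
  moreover have "finite_p_subgroup G p (conj G (c \<otimes> u) ` Q)"
    using finite_p_subgroup_conj[OF Nil.prems(4)] cG uG by simp
  ultimately show ?case using M_True aG by simp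
next
  case (Cons z zs)
  have z: "z \<in> F b" "z \<notin> F (\<not> b)" "alternating F (\<not> b) zs" using Cons.prems(1) by auto
  have uG: "u \<in> carrier G" and cG: "c \<in> carrier G" and aG: "a \<in> carrier G" and zG: "z \<in> carrier G"
    and zsG: "word_prod zs \<in> carrier G"
    using u_F Cons.prems z F_carrier alternating_carrier[OF z(3)] by auto
  have QG: "Q \<subseteq> carrier G" using Cons.prems(5) core_carrier by blast
  define Q' where "Q' = conj G z ` Q"
  have Q'G: "Q' \<subseteq> carrier G" using QG zG by (auto simp: Q'_def)
  have final: "conj G (word_prod zs \<otimes> a) ` Q' \<subseteq> S"
    using Cons.prems(8) conj_image_mult[of z "word_prod zs \<otimes> a" Q] zG aG zsG QG
    by (simp add: Q'_def m_assoc)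
  \<comment> \<open>The conjugations still to come end in \<open>F True\<close>; by
    \<open>conj_word_core\<close> this is possible only from inside the core. If \<open>z\<close> is
    the last letter it is in \<open>F False\<close>, and membership in both factors is
    immediate.\<close>
  have "conj G z q \<in> core" if q: "q \<in> Q" for q
  proof -
    have qc: "q \<in> core" using q Cons.prems(5) by blast
    have zq: "conj G z q \<in> F b" using F_conj[OF z(1)] core_F[OF qc] by blast
    have zqG: "conj G z q \<in> carrier G" using F_carrier[OF zq] .
    have "conj G (word_prod zs \<otimes> a) (conj G z q) \<in> F True" using final q S_F by (auto simp: Q'_def)
    then have fin: "conj G (word_prod zs) (conj G z q) \<in> F True"
      using F_conj_iff[OF Cons.prems(3)] zsG aG zqG by (simp add: conj_mult)
    show ?thesis
    proof (cases "zs = []")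
      case True
      then have "\<not> b" using Cons.prems(2) by simp
      then show ?thesis using zq fin True zqG by simp
    next
      case False
      show ?thesis using conj_word_core[OF z(3) False _ fin] zq by simp
    qed
  qed
  then have Q'core: "Q' \<subseteq> core" by (auto simp: Q'_def)
  have Q'p: "finite_p_subgroup G p Q'" unfolding Q'_def by (rule finite_p_subgroup_conj[OF Cons.prems(4) zG])
  obtain c' where c': "c' \<in> core" "conj G c' ` Q' \<subseteq> T" using sylow_core[OF Q'p Q'core] by blast
  have c'G: "c' \<in> carrier G" using c' core_carrier by blast
  have IH: "M (conj G (c' \<otimes> u) ` Q') (inv (c' \<otimes> u) \<otimes> (word_prod zs \<otimes> a))"
    by (rule Cons.IH[OF z(3) _ Cons.prems(3) Q'p Q'core c' final]) (use Cons.prems(2) in auto)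
  \<comment> \<open>\<open>?w\<close> leads from the copy of \<open>Q\<close> in \<open>S\<close> to
    the copy of \<open>Q'\<close>; multiplied with the element of the induction hypothesis it
    telescopes.\<close>
  let ?R = "conj G (c \<otimes> u) ` Q" and ?w = "inv (c \<otimes> u) \<otimes> (z \<otimes> (c' \<otimes> u))"
  have Rp: "finite_p_subgroup G p ?R" using finite_p_subgroup_conj[OF Cons.prems(4)] cG uG by simp
  have RT: "?R \<subseteq> conj G u ` T" using conj_image_mult[OF cG uG QG] Cons.prems(7) by auto
  have "conj G ?w ` ?R = conj G (z \<otimes> (c' \<otimes> u)) ` Q"
    using conj_image_mult[of "c \<otimes> u" ?w Q] cG uG zG c'G QG by (simp add: inv_mult_group m_assoc)
  also have "\<dots> = conj G (c' \<otimes> u) ` Q'"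
    using conj_image_mult[of z "c' \<otimes> u" Q] uG zG c'G QG by (simp add: Q'_def)
  finally have wR: "conj G ?w ` ?R = conj G (c' \<otimes> u) ` Q'" .
  have wT: "conj G ?w ` ?R \<subseteq> conj G u ` T"
    unfolding wR using conj_image_mult[OF c'G uG Q'G] c'(2) by auto
  \<comment> \<open>For a letter of \<open>F True\<close> all factors of \<open>?w\<close> lie in
    \<open>F True\<close>. Otherwise the core elements are absorbed by the letter and
    \<open>u\<close> stays outside, which is the shape demanded by \<open>M_False\<close>.\<close>
  have "M ?R ?w"
  proof (cases b)
    case True
    then have "?w \<in> F True" using z u_F c' Cons.prems(6) by (simp add: F_mult F_inv)
    then show ?thesis using M_True Rp RT wT T_conj_S by blast
  next
    case False
    have eq: "?w = inv u \<otimes> (inv c \<otimes> z \<otimes> c') \<otimes> u"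
      using cG uG zG c'G by (simp add: inv_mult_group m_assoc)
    have "inv c \<otimes> z \<otimes> c' \<in> F False" using False z c' Cons.prems(6) by (simp add: F_mult F_inv)
    then show ?thesis using M_False Rp RT wT unfolding eq by blast
  qed
  then have "M ?R (?w \<otimes> (inv (c' \<otimes> u) \<otimes> (word_prod zs \<otimes> a)))"
    by (rule M_comp[rotated 2]) (use IH wR cG uG zG c'G aG zsG in simp_all)
  moreover have "?w \<otimes> (inv (c' \<otimes> u) \<otimes> (word_prod zs \<otimes> a)) = inv (c \<otimes> u) \<otimes> (word_prod (z # zs) \<otimes> a)"
    using cG uG zG c'G aG zsG by (simp add: inv_mult_group m_assoc)
  ultimately show ?case by simp
qed

text \<open>If the inner word is nonempty, \<open>a\<close> conjugates \<open>P\<close> into the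
  core, since the word starts in \<open>F False\<close> and yet leads back into
  \<open>F True\<close>. The map is split at the copy in \<open>S\<close> of that subgroup:
  \<open>M_True\<close> covers the first half, \<open>chain\<close> the second.\<close>

theorem M_all:
  assumes P: "finite_p_subgroup G p P" "P \<subseteq> S" and g: "g \<in> carrier G" "conj G g ` P \<subseteq> S"
  shows "M P g"
proof -
  obtain a ys a' where w: "a \<in> F True" "a' \<in> F True" "alternating F False ys" "ys = [] \<or> odd (length ys)"
    "g = a \<otimes> word_prod ys \<otimes> a'" using sandwich_word[OF g(1)] .
  have aG: "a \<in> carrier G" "a' \<in> carrier G" "word_prod ys \<in> carrier G"
    using w F_carrier word_prod_F_carrier by auto
  have PG: "P \<subseteq> carrier G" using P(2) S_F F_carrier by blast
  show ?thesis
  proof (cases "ys = []")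
    case True
    then have "g \<in> F True" using w F_mult aG by simp
    then show ?thesis using M_True P g by blast
  next
    case False
    then have odd: "odd (length ys)" using w by blast
    define Q where "Q = conj G a ` P"
    have Qp: "finite_p_subgroup G p Q" unfolding Q_def by (rule finite_p_subgroup_conj[OF P(1) aG(1)])
    have QG: "Q \<subseteq> carrier G" using PG aG by (auto simp: Q_def)
    have final: "conj G (word_prod ys \<otimes> a') ` Q \<subseteq> S"
      using g(2) w(5) conj_image_mult[of a "word_prod ys \<otimes> a'" P] PG aG by (simp add: Q_def m_assoc)
    have "q \<in> core" if q: "q \<in> Q" for q
    proof -
      have qF: "q \<in> F True" using q P(2) S_F F_conj[OF w(1)] by (auto simp: Q_def)
      have qG: "q \<in> carrier G" using F_carrier[OF qF] .
      have "conj G (word_prod ys \<otimes> a') q \<in> F True" using final q S_F by blast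
      then have fin: "conj G (word_prod ys) q \<in> F True"
        using F_conj_iff[OF w(2)] aG qG by (simp add: conj_mult)
      show ?thesis using conj_word_core[OF w(3) False _ fin] qF by simp
    qed
    then have Qcore: "Q \<subseteq> core" by blast
    obtain c where c: "c \<in> core" "conj G c ` Q \<subseteq> T" using sylow_core[OF Qp Qcore] by blast
    have cuG: "c \<in> carrier G" "u \<in> carrier G" using c u_F F_carrier by auto
    have ch: "M (conj G (c \<otimes> u) ` Q) (inv (c \<otimes> u) \<otimes> (word_prod ys \<otimes> a'))"
      using chain[OF w(3) _ w(2) Qp Qcore c final] odd by simp
    have img: "conj G (a \<otimes> (c \<otimes> u)) ` P = conj G (c \<otimes> u) ` Q"
      using conj_image_mult[of a "c \<otimes> u" P] PG aG cuG by (simp add: Q_def)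
    also have "\<dots> \<subseteq> S" using conj_image_mult[OF cuG QG] c(2) T_conj_S by auto
    finally have "M P (a \<otimes> (c \<otimes> u))"
      using w(1) c(1) u_F P by (intro M_True) (simp_all add: F_mult)
    then have "M P (a \<otimes> (c \<otimes> u) \<otimes> (inv (c \<otimes> u) \<otimes> (word_prod ys \<otimes> a')))"
      by (rule M_comp[rotated 2]) (use ch img aG cuG in simp_all)
    moreover have "a \<otimes> (c \<otimes> u) \<otimes> (inv (c \<otimes> u) \<otimes> (word_prod ys \<otimes> a')) = g"
      using aG cuG w(5) by (simp add: inv_mult_group m_assoc)
    ultimately show ?thesis by simp
  qed
qed

end

section \<open>Completions of graphs of groups\<close>

text \<open>General enough to cover the whole tree, its rooted subtrees and a single vertex, and
  sufficient for the completion to be a group with its universal property.\<close>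

locale graph_of_groups =
  fixes V :: "'v set" and E :: "'v set set" and Gv :: "'v \<Rightarrow> 'a monoid" and Ge :: "'v set \<Rightarrow> 'a monoid"
    and phi :: "'v set \<Rightarrow> 'v \<Rightarrow> 'a \<Rightarrow> 'a"
  assumes Gv_group: "v \<in> V \<Longrightarrow> group (Gv v)" and Ge_group: "e \<in> E \<Longrightarrow> group (Ge e)"
    and E_V: "e \<in> E \<Longrightarrow> v \<in> e \<Longrightarrow> v \<in> V"
    and phi_hom: "e \<in> E \<Longrightarrow> v \<in> e \<Longrightarrow> phi e v \<in> hom (Ge e) (Gv v)"
begin

abbreviation cong :: "('v \<times> 'a) list \<Rightarrow> ('v \<times> 'a) list \<Rightarrow> bool" where
  "cong \<equiv> amalg_eq V E Gv Ge phi"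

abbreviation "valid \<equiv> valid_word V Gv"

abbreviation cls :: "('v \<times> 'a) list \<Rightarrow> ('v \<times> 'a) list set" where
  "cls w \<equiv> Collect (cong w)"

abbreviation GT :: "('v \<times> 'a) list set monoid" where
  "GT \<equiv> completion V E Gv Ge phi"

abbreviation emb :: "'v \<Rightarrow> 'a \<Rightarrow> ('v \<times> 'a) list set" where
  "emb \<equiv> completion_emb V E Gv Ge phi"

lemma valid_Nil [simp]: "valid []"
  and valid_Cons [simp]: "valid ((v, g) # w) \<longleftrightarrow> v \<in> V \<and> g \<in> carrier (Gv v) \<and> valid w"
  and valid_append [simp]: "valid (w @ z) \<longleftrightarrow> valid w \<and> valid z"
  by (auto simp: valid_word_def)

lemma cong_valid: "cong w w' \<Longrightarrow> valid w \<and> valid w'"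
proof (induction rule: amalg_eq.induct)
  case (ae_mult v g h)
  then show ?case using monoid.m_closed[OF group.is_monoid[OF Gv_group]] by simp
next
  case (ae_one v)
  then show ?case using monoid.one_closed[OF group.is_monoid[OF Gv_group]] by simp
next
  case (ae_edge e v w x)
  then have "phi e v x \<in> carrier (Gv v)" "phi e w x \<in> carrier (Gv w)"
    using phi_hom by (meson hom_in_carrier)+
  then show ?case using ae_edge E_V by simp
qed auto

lemma cls_eq_iff: "valid w \<Longrightarrow> cls w = cls w' \<longleftrightarrow> cong w w'"
  by (metis (mono_tags) Collect_cong amalg_eq.ae_refl amalg_eq.ae_sym amalg_eq.ae_trans mem_Collect_eq)

lemma cong_append:
  assumes "cong a a'" "cong b b'" shows "cong (a @ b) (a' @ b')"
proof -
  have "cong ([] @ a @ b) ([] @ a' @ b)" using assms cong_valid by (intro amalg_eq.ae_ctx) auto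
  moreover have "cong (a' @ b @ []) (a' @ b' @ [])" using assms cong_valid by (intro amalg_eq.ae_ctx) auto
  ultimately show ?thesis by (auto intro: amalg_eq.ae_trans)
qed

lemma carrier_GT: "carrier GT = cls ` {w. valid w}"
  by (auto simp: completion_def)

lemma one_GT: "\<one>\<^bsub>GT\<^esub> = cls []"
  by (simp add: completion_def)

lemma mult_GT:
  assumes "valid w" "valid z" shows "cls w \<otimes>\<^bsub>GT\<^esub> cls z = cls (w @ z)"
proof -
  have "cong (w @ z) x" if "cong w a" "cong z b" "cong (a @ b) x" for a b x
    using that cong_append amalg_eq.ae_trans by blast
  moreover have "\<exists>a b. cong w a \<and> cong z b \<and> cong (a @ b) x" if "cong (w @ z) x" for x
    using that assms amalg_eq.ae_refl by blast
  ultimately show ?thesis unfolding completion_def by auto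
qed

definition word_inv :: "('v \<times> 'a) list \<Rightarrow> ('v \<times> 'a) list" where
  "word_inv w = rev (map (\<lambda>(v, g). (v, inv\<^bsub>Gv v\<^esub> g)) w)"

lemma word_inv: "valid w \<Longrightarrow> valid (word_inv w) \<and> cong (word_inv w @ w) []"
proof (induction w)
  case Nil
  then show ?case by (auto simp: word_inv_def intro: amalg_eq.ae_refl)
next
  case (Cons x w)
  obtain v g where x: "x = (v, g)" by (cases x)
  interpret group "Gv v" using Cons.prems x Gv_group by auto
  have v: "v \<in> V" "g \<in> carrier (Gv v)" "valid w" using Cons.prems x by auto
  have eq: "word_inv (x # w) = word_inv w @ [(v, inv\<^bsub>Gv v\<^esub> g)]" by (simp add: word_inv_def x)
  have "cong [(v, inv\<^bsub>Gv v\<^esub> g), (v, g)] [(v, \<one>\<^bsub>Gv v\<^esub>)]"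
    using amalg_eq.ae_mult[OF v(1), of "inv\<^bsub>Gv v\<^esub> g" Gv g] v by simp
  then have "cong [(v, inv\<^bsub>Gv v\<^esub> g), (v, g)] []" using amalg_eq.ae_one[OF v(1)] amalg_eq.ae_trans by blast
  from amalg_eq.ae_ctx[OF this, of "word_inv w" w]
  have "cong (word_inv (x # w) @ x # w) (word_inv w @ w)" using Cons.IH v unfolding eq by (simp add: x)
  then show ?case using Cons.IH v eq amalg_eq.ae_trans by auto
qed

lemma group_GT: "group GT"
proof (rule groupI)
  show "\<one>\<^bsub>GT\<^esub> \<in> carrier GT" by (auto simp: one_GT carrier_GT)
  show "x \<otimes>\<^bsub>GT\<^esub> y \<in> carrier GT" if "x \<in> carrier GT" "y \<in> carrier GT" for x y
    using that by (auto simp: carrier_GT mult_GT)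
  show "x \<otimes>\<^bsub>GT\<^esub> y \<otimes>\<^bsub>GT\<^esub> z = x \<otimes>\<^bsub>GT\<^esub> (y \<otimes>\<^bsub>GT\<^esub> z)"
    if "x \<in> carrier GT" "y \<in> carrier GT" "z \<in> carrier GT" for x y z
    using that by (auto simp: carrier_GT mult_GT)
  show "\<one>\<^bsub>GT\<^esub> \<otimes>\<^bsub>GT\<^esub> x = x" if "x \<in> carrier GT" for x
    using that by (auto simp: carrier_GT mult_GT one_GT)
  show "\<exists>y\<in>carrier GT. y \<otimes>\<^bsub>GT\<^esub> x = \<one>\<^bsub>GT\<^esub>" if x: "x \<in> carrier GT" for x
  proof -
    obtain w where w: "valid w" "x = cls w" using x by (auto simp: carrier_GT)
    have "cls (word_inv w) \<otimes>\<^bsub>GT\<^esub> x = \<one>\<^bsub>GT\<^esub>"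
      using word_inv[OF w(1)] w by (simp add: mult_GT one_GT cls_eq_iff)
    then show ?thesis using word_inv[OF w(1)] by (auto simp: carrier_GT)
  qed
qed

lemma emb_closed: "v \<in> V \<Longrightarrow> g \<in> carrier (Gv v) \<Longrightarrow> emb v g \<in> carrier GT"
  by (auto simp: completion_emb_def carrier_GT)

lemma emb_hom: "v \<in> V \<Longrightarrow> emb v \<in> hom (Gv v) GT"
proof (rule homI)
  fix g h assume *: "v \<in> V" "g \<in> carrier (Gv v)" "h \<in> carrier (Gv v)"
  then have "cong [(v, g), (v, h)] [(v, g \<otimes>\<^bsub>Gv v\<^esub> h)]" by (rule amalg_eq.ae_mult)
  then have "cls [(v, g), (v, h)] = cls [(v, g \<otimes>\<^bsub>Gv v\<^esub> h)]" using * by (subst cls_eq_iff) auto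
  then show "emb v (g \<otimes>\<^bsub>Gv v\<^esub> h) = emb v g \<otimes>\<^bsub>GT\<^esub> emb v h"
    using * by (simp add: completion_emb_def mult_GT)
qed (rule emb_closed)

lemma emb_edge:
  assumes "e \<in> E" "v \<in> e" "w \<in> e" "x \<in> carrier (Ge e)"
  shows "emb v (phi e v x) = emb w (phi e w x)"
proof -
  have "cong [(v, phi e v x)] [(w, phi e w x)]" using assms by (rule amalg_eq.ae_edge)
  then show ?thesis unfolding completion_emb_def using cong_valid cls_eq_iff by blast
qed

lemma cls_Cons: "v \<in> V \<Longrightarrow> g \<in> carrier (Gv v) \<Longrightarrow> valid w \<Longrightarrow> cls ((v, g) # w) = emb v g \<otimes>\<^bsub>GT\<^esub> cls w"
  by (simp add: completion_emb_def mult_GT)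

lemma GT_induct [consumes 1, case_names one mult]:
  assumes x: "x \<in> carrier GT" and one: "P \<one>\<^bsub>GT\<^esub>"
    and mult: "\<And>v g y. v \<in> V \<Longrightarrow> g \<in> carrier (Gv v) \<Longrightarrow> y \<in> carrier GT \<Longrightarrow> P y \<Longrightarrow> P (emb v g \<otimes>\<^bsub>GT\<^esub> y)"
  shows "P x"
proof -
  have "P (cls w)" if "valid w" for w using that
  proof (induction w)
    case Nil
    then show ?case using one by (simp add: one_GT)
  next
    case (Cons a w)
    then show ?case using mult[of "fst a" "snd a" "cls w"] cls_Cons[of "fst a" "snd a" w]
      by (cases a) (auto simp: carrier_GT)
  qed
  then show ?thesis using x by (auto simp: carrier_GT)
qed

text \<open>Evaluating words letter by letter respects each generating relation of the congruence,
  so it descends to classes. The maps between completions and the action on normal forms are all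
  obtained from this.\<close>

lemma GT_universal:
  assumes K: "group K" and f: "\<And>v. v \<in> V \<Longrightarrow> f v \<in> hom (Gv v) K"
    and edge: "\<And>e v w x. e \<in> E \<Longrightarrow> v \<in> e \<Longrightarrow> w \<in> e \<Longrightarrow> x \<in> carrier (Ge e) \<Longrightarrow> f v (phi e v x) = f w (phi e w x)"
  obtains h where "h \<in> hom GT K" "\<And>v g. v \<in> V \<Longrightarrow> g \<in> carrier (Gv v) \<Longrightarrow> h (emb v g) = f v g"
proof -
  interpret K: group K by (rule K)
  define ev where "ev w = foldr (\<lambda>(v, g) k. f v g \<otimes>\<^bsub>K\<^esub> k) w \<one>\<^bsub>K\<^esub>" for w
  have ev_simps [simp]: "ev [] = \<one>\<^bsub>K\<^esub>" "ev ((v, g) # w) = f v g \<otimes>\<^bsub>K\<^esub> ev w" for v g w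
    by (auto simp: ev_def)
  have f_closed [simp]: "f v g \<in> carrier K" if "v \<in> V" "g \<in> carrier (Gv v)" for v g
    using f that by (meson hom_in_carrier)
  have ev_closed [simp]: "ev w \<in> carrier K" if "valid w" for w
    using that by (induction w) auto
  have ev_append: "ev (w @ z) = ev w \<otimes>\<^bsub>K\<^esub> ev z" if "valid w" "valid z" for w z
    using that by (induction w) (auto simp: K.m_assoc)
  have ev_cong: "ev w = ev w'" if "cong w w'" for w w'
    using that
  proof (induction rule: amalg_eq.induct)
    case (ae_ctx w w' u z)
    then show ?case using cong_valid[OF ae_ctx.hyps(1)] by (simp add: ev_append)
  next
    case (ae_mult v g h)
    then show ?case using f[OF ae_mult(1)] by (simp add: hom_def K.m_assoc Pi_iff)
  next
    case (ae_one v)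
    have "f v \<one>\<^bsub>Gv v\<^esub> = \<one>\<^bsub>K\<^esub>" using hom_one[OF f[OF ae_one] Gv_group[OF ae_one] K] .
    then show ?case by simp
  next
    case (ae_edge e v w x)
    then have "phi e v x \<in> carrier (Gv v)" "phi e w x \<in> carrier (Gv w)" "v \<in> V" "w \<in> V"
      using phi_hom E_V by (meson hom_in_carrier)+
    then show ?case using edge[OF ae_edge] by simp
  qed auto
  \<comment> \<open>Any member of the class may be chosen, since \<open>ev\<close> is constant on
    it.\<close>
  define h where "h A = ev (SOME w. w \<in> A)" for A
  have h_cls: "h (cls w) = ev w" if "valid w" for w
  proof -
    have "(SOME z. z \<in> cls w) \<in> cls w" by (rule someI[of _ w]) (simp add: that amalg_eq.ae_refl)
    then show ?thesis using ev_cong by (auto simp: h_def)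
  qed
  have "h \<in> hom GT K"
    by (rule homI) (auto simp: carrier_GT h_cls mult_GT ev_append)
  moreover have "h (emb v g) = f v g" if "v \<in> V" "g \<in> carrier (Gv v)" for v g
    using that by (simp add: completion_emb_def h_cls)
  ultimately show thesis by (rule that)
qed

end

lemma (in graph_of_groups) GT_hom_eq:
  assumes K: "group K" and f: "f \<in> hom GT K" "f' \<in> hom GT K"
    and eq: "\<And>v g. v \<in> V \<Longrightarrow> g \<in> carrier (Gv v) \<Longrightarrow> f (emb v g) = f' (emb v g)"
    and x: "x \<in> carrier GT"
  shows "f x = f' x"
  using x
proof (induction rule: GT_induct)
  case one
  then show ?case using hom_one[OF f(1) group_GT K] hom_one[OF f(2) group_GT K] by simp
next
  case (mult v g y)
  then show ?case using hom_mult[OF f(1)] hom_mult[OF f(2)] emb_closed eq by simp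
qed

lemma single_vertex_graph:
  assumes "group (Gv v)" shows "graph_of_groups {v} {} Gv Ge phi"
  using assms by (simp add: graph_of_groups_def)

text \<open>Besides serving the base of the induction, this supplies a copy of a vertex group made
  of word classes, which can be paired with the completion of a subtree in
  \<open>amalgam_factors\<close>.\<close>

lemma completion_single_vertex:
  fixes Gv :: "'v \<Rightarrow> 'a monoid"
  assumes G: "group (Gv v)"
  shows "bij_betw (completion_emb {v} {} Gv Ge phi v) (carrier (Gv v)) (carrier (completion {v} {} Gv Ge phi))"
proof -
  interpret graph_of_groups "{v}" "{}" Gv Ge phi using G by (rule single_vertex_graph)
  interpret G: group "Gv v" by (rule G)
  obtain h where h: "h \<in> hom GT (Gv v)" "\<And>w g. w \<in> {v} \<Longrightarrow> g \<in> carrier (Gv w) \<Longrightarrow> h (emb w g) = g"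
    by (rule GT_universal[OF G, of "\<lambda>_ x. x"]) (auto simp: hom_def)
  have "inj_on (emb v) (carrier (Gv v))" using h(2)[of v] by (intro inj_on_inverseI[of _ h]) auto
  moreover have "x \<in> emb v ` carrier (Gv v)" if "x \<in> carrier GT" for x
    using that
  proof (induction rule: GT_induct)
    case one
    have "emb v \<one>\<^bsub>Gv v\<^esub> = \<one>\<^bsub>GT\<^esub>" using hom_one[OF emb_hom G group_GT] by simp
    then show ?case by (metis G.one_closed imageI)
  next
    case (mult w g y)
    then obtain k where "k \<in> carrier (Gv v)" "y = emb v k" by blast
    then have "emb w g \<otimes>\<^bsub>GT\<^esub> y = emb v (g \<otimes>\<^bsub>Gv v\<^esub> k)"
      using mult hom_mult[OF emb_hom[of v], of g k] by simp
    then show ?case using mult \<open>k \<in> carrier (Gv v)\<close> by auto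
  qed
  ultimately show ?thesis using emb_closed by (auto simp: bij_betw_def)
qed

section \<open>Paths in trees\<close>

lemma gpath_iff: "gpath V E a b xs \<longleftrightarrow> xs \<noteq> [] \<and> hd xs = a \<and> last xs = b \<and> distinct xs \<and> set xs \<subseteq> V \<and>
  successively (\<lambda>x y. {x, y} \<in> E) xs"
  by (simp add: gpath_def successively_conv_nth)

lemma gpath_Cons_Cons: "gpath V E a b (x # y # ys) \<longleftrightarrow>
  x = a \<and> x \<in> V \<and> x \<notin> set (y # ys) \<and> {x, y} \<in> E \<and> gpath V E y b (y # ys)"
  by (auto simp: gpath_iff)

lemma gpath_single: "gpath V E a b [x] \<longleftrightarrow> x = a \<and> a = b \<and> x \<in> V"
  by (auto simp: gpath_iff)

lemma tree_acyclic:
  assumes "is_tree V E" "distinct xs" "set xs \<subseteq> V" "successively (\<lambda>x y. {x, y} \<in> E) xs"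
    "{last xs, hd xs} \<in> E"
  shows "length xs < 3"
proof (rule ccontr)
  assume *: "\<not> length xs < 3"
  then have "gpath V E (hd xs) (last xs) xs" using assms by (auto simp: gpath_iff)
  then show False using assms(1,5) * unfolding is_tree_def by (metis not_le)
qed

text \<open>If two paths part at the first step, the second meets the first again because both end
  in \<open>b\<close>; the pieces up to the first meeting point form a cycle through
  \<open>a\<close>.\<close>

lemma gpath_unique:
  assumes T: "is_tree V E"
  shows "gpath V E a b xs \<Longrightarrow> gpath V E a b ys \<Longrightarrow> xs = ys"
proof (induction xs arbitrary: a ys rule: induct_list012)
  case 1
  then show ?case by (simp add: gpath_def)
next
  case (2 x)
  then have "x = a" "a = b" by (auto simp: gpath_single)
  obtain y ys' where ys: "ys = y # ys'" using 2 by (cases ys) (auto simp: gpath_def)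
  show ?case
  proof (cases ys')
    case Nil
    then show ?thesis using 2 ys by (simp add: gpath_single)
  next
    case (Cons z zs)
    then have "a \<notin> set (z # zs)" "b \<in> set (z # zs)"
      using 2(2) ys by (auto simp: gpath_Cons_Cons) (auto simp: gpath_iff)
    then show ?thesis using \<open>a = b\<close> by simp
  qed
next
  case (3 x y zs)
  have p: "x = a" "a \<in> V" "a \<notin> set (y # zs)" "{a, y} \<in> E" "gpath V E y b (y # zs)"
    using 3(3) by (auto simp: gpath_Cons_Cons)
  have b1: "b \<in> set (y # zs)" using p(5) unfolding gpath_iff by (metis last_in_set)
  have "ys \<noteq> [a]" using 3(4) b1 p(3) by (auto simp: gpath_single)
  then obtain y' zs' where ys: "ys = a # y' # zs'" using 3(4)
    by (cases ys; cases "tl ys") (auto simp: gpath_def)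
  have q: "a \<notin> set (y' # zs')" "{a, y'} \<in> E" "gpath V E y' b (y' # zs')"
    using 3(4) by (auto simp: ys gpath_Cons_Cons)
  have "y = y'"
  proof (rule ccontr)
    assume ne: "y \<noteq> y'"
    have "b \<in> set (y' # zs')" using q(3) unfolding gpath_iff by (metis last_in_set)
    then have "\<exists>z\<in>set (y' # zs'). z \<in> set (y # zs)" using b1 by blast
    then obtain us z vs where us: "y' # zs' = us @ z # vs" "z \<in> set (y # zs)" "\<forall>u\<in>set us. u \<notin> set (y # zs)"
      by (rule split_list_first_propE)
    obtain ps qs where ps: "y # zs = ps @ z # qs" using us(2) by (meson split_list)
    \<comment> \<open>From \<open>a\<close> along the first path to the meeting point
      \<open>z\<close>, then back along the second to \<open>y'\<close>, which is joined to
      \<open>a\<close>. As cycles are excluded, only two entries remain, and \<open>y\<close> and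
      \<open>y'\<close> both equal \<open>z\<close>.\<close>
    let ?L = "a # ps @ z # rev us"
    have d: "distinct (ps @ z # qs)" "set (ps @ z # qs) \<subseteq> V" "successively (\<lambda>x y. {x, y} \<in> E) (ps @ z # qs)"
      using p(5) unfolding gpath_iff ps by auto
    have d': "distinct (us @ z # vs)" "set (us @ z # vs) \<subseteq> V" "successively (\<lambda>x y. {x, y} \<in> E) (us @ z # vs)"
      using q(3) unfolding gpath_iff us(1) by auto
    have "distinct ?L" using d(1) d'(1) p(3) q(1) us(3) unfolding ps us(1) by auto
    moreover have "set ?L \<subseteq> V" using d(2) d'(2) p(2) by auto
    moreover have "successively (\<lambda>x y. {x, y} \<in> E) ?L"
    proof -
      have "successively (\<lambda>x y. {x, y} \<in> E) (us @ [z])"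
        using d'(3) by (auto simp: successively_append_iff)
      then have "successively (\<lambda>x y. {x, y} \<in> E) (rev (us @ [z]))"
        by (subst successively_rev) (simp add: insert_commute)
      then have 1: "successively (\<lambda>x y. {x, y} \<in> E) (z # rev us)" by simp
      have "successively (\<lambda>x y. {x, y} \<in> E) ((a # ps) @ z # qs)"
        using d(3) p(4) ps by (cases ps) auto
      then show ?thesis using 1 unfolding append_Cons[symmetric] successively_append_iff by auto
    qed
    moreover have "last ?L = y'" using us(1) by (cases us) auto
    ultimately have "length ?L < 3" using tree_acyclic[OF T, of ?L] q(2) by (simp add: insert_commute)
    then have "ps = []" "us = []" by auto
    then show False using ps us(1) ne by simp
  qed
  then show ?case using 3(2)[OF p(5)] q(3) p(1) ys by simp
qed

lemma path_to_eq:
  assumes "is_tree V E" "gpath V E a b xs" shows "path_to V E a b = xs"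
  unfolding path_to_def using assms(2) by (rule the_equality) (rule gpath_unique[OF assms(1) _ assms(2)])

lemma gpath_path_to:
  assumes "is_tree V E" "a \<in> V" "b \<in> V" shows "gpath V E a b (path_to V E a b)"
proof -
  obtain xs where "gpath V E a b xs" using assms unfolding is_tree_def by blast
  then show ?thesis using path_to_eq[OF assms(1)] by simp
qed

definition parent :: "'v set \<Rightarrow> 'v set set \<Rightarrow> 'v \<Rightarrow> 'v \<Rightarrow> 'v" where
  "parent V E r v = path_to V E v r ! 1"

lemma path_to_self: "is_tree V E \<Longrightarrow> r \<in> V \<Longrightarrow> path_to V E r r = [r]"
  by (rule path_to_eq) (auto simp: gpath_single)

lemma path_to_parent:
  assumes T: "is_tree V E" and "v \<in> V" "r \<in> V" "v \<noteq> r"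
  shows "path_to V E v r = v # path_to V E (parent V E r v) r"
    "parent V E r v \<in> V" "{v, parent V E r v} \<in> E"
proof -
  have g: "gpath V E v r (path_to V E v r)" using gpath_path_to assms by metis
  then obtain y ys where y: "path_to V E v r = v # y # ys"
    using assms(4) by (cases "path_to V E v r"; cases "tl (path_to V E v r)") (auto simp: gpath_def)
  then have *: "{v, y} \<in> E" "gpath V E y r (y # ys)" using g by (auto simp: gpath_Cons_Cons)
  have p: "parent V E r v = y" using y by (simp add: parent_def)
  show "{v, parent V E r v} \<in> E" using * p by simp
  show "parent V E r v \<in> V" using * p by (auto simp: gpath_def)
  show "path_to V E v r = v # path_to V E (parent V E r v) r"
    using path_to_eq[OF T *(2)] p y by simp
qed

text \<open>Either \<open>b\<close> is off the path from \<open>a\<close> to the root, and then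
  \<open>a\<close> is the parent of \<open>b\<close>; or the stretch of that path from
  \<open>a\<close> to \<open>b\<close> closes up with the edge, so it has no inner vertex and
  \<open>b\<close> is the parent of \<open>a\<close>.\<close>

lemma tree_edge_parent:
  assumes T: "is_tree V E" and r: "r \<in> V" and e: "e \<in> E"
  obtains v where "v \<in> V" "v \<noteq> r" "e = {v, parent V E r v}"
proof -
  obtain a b where ab: "a \<in> V" "b \<in> V" "a \<noteq> b" "e = {a, b}" using T e unfolding is_tree_def by blast
  have ga: "gpath V E a r (path_to V E a r)" using gpath_path_to T ab r by metis
  then obtain xs where xs: "path_to V E a r = a # xs" by (cases "path_to V E a r") (auto simp: gpath_def)
  show thesis
  proof (cases "b \<in> set (a # xs)")
    case False
    have "gpath V E b r (b # a # xs)"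
      using ga False ab e unfolding xs by (simp add: gpath_Cons_Cons insert_commute)
    then have "path_to V E b r = b # a # xs" by (rule path_to_eq[OF T])
    moreover have "r \<in> set (a # xs)" using ga unfolding xs gpath_iff by (metis last_in_set)
    then have "b \<noteq> r" using False by blast
    ultimately show thesis using that[of b] ab by (simp add: parent_def insert_commute)
  next
    case True
    then obtain us vs where us: "xs = us @ b # vs" using ab(3) by (auto dest: split_list)
    have g: "distinct (a # xs)" "set (a # xs) \<subseteq> V" "successively (\<lambda>x y. {x, y} \<in> E) (a # xs)" "last (a # xs) = r"
      using ga unfolding xs gpath_iff by auto
    have "successively (\<lambda>x y. {x, y} \<in> E) ((a # us @ [b]) @ vs)" using g(3) us by simp
    then have "successively (\<lambda>x y. {x, y} \<in> E) (a # us @ [b])" using successively_append_iff by blast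
    then have "length (a # us @ [b]) < 3"
      using g us ab e by (intro tree_acyclic[OF T]) (auto simp: insert_commute)
    then have "us = []" by simp
    moreover have "a \<noteq> r" using g us by (auto split: if_splits)
    ultimately show thesis using that[of a] ab xs us by (simp add: parent_def)
  qed
qed

section \<open>Fusion in the completion of a rooted tree of groups\<close>

lemma fusion_system_mor:
  assumes "fusion_system H S F" "(P, Q, f) \<in> F"
  shows "subgroup P H" "P \<subseteq> S" "subgroup Q H" "Q \<subseteq> S" "f ` P \<subseteq> Q" "inj_on f P" "f = restrict f P"
proof -
  have "\<forall>(P, Q, f) \<in> F. subgroup P H \<and> P \<subseteq> S \<and> subgroup Q H \<and> Q \<subseteq> S \<and>
      f ` P \<subseteq> Q \<and> inj_on f P \<and> (\<forall>x\<in>P. \<forall>y\<in>P. f (x \<otimes>\<^bsub>H\<^esub> y) = f x \<otimes>\<^bsub>H\<^esub> f y) \<and> f = restrict f P"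
    using assms(1) unfolding fusion_system_def by (rule conjunct1)
  from bspec[OF this assms(2)]
  show "subgroup P H" "P \<subseteq> S" "subgroup Q H" "Q \<subseteq> S" "f ` P \<subseteq> Q" "inj_on f P" "f = restrict f P"
    unfolding prod.case by blast+
qed

lemma fusion_system_comp:
  assumes "fusion_system H S F" "(P, Q, f) \<in> F" "(Q, R, g) \<in> F"
  shows "(P, R, restrict (g \<circ> f) P) \<in> F"
  using assms unfolding fusion_system_def by blast

lemma fusion_system_restrict:
  assumes "fusion_system H S F" "(P, Q, f) \<in> F" "subgroup P' H" "P' \<subseteq> P" "subgroup Q' H" "Q' \<subseteq> S" "f ` P' \<subseteq> Q'"
  shows "(P', Q', restrict f P') \<in> F"
  using assms unfolding fusion_system_def by blast

text \<open>The tree as the induction needs it: each edge is indexed by its lower end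
  \<open>v\<close>, \<open>dep\<close> decreases towards the root, and \<open>psi\<close> is known
  only through its recursion along edges. The surjectivity in (H) is \<open>Sv_onto\<close>; the
  injectivity makes \<open>psi_edge\<close> true of the given identification.\<close>

locale rooted_tree_fusion =
  fixes p :: nat and V :: "'v set" and r :: 'v and par :: "'v \<Rightarrow> 'v" and dep :: "'v \<Rightarrow> nat"
    and Gv :: "'v \<Rightarrow> 'a monoid" and Ge :: "'v set \<Rightarrow> 'a monoid" and phi :: "'v set \<Rightarrow> 'v \<Rightarrow> 'a \<Rightarrow> 'a"
    and Sv :: "'v \<Rightarrow> 'a set" and Se :: "'v set \<Rightarrow> 'a set" and gg :: "'v set \<Rightarrow> 'v \<Rightarrow> 'a"
    and psi :: "'v \<Rightarrow> 'a \<Rightarrow> 'a"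
  assumes prime_p: "Factorial_Ring.prime p" and fin_V: "finite V" and r_V: "r \<in> V"
    and par_V: "v \<in> V \<Longrightarrow> v \<noteq> r \<Longrightarrow> par v \<in> V"
    and dep_par: "v \<in> V \<Longrightarrow> v \<noteq> r \<Longrightarrow> dep (par v) < dep v"
    and vertex_group: "v \<in> V \<Longrightarrow> group (Gv v)" and vertex_finite: "v \<in> V \<Longrightarrow> finite (carrier (Gv v))"
    and edge_group: "v \<in> V \<Longrightarrow> v \<noteq> r \<Longrightarrow> group (Ge {v, par v})"
    and edge_finite: "v \<in> V \<Longrightarrow> v \<noteq> r \<Longrightarrow> finite (carrier (Ge {v, par v}))"
    and edge_hom: "v \<in> V \<Longrightarrow> v \<noteq> r \<Longrightarrow> w \<in> {v, par v} \<Longrightarrow> phi {v, par v} w \<in> hom (Ge {v, par v}) (Gv w)"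
    and edge_inj: "v \<in> V \<Longrightarrow> v \<noteq> r \<Longrightarrow> w \<in> {v, par v} \<Longrightarrow> inj_on (phi {v, par v} w) (carrier (Ge {v, par v}))"
    and Sv_sylow: "v \<in> V \<Longrightarrow> sylow_finite (Gv v) p (Sv v)"
    and Se_sylow: "v \<in> V \<Longrightarrow> v \<noteq> r \<Longrightarrow> sylow_finite (Ge {v, par v}) p (Se {v, par v})"
    and gg_closed: "v \<in> V \<Longrightarrow> v \<noteq> r \<Longrightarrow> w \<in> {v, par v} \<Longrightarrow> gg {v, par v} w \<in> carrier (Gv w)"
    and gg_Sv: "v \<in> V \<Longrightarrow> v \<noteq> r \<Longrightarrow> w \<in> {v, par v} \<Longrightarrow> s \<in> Se {v, par v}
      \<Longrightarrow> conj (Gv w) (gg {v, par v} w) (phi {v, par v} w s) \<in> Sv w"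
    and Sv_onto: "v \<in> V \<Longrightarrow> v \<noteq> r \<Longrightarrow> x \<in> Sv v
      \<Longrightarrow> \<exists>s\<in>Se {v, par v}. x = conj (Gv v) (gg {v, par v} v) (phi {v, par v} v s)"
    and psi_root: "psi r x = x"
    and psi_edge: "v \<in> V \<Longrightarrow> v \<noteq> r \<Longrightarrow> s \<in> Se {v, par v}
      \<Longrightarrow> psi v (conj (Gv v) (gg {v, par v} v) (phi {v, par v} v s))
        = psi (par v) (conj (Gv (par v)) (gg {v, par v} (par v)) (phi {v, par v} (par v) s))"
begin

section \<open>Rooted subtrees and conjugations realised by a fusion system\<close>

definition closed_set :: "'v set \<Rightarrow> bool" where
  "closed_set W \<longleftrightarrow> r \<in> W \<and> W \<subseteq> V \<and> (\<forall>v\<in>W. v \<noteq> r \<longrightarrow> par v \<in> W)"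

definition edges :: "'v set \<Rightarrow> 'v set set" where
  "edges W = (\<lambda>v. {v, par v}) ` (W - {r})"

abbreviation "sub_GT W \<equiv> completion W (edges W) Gv Ge phi"
abbreviation "sub_emb W \<equiv> completion_emb W (edges W) Gv Ge phi"

definition gens :: "'v set \<Rightarrow> 'a fmor set" where
  "gens W = {(psi v ` P, psi v ` Sv v, restrict (psi v \<circ> conj (Gv v) g \<circ> inv_into (Sv v) (psi v)) (psi v ` P))
    | v P g. v \<in> W \<and> subgroup P (Gv v) \<and> P \<subseteq> Sv v \<and> g \<in> carrier (Gv v) \<and> conj (Gv v) g ` P \<subseteq> Sv v}"

text \<open>The target is always \<open>Sv r\<close>, since restriction recovers smaller targets.
  The source is a subset of the completion because that is what the predicate \<open>M\<close> of
  \<open>amalgam_fusion\<close> takes.\<close>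

definition realised :: "'v set \<Rightarrow> 'a fmor set \<Rightarrow> ('v \<times> 'a) list set set \<Rightarrow> ('v \<times> 'a) list set \<Rightarrow> bool" where
  "realised W F P g \<longleftrightarrow> (\<exists>P0 f. P = sub_emb W r ` P0 \<and> (P0, Sv r, f) \<in> F \<and>
    (\<forall>x\<in>P0. sub_emb W r (f x) = conj (sub_GT W) g (sub_emb W r x)))"

lemma closed_V: "closed_set W \<Longrightarrow> v \<in> W \<Longrightarrow> v \<in> V"
  by (auto simp: closed_set_def)

lemma Sv_subgroup: "v \<in> V \<Longrightarrow> subgroup (Sv v) (Gv v)"
  using Sv_sylow by (simp add: sylow_finite_def)

lemma Sv_carrier: "v \<in> V \<Longrightarrow> x \<in> Sv v \<Longrightarrow> x \<in> carrier (Gv v)"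
  by (rule subgroup.mem_carrier[OF Sv_subgroup])

lemma Sv_sylow_gen: "v \<in> V \<Longrightarrow> sylow_gen (Gv v) p (Sv v)"
  by (rule group.sylow_finite_imp_sylow_gen[OF vertex_group vertex_finite prime_p Sv_sylow])

lemma Se_sylow_gen: "v \<in> V \<Longrightarrow> v \<noteq> r \<Longrightarrow> sylow_gen (Ge {v, par v}) p (Se {v, par v})"
  by (rule group.sylow_finite_imp_sylow_gen[OF edge_group edge_finite prime_p Se_sylow])

lemma Se_carrier: "v \<in> V \<Longrightarrow> v \<noteq> r \<Longrightarrow> s \<in> Se {v, par v} \<Longrightarrow> s \<in> carrier (Ge {v, par v})"
  using Se_sylow by (meson sylow_finite_def subgroup.mem_carrier)

lemma closed_graph:
  assumes "closed_set W" shows "graph_of_groups W (edges W) Gv Ge phi"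
proof (rule graph_of_groups.intro)
  show "group (Gv v)" if "v \<in> W" for v using vertex_group closed_V[OF assms that] by blast
  show "group (Ge e)" if "e \<in> edges W" for e using that edge_group closed_V[OF assms] by (auto simp: edges_def)
  show "v \<in> W" if "e \<in> edges W" "v \<in> e" for e v using that assms by (auto simp: edges_def closed_set_def)
  show "phi e v \<in> hom (Ge e) (Gv v)" if "e \<in> edges W" "v \<in> e" for e v
    using that edge_hom closed_V[OF assms] unfolding edges_def by blast
qed

lemma sub_emb_edge:
  assumes W: "closed_set W" and v: "v \<in> W" "v \<noteq> r" and s: "s \<in> carrier (Ge {v, par v})"
  shows "sub_emb W v (phi {v, par v} v s) = sub_emb W (par v) (phi {v, par v} (par v) s)"
  by (rule graph_of_groups.emb_edge[OF closed_graph[OF W]]) (use v s in \<open>auto simp: edges_def\<close>)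

text \<open>The images of an edge element in the Sylow groups of its two endpoints are conjugate in
  the completion to one and the same element; this turns each step of the identification into a
  conjugation.\<close>

lemma transport_edge:
  assumes W: "closed_set W" and v: "v \<in> W" "v \<noteq> r" and s: "s \<in> Se {v, par v}"
    and w: "w \<in> {v, par v}"
  shows "sub_emb W w (conj (Gv w) (gg {v, par v} w) (phi {v, par v} w s))
    = conj (sub_GT W) (sub_emb W w (gg {v, par v} w)) (sub_emb W v (phi {v, par v} v s))"
proof -
  interpret graph_of_groups W "edges W" Gv Ge phi using W by (rule closed_graph)
  have wW: "w \<in> W" using v w W by (auto simp: closed_set_def)
  have vV: "v \<in> V" using closed_V W v by blast
  have sC: "s \<in> carrier (Ge {v, par v})" using Se_carrier vV v s by blast
  have "sub_emb W w (conj (Gv w) (gg {v, par v} w) (phi {v, par v} w s))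
    = conj (sub_GT W) (sub_emb W w (gg {v, par v} w)) (sub_emb W w (phi {v, par v} w s))"
    using hom_conj[OF Gv_group[OF wW] group_GT emb_hom[OF wW]] gg_closed[OF vV v(2) w]
      hom_in_carrier[OF edge_hom[OF vV v(2) w] sC] by blast
  then show ?thesis using sub_emb_edge[OF W v sC] w by auto
qed

text \<open>One \<open>t\<close> works for all of \<open>Sv v\<close>. Going up an edge,
  \<open>inv a\<close> undoes the twist by \<open>gg\<close> at \<open>v\<close>, \<open>b\<close>
  applies the twist at the parent, and the element found for the parent does the rest.\<close>

lemma psi_conj:
  assumes W: "closed_set W" and "v \<in> W"
  shows "\<exists>t\<in>carrier (sub_GT W). \<forall>x\<in>Sv v. psi v x \<in> Sv r
    \<and> sub_emb W r (psi v x) = conj (sub_GT W) t (sub_emb W v x)"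
  using \<open>v \<in> W\<close>
proof (induction "dep v" arbitrary: v rule: less_induct)
  case less
  interpret graph_of_groups W "edges W" Gv Ge phi using W by (rule closed_graph)
  interpret GT: group "sub_GT W" by (rule group_GT)
  have vV: "v \<in> V" using closed_V W less.prems by blast
  show ?case
  proof (cases "v = r")
    case True
    then show ?thesis using emb_closed[OF less.prems] Sv_carrier[OF vV]
      by (intro bexI[of _ "\<one>\<^bsub>sub_GT W\<^esub>"]) (auto simp: psi_root)
  next
    case False
    let ?e = "{v, par v}" and ?w = "par v"
    have w: "?w \<in> W" using W less.prems False by (auto simp: closed_set_def)
    obtain t where t: "t \<in> carrier (sub_GT W)" "\<And>x. x \<in> Sv ?w \<Longrightarrow> psi ?w x \<in> Sv r
        \<and> sub_emb W r (psi ?w x) = conj (sub_GT W) t (sub_emb W ?w x)"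
      using less.hyps[OF dep_par[OF vV False] w] by blast
    define a where "a = sub_emb W v (gg ?e v)"
    define b where "b = sub_emb W ?w (gg ?e ?w)"
    have ab: "a \<in> carrier (sub_GT W)" "b \<in> carrier (sub_GT W)"
      unfolding a_def b_def using emb_closed less.prems w gg_closed[OF vV False] by auto
    have "psi v x \<in> Sv r \<and> sub_emb W r (psi v x) = conj (sub_GT W) (inv\<^bsub>sub_GT W\<^esub> a \<otimes>\<^bsub>sub_GT W\<^esub> b \<otimes>\<^bsub>sub_GT W\<^esub> t) (sub_emb W v x)"
      if x: "x \<in> Sv v" for x
    proof -
      obtain s where s: "s \<in> Se ?e" "x = conj (Gv v) (gg ?e v) (phi ?e v s)"
        using Sv_onto[OF vV False x] by blast
      define y where "y = conj (Gv ?w) (gg ?e ?w) (phi ?e ?w s)"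
      define c where "c = sub_emb W v (phi ?e v s)"
      have "s \<in> carrier (Ge ?e)" using Se_carrier[OF vV False s(1)] .
      then have c: "c \<in> carrier (sub_GT W)" unfolding c_def
        using emb_closed[OF less.prems] hom_in_carrier[OF edge_hom[OF vV False]] by blast
      have y: "y \<in> Sv ?w" unfolding y_def using gg_Sv[OF vV False _ s(1)] by blast
      have "psi v x = psi ?w y" unfolding s(2) y_def by (rule psi_edge[OF vV False s(1)])
      moreover have "sub_emb W v x = conj (sub_GT W) a c" "sub_emb W ?w y = conj (sub_GT W) b c"
        unfolding s(2) y_def a_def b_def c_def
        using transport_edge[OF W less.prems False s(1)] by blast+
      ultimately show ?thesis using t(2)[OF y] t(1) ab c
        by (simp add: GT.conj_mult)
    qed
    then show ?thesis using ab t(1) by (intro bexI[of _ "inv\<^bsub>sub_GT W\<^esub> a \<otimes>\<^bsub>sub_GT W\<^esub> b \<otimes>\<^bsub>sub_GT W\<^esub> t"]) auto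
  qed
qed

text \<open>The two witnessing morphisms fit together because the root group embeds: the source of
  the second is forced to be the image of the first.\<close>

lemma realised_comp:
  assumes W: "closed_set W" and inj: "inj_on (sub_emb W r) (carrier (Gv r))"
    and F: "fusion_system (Gv r) (Sv r) F" and g: "g \<in> carrier (sub_GT W)" "h \<in> carrier (sub_GT W)"
    and R: "realised W F P g" "realised W F (conj (sub_GT W) g ` P) h"
  shows "realised W F P (g \<otimes>\<^bsub>sub_GT W\<^esub> h)"
proof -
  interpret graph_of_groups W "edges W" Gv Ge phi using W by (rule closed_graph)
  interpret GT: group "sub_GT W" by (rule group_GT)
  have rW: "r \<in> W" using W by (simp add: closed_set_def)
  obtain P0 f where f: "P = sub_emb W r ` P0" "(P0, Sv r, f) \<in> F"
    "\<And>x. x \<in> P0 \<Longrightarrow> sub_emb W r (f x) = conj (sub_GT W) g (sub_emb W r x)"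
    using R(1) by (auto simp: realised_def)
  obtain P1 f' where f': "conj (sub_GT W) g ` P = sub_emb W r ` P1" "(P1, Sv r, f') \<in> F"
    "\<And>x. x \<in> P1 \<Longrightarrow> sub_emb W r (f' x) = conj (sub_GT W) h (sub_emb W r x)"
    using R(2) by (auto simp: realised_def)
  have sub: "P0 \<subseteq> carrier (Gv r)" "P1 \<subseteq> carrier (Gv r)" "f ` P0 \<subseteq> carrier (Gv r)"
    using fusion_system_mor(1,5)[OF F f(2)] fusion_system_mor(1)[OF F f'(2)] fusion_system_mor(3)[OF F f(2)]
    by (auto dest: subgroup.subset)
  have "sub_emb W r ` f ` P0 = sub_emb W r ` P1" using f(1,3) f'(1) by (simp add: image_image)
  then have P1: "P1 = f ` P0" by (rule iffD1[OF inj_on_image_eq_iff[OF inj sub(3,2)], symmetric])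
  have "(P0, P1, restrict f P0) \<in> F"
    by (rule fusion_system_restrict[OF F f(2) fusion_system_mor(1)[OF F f(2)] order_refl
          fusion_system_mor(1,2)[OF F f'(2)]]) (simp add: P1)
  then have "(P0, P1, f) \<in> F" using fusion_system_mor(7)[OF F f(2)] by metis
  from fusion_system_comp[OF F this f'(2)] have "(P0, Sv r, restrict (f' \<circ> f) P0) \<in> F" .
  moreover have "sub_emb W r (restrict (f' \<circ> f) P0 x) = conj (sub_GT W) (g \<otimes>\<^bsub>sub_GT W\<^esub> h) (sub_emb W r x)"
    if x: "x \<in> P0" for x
    using x f(3)[OF x] f'(3)[of "f x"] P1 g emb_closed[OF rW] sub(1) by (auto simp: GT.conj_mult)
  ultimately show ?thesis unfolding realised_def using f(1) by blast
qed

text \<open>As \<open>psi v\<close> is conjugation by \<open>t\<close>, the element t^-1 k t acts on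
  the identified group the way \<open>k\<close> acts on \<open>Sv v\<close>. Pulling
  \<open>P\<close> back to a subgroup \<open>Q\<close> of \<open>Sv v\<close> therefore exhibits the
  map as a generator, up to enlarging the target.\<close>

lemma realised_gens:
  assumes W: "closed_set W" and v: "v \<in> W"
    and inj: "inj_on (sub_emb W r) (carrier (Gv r))" "inj_on (sub_emb W v) (carrier (Gv v))"
    and F: "fusion_system (Gv r) (Sv r) F" "gens W \<subseteq> F"
    and t: "t \<in> carrier (sub_GT W)" "\<And>x. x \<in> Sv v \<Longrightarrow> psi v x \<in> Sv r
      \<and> sub_emb W r (psi v x) = conj (sub_GT W) t (sub_emb W v x)"
    and k: "k \<in> carrier (Gv v)" and g: "g = inv\<^bsub>sub_GT W\<^esub> t \<otimes>\<^bsub>sub_GT W\<^esub> sub_emb W v k \<otimes>\<^bsub>sub_GT W\<^esub> t"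
    and P: "subgroup P (sub_GT W)" "P \<subseteq> sub_emb W r ` psi v ` Sv v"
      "conj (sub_GT W) g ` P \<subseteq> sub_emb W r ` psi v ` Sv v"
  shows "realised W F P g"
proof -
  interpret graph_of_groups W "edges W" Gv Ge phi using W by (rule closed_graph)
  interpret GT: group "sub_GT W" by (rule group_GT)
  have vV: "v \<in> V" using closed_V W v by blast
  interpret Gv: group "Gv v" by (rule vertex_group[OF vV])
  interpret em: group_hom "Gv v" "sub_GT W" "sub_emb W v"
    by (simp add: group_hom_def group_hom_axioms_def emb_hom[OF v] Gv.is_group GT.is_group)
  have kc: "sub_emb W v k \<in> carrier (sub_GT W)" using emb_closed[OF v k] .
  have conj_inj: "x = y" if "conj (sub_GT W) t (sub_emb W v x) = conj (sub_GT W) t (sub_emb W v y)"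
    "x \<in> carrier (Gv v)" "y \<in> carrier (Gv v)" for x y
    using that GT.inj_on_conj[OF t(1)] inj(2) emb_closed[OF v] by (meson inj_onD)
  have psi_inj: "inj_on (psi v) (Sv v)"
    using t(2) Sv_carrier[OF vV] conj_inj by (intro inj_onI) metis
  define Q where "Q = {x \<in> Sv v. sub_emb W r (psi v x) \<in> P}"
  have Q_iff: "x \<in> Q \<longleftrightarrow> x \<in> Sv v \<and> conj (sub_GT W) t (sub_emb W v x) \<in> P" for x
    using t(2) by (auto simp: Q_def)
  have QP: "P = sub_emb W r ` psi v ` Q" using P(2) by (auto simp: Q_def)
  have "subgroup Q (Gv v)"
  proof -
    have "subgroup {x \<in> carrier (Gv v). conj (sub_GT W) t (sub_emb W v x) \<in> P} (Gv v)"
    proof (rule Gv.subgroupI)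
      show "{x \<in> carrier (Gv v). conj (sub_GT W) t (sub_emb W v x) \<in> P} \<noteq> {}"
        using t(1) subgroup.one_closed[OF P(1)]
        by (auto simp: conj_def intro!: exI[of _ "\<one>\<^bsub>Gv v\<^esub>"])
      fix x y assume "x \<in> {x \<in> carrier (Gv v). conj (sub_GT W) t (sub_emb W v x) \<in> P}"
        "y \<in> {x \<in> carrier (Gv v). conj (sub_GT W) t (sub_emb W v x) \<in> P}"
      then show "x \<otimes>\<^bsub>Gv v\<^esub> y \<in> {x \<in> carrier (Gv v). conj (sub_GT W) t (sub_emb W v x) \<in> P}"
        using t(1) subgroup.m_closed[OF P(1)] by (auto simp: GT.conj_distrib)
    next
      fix x assume x: "x \<in> {x \<in> carrier (Gv v). conj (sub_GT W) t (sub_emb W v x) \<in> P}"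
      then have "inv\<^bsub>sub_GT W\<^esub> (conj (sub_GT W) t (sub_emb W v x)) \<in> P"
        using subgroup.m_inv_closed[OF P(1)] by blast
      moreover have "inv\<^bsub>sub_GT W\<^esub> (conj (sub_GT W) t (sub_emb W v x)) = conj (sub_GT W) t (sub_emb W v (inv\<^bsub>Gv v\<^esub> x))"
        using x t(1) by (simp add: conj_def GT.inv_mult_group GT.m_assoc)
      ultimately show "inv\<^bsub>Gv v\<^esub> x \<in> {x \<in> carrier (Gv v). conj (sub_GT W) t (sub_emb W v x) \<in> P}"
        using x by simp
    qed auto
    from Gv.subgroups_Inter_pair[OF Sv_subgroup[OF vV] this]
    have "subgroup (Sv v \<inter> {x \<in> carrier (Gv v). conj (sub_GT W) t (sub_emb W v x) \<in> P}) (Gv v)" .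
    moreover have "Sv v \<inter> {x \<in> carrier (Gv v). conj (sub_GT W) t (sub_emb W v x) \<in> P} = Q"
      using Q_iff Sv_carrier[OF vV] by auto
    ultimately show ?thesis by simp
  qed
  have conj_g: "conj (sub_GT W) g (sub_emb W r (psi v x)) = conj (sub_GT W) t (sub_emb W v (conj (Gv v) k x))"
    if x: "x \<in> Sv v" for x
  proof -
    have xc: "x \<in> carrier (Gv v)" using Sv_carrier[OF vV x] .
    have "conj (sub_GT W) g (sub_emb W r (psi v x)) = conj (sub_GT W) (t \<otimes>\<^bsub>sub_GT W\<^esub> g) (sub_emb W v x)"
      using t(2)[OF x] t(1) kc g emb_closed[OF v xc] by (simp add: GT.conj_mult)
    also have "t \<otimes>\<^bsub>sub_GT W\<^esub> g = sub_emb W v k \<otimes>\<^bsub>sub_GT W\<^esub> t" using g t(1) kc by (simp add: GT.m_assoc)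
    also have "conj (sub_GT W) \<dots> (sub_emb W v x) = conj (sub_GT W) t (sub_emb W v (conj (Gv v) k x))"
      using t(1) kc emb_closed[OF v xc] hom_conj[OF Gv.is_group GT.is_group emb_hom[OF v] k xc]
      by (simp add: GT.conj_mult)
    finally show ?thesis .
  qed
  have kQ: "conj (Gv v) k x \<in> Sv v" if x: "x \<in> Q" for x
  proof -
    have xS: "x \<in> Sv v" using x by (simp add: Q_def)
    have "conj (sub_GT W) g (sub_emb W r (psi v x)) \<in> sub_emb W r ` psi v ` Sv v" using P(3) x by (auto simp: Q_def)
    then obtain y where y: "y \<in> Sv v" "conj (sub_GT W) t (sub_emb W v (conj (Gv v) k x)) = conj (sub_GT W) t (sub_emb W v y)"
      using conj_g[OF xS] t(2) by auto
    then have "conj (Gv v) k x = y" using conj_inj k Sv_carrier[OF vV] xS by simp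
    then show ?thesis using y(1) by simp
  qed
  define f where "f = restrict (psi v \<circ> conj (Gv v) k \<circ> inv_into (Sv v) (psi v)) (psi v ` Q)"
  have QS: "Q \<subseteq> Sv v" by (auto simp: Q_def)
  have f_psi: "f (psi v x) = psi v (conj (Gv v) k x)" if "x \<in> Q" for x
    using that QS psi_inj by (auto simp: f_def)
  have "(psi v ` Q, psi v ` Sv v, f) \<in> gens W"
    unfolding gens_def f_def using v \<open>subgroup Q (Gv v)\<close> QS k kQ by blast
  then have fF: "(psi v ` Q, psi v ` Sv v, f) \<in> F" using F(2) by blast
  have "(psi v ` Q, Sv r, restrict f (psi v ` Q)) \<in> F"
    using fusion_system_mor(1)[OF F(1) fF] Sv_subgroup[OF r_V] t(2) kQ
    by (intro fusion_system_restrict[OF F(1) fF]) (auto simp: f_psi)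
  then have "(psi v ` Q, Sv r, f) \<in> F" using fusion_system_mor(7)[OF F(1) fF] by metis
  moreover have "sub_emb W r (f y) = conj (sub_GT W) g (sub_emb W r y)" if "y \<in> psi v ` Q" for y
    using that f_psi conj_g QS kQ t(2) by auto
  ultimately show ?thesis unfolding realised_def using QP by blast
qed

text \<open>Injectivity at the parent vertex allows the next amalgam to be formed; quantification
  over all \<open>F\<close> lets the fusion clause pass to larger vertex sets by
  \<open>gens_mono\<close>.\<close>

definition good :: "'v set \<Rightarrow> bool" where
  "good W \<longleftrightarrow> (\<forall>v\<in>W. inj_on (sub_emb W v) (carrier (Gv v))) \<and>
    sylow_gen (sub_GT W) p (sub_emb W r ` Sv r) \<and>
    (\<forall>F P g. fusion_system (Gv r) (Sv r) F \<longrightarrow> gens W \<subseteq> F \<longrightarrow> finite_p_subgroup (sub_GT W) p P \<longrightarrow>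
      P \<subseteq> sub_emb W r ` Sv r \<longrightarrow> g \<in> carrier (sub_GT W) \<longrightarrow> conj (sub_GT W) g ` P \<subseteq> sub_emb W r ` Sv r \<longrightarrow>
      realised W F P g)"

text \<open>The completion is the root group itself and \<open>psi r\<close> is the identity, so
  \<open>realised_gens\<close> applies with trivial \<open>t\<close>.\<close>

lemma good_root: "good {r}"
proof -
  have W: "closed_set {r}" using r_V by (auto simp: closed_set_def)
  have edges: "edges {r} = {}" by (simp add: edges_def)
  interpret graph_of_groups "{r}" "edges {r}" Gv Ge phi using W by (rule closed_graph)
  interpret GT: group "sub_GT {r}" by (rule group_GT)
  have bij: "bij_betw (sub_emb {r} r) (carrier (Gv r)) (carrier (sub_GT {r}))"
    unfolding edges using vertex_group[OF r_V] by (rule completion_single_vertex)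
  then have inj: "inj_on (sub_emb {r} r) (carrier (Gv r))" and surj: "carrier (sub_GT {r}) = sub_emb {r} r ` carrier (Gv r)"
    by (auto simp: bij_betw_def)
  have hom: "sub_emb {r} r \<in> hom (Gv r) (sub_GT {r})" by (rule emb_hom) simp
  have "sylow_gen (sub_GT {r}) p (sub_emb {r} r ` Sv r)"
    unfolding sylow_gen_def
  proof (intro conjI allI impI)
    have "finite_p_subgroup (Gv r) p (Sv r)" using Sv_sylow_gen[OF r_V] by (simp add: sylow_gen_def)
    then show "finite_p_subgroup (sub_GT {r}) p (sub_emb {r} r ` Sv r)"
      by (rule finite_p_subgroup_image[OF vertex_group[OF r_V] GT.is_group hom inj])
    fix P assume P: "finite_p_subgroup (sub_GT {r}) p P"
    then have "P \<subseteq> sub_emb {r} r ` carrier (Gv r)"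
      unfolding surj[symmetric] by (simp add: finite_p_subgroup_def subgroup.subset)
    then obtain g where "g \<in> carrier (Gv r)" "conj (sub_GT {r}) (sub_emb {r} r g) ` P \<subseteq> sub_emb {r} r ` Sv r"
      using sylow_gen_image[OF vertex_group[OF r_V] GT.is_group hom inj Sv_sylow_gen[OF r_V] P] by blast
    then show "\<exists>g\<in>carrier (sub_GT {r}). conj (sub_GT {r}) g ` P \<subseteq> sub_emb {r} r ` Sv r"
      unfolding surj by blast
  qed
  moreover have "realised {r} F P g"
    if F: "fusion_system (Gv r) (Sv r) F" "gens {r} \<subseteq> F" and P: "finite_p_subgroup (sub_GT {r}) p P"
      "P \<subseteq> sub_emb {r} r ` Sv r" and g: "g \<in> carrier (sub_GT {r})" "conj (sub_GT {r}) g ` P \<subseteq> sub_emb {r} r ` Sv r"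
    for F P g
  proof -
    obtain k where k: "k \<in> carrier (Gv r)" "g = sub_emb {r} r k" using g(1) unfolding surj by blast
    have psi: "psi r ` Sv r = Sv r" by (auto simp: psi_root image_iff)
    show ?thesis
      using P g(2) k g(1) emb_closed[of r] Sv_carrier[OF r_V]
      by (intro realised_gens[OF W _ inj inj F, of "\<one>\<^bsub>sub_GT {r}\<^esub>" k])
        (auto simp: psi psi_root finite_p_subgroup_def)
  qed
  ultimately show ?thesis using inj by (simp add: good_def)
qed

text \<open>No amalgam is constructed: the universal property maps the completion of
  \<open>W\<close> to permutations of the normal forms over the two smaller groups. This action
  shows both that these groups embed and that reduced words have a well-defined length.\<close>

lemma peel:
  assumes W: "closed_set W" and v: "v \<in> W" "v \<noteq> r" and W': "closed_set W'" "W' = W - {v}"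
    and inj: "\<And>u. u \<in> W' \<Longrightarrow> inj_on (sub_emb W' u) (carrier (Gv u))"
  obtains j len where "j \<in> hom (sub_GT W') (sub_GT W)" "inj_on j (carrier (sub_GT W'))"
    "\<And>u g. u \<in> W' \<Longrightarrow> g \<in> carrier (Gv u) \<Longrightarrow> j (sub_emb W' u g) = sub_emb W u g"
    "inj_on (sub_emb W v) (carrier (Gv v))"
    "amalgam_length (sub_GT W) (\<lambda>b. if b then j ` carrier (sub_GT W') else sub_emb W v ` carrier (Gv v)) len"
    "j ` carrier (sub_GT W') \<inter> sub_emb W v ` carrier (Gv v)
      = (\<lambda>c. sub_emb W v (phi {v, par v} v c)) ` carrier (Ge {v, par v})"
proof -
  let ?e = "{v, par v}" and ?w = "par v"
  have vV: "v \<in> V" using closed_V W v by blast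
  have wW': "?w \<in> W'"
    using W v W' dep_par[OF vV v(2)] by (auto simp: closed_set_def)
  have edges: "edges W = insert ?e (edges W')" using v W'(2) by (auto simp: edges_def)
  interpret GW: graph_of_groups W "edges W" Gv Ge phi using W by (rule closed_graph)
  interpret GW': graph_of_groups W' "edges W'" Gv Ge phi using W'(1) by (rule closed_graph)
  interpret GB: graph_of_groups "{v}" "{}" Gv Ge phi using vertex_group[OF vV] by (rule single_vertex_graph)
  \<comment> \<open>The removed vertex group, copied into its one-vertex completion to share the
    element type of the other factor.\<close>
  define B where "B = completion {v} {} Gv Ge phi"
  define eB where "eB = completion_emb {v} {} Gv Ge phi v"
  have eB_bij: "bij_betw eB (carrier (Gv v)) (carrier B)"
    unfolding eB_def B_def using vertex_group[OF vV] by (rule completion_single_vertex)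
  have eB_hom: "eB \<in> hom (Gv v) B" unfolding eB_def B_def by (rule GB.emb_hom) simp
  define H where "H b = (if b then sub_GT W' else B)" for b
  define \<kappa> where "\<kappa> b = (if b then (\<lambda>c. sub_emb W' ?w (phi ?e ?w c)) else (\<lambda>c. eB (phi ?e v c)))" for b
  have H_simps [simp]: "H True = sub_GT W'" "H False = B" by (auto simp: H_def)
  have \<kappa>_simps [simp]: "\<kappa> True c = sub_emb W' ?w (phi ?e ?w c)" "\<kappa> False c = eB (phi ?e v c)" for c
    by (auto simp: \<kappa>_def)
  have w_hom: "phi ?e ?w \<in> hom (Ge ?e) (Gv ?w)" and v_hom: "phi ?e v \<in> hom (Ge ?e) (Gv v)"
    using edge_hom[OF vV v(2)] by auto
  have w_car: "phi ?e ?w c \<in> carrier (Gv ?w)" and v_car: "phi ?e v c \<in> carrier (Gv v)"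
    if "c \<in> carrier (Ge ?e)" for c
    using that hom_in_carrier[OF w_hom] hom_in_carrier[OF v_hom] by auto
  interpret A: amalgam_factors H "Ge ?e" \<kappa>
  proof (rule amalgam_factors.intro)
    show "group (Ge ?e)" by (rule edge_group[OF vV v(2)])
    fix b
    show "group (H b)" by (cases b) (auto simp: GW'.group_GT GB.group_GT B_def)
    show "\<kappa> b \<in> hom (Ge ?e) (H b)"
    proof (cases b)
      case True
      then show ?thesis using hom_compose[OF w_hom GW'.emb_hom[OF wW']] by (simp add: \<kappa>_def comp_def)
    next
      case False
      then show ?thesis using hom_compose[OF v_hom eB_hom] by (simp add: \<kappa>_def comp_def)
    qed
    show "inj_on (\<kappa> b) (carrier (Ge ?e))"
    proof (cases b)
      case True
      then show ?thesis
        using edge_inj[OF vV v(2), of ?w] inj[OF wW'] w_car by (simp add: inj_on_def \<kappa>_def)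
    next
      case False
      then show ?thesis
        using edge_inj[OF vV v(2), of v] eB_bij v_car by (simp add: bij_betw_def inj_on_def \<kappa>_def)
    qed
  qed
  obtain j where j: "j \<in> hom (sub_GT W') (sub_GT W)"
    "\<And>u g. u \<in> W' \<Longrightarrow> g \<in> carrier (Gv u) \<Longrightarrow> j (sub_emb W' u g) = sub_emb W u g"
  proof (rule GW'.GT_universal[OF GW.group_GT])
    show "sub_emb W u \<in> hom (Gv u) (sub_GT W)" if "u \<in> W'" for u using that W'(2) by (intro GW.emb_hom) simp
    show "sub_emb W a (phi e' a x) = sub_emb W b (phi e' b x)"
      if "e' \<in> edges W'" "a \<in> e'" "b \<in> e'" "x \<in> carrier (Ge e')" for e' a b x
      using that edges by (intro GW.emb_edge) auto
  qed blast
  obtain j' where j': "j' \<in> hom B (sub_GT W)" "\<And>g. g \<in> carrier (Gv v) \<Longrightarrow> j' (eB g) = sub_emb W v g"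
  proof (rule GB.GT_universal[OF GW.group_GT, of "\<lambda>_. sub_emb W v"])
    show "sub_emb W v \<in> hom (Gv u) (sub_GT W)" if "u \<in> {v}" for u using that GW.emb_hom[OF v(1)] by simp
  qed (auto simp: B_def eB_def)
  let ?\<Omega> = A.states
  define rho where "rho b h = restrict (A.act b h) ?\<Omega>" for b h
  have rho_action: "group_action (H b) ?\<Omega> (rho b)" for b
    unfolding rho_def
    by (rule group_actionI) (auto simp: A.H_group A.act_states A.act_one A.act_mult)
  then have rho_hom: "rho b \<in> hom (H b) (BijGroup ?\<Omega>)" for b
    by (simp add: group_action_def group_hom_def group_hom_axioms_def)
  have rho_\<kappa>: "rho True (\<kappa> True c) = rho False (\<kappa> False c)" if "c \<in> carrier (Ge ?e)" for c
    unfolding rho_def by (rule restrict_ext) (simp only: A.act_\<kappa>[OF that])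
  \<comment> \<open>Each vertex group acts through the factor that contains it. Compatibility along
    an old edge holds already in the smaller completion; along the new edge it is
    \<open>rho_\<kappa>\<close>.\<close>
  define f where "f u = (if u = v then rho False \<circ> eB else rho True \<circ> sub_emb W' u)" for u
  have f_edge: "f v (phi ?e v c) = f ?w (phi ?e ?w c)" if "c \<in> carrier (Ge ?e)" for c
    using rho_\<kappa>[OF that] wW' W'(2) by (auto simp: f_def)
  obtain Act where Act: "Act \<in> hom (sub_GT W) (BijGroup ?\<Omega>)"
    "\<And>u g. u \<in> W \<Longrightarrow> g \<in> carrier (Gv u) \<Longrightarrow> Act (sub_emb W u g) = f u g"
  proof (rule GW.GT_universal[OF group_BijGroup])
    show "f u \<in> hom (Gv u) (BijGroup ?\<Omega>)" if u: "u \<in> W" for u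
    proof (cases "u = v")
      case True
      then show ?thesis using hom_compose[OF eB_hom] rho_hom[of False] by (simp add: f_def)
    next
      case False
      then have "u \<in> W'" using u W'(2) by simp
      then show ?thesis using hom_compose[OF GW'.emb_hom] rho_hom[of True] False by (simp add: f_def)
    qed
    show "f a (phi e' a x) = f b (phi e' b x)"
      if e': "e' \<in> edges W" "a \<in> e'" "b \<in> e'" "x \<in> carrier (Ge e')" for e' a b x
    proof (cases "e' = ?e")
      case True
      then show ?thesis using f_edge e' by auto
    next
      case False
      then have e: "e' \<in> edges W'" using e' edges by simp
      then have "a \<noteq> v" "b \<noteq> v" using GW'.E_V e' W'(2) by auto
      then show ?thesis using GW'.emb_edge[OF e e'(2-4)] by (simp add: f_def)
    qed
  qed blast
  interpret Bij: group "BijGroup ?\<Omega>" by (rule group_BijGroup)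
  define I where "I b = (if b then j else j')" for b
  have I_hom: "I b \<in> hom (H b) (sub_GT W)" for b using j(1) j'(1) by (simp add: I_def H_def)
  have Act_I: "Act (I b h) = rho b h" if "h \<in> carrier (H b)" for b h
  proof (cases b)
    case True
    \<comment> \<open>Both sides are homomorphisms on the completion of \<open>W'\<close>, so
      agreement on the vertex groups suffices.\<close>
    have "(Act \<circ> j) h = rho True h"
      by (rule GW'.GT_hom_eq[OF group_BijGroup hom_compose[OF j(1) Act(1)]])
        (use rho_hom[of True] that True j(2) Act(2) W'(2) in \<open>auto simp: f_def\<close>)
    then show ?thesis using True by (simp add: I_def)
  next
    case False
    then have "h \<in> eB ` carrier (Gv v)" using that eB_bij by (simp add: bij_betw_def)
    then obtain g where g: "g \<in> carrier (Gv v)" "h = eB g" by blast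
    then show ?thesis using False j'(2) Act(2)[OF v(1)] by (simp add: I_def f_def)
  qed
  interpret AA: amalgam_action H "Ge ?e" \<kappa> "sub_GT W" I Act
  proof (intro amalgam_action.intro amalgam_action_axioms.intro)
    show "amalgam_factors H (Ge ?e) \<kappa>" by (rule A.amalgam_factors_axioms)
    show "group (sub_GT W)" by (rule GW.group_GT)
    show "I b \<in> hom (H b) (sub_GT W)" for b by (rule I_hom)
    show "I True (\<kappa> True c) = I False (\<kappa> False c)" if "c \<in> carrier (Ge ?e)" for c
      using that sub_emb_edge[OF W v that] j(2)[OF wW'] j'(2) w_car v_car by (simp add: I_def)
    show "Act (x \<otimes>\<^bsub>sub_GT W\<^esub> y) s = Act x (Act y s)"
      if "x \<in> carrier (sub_GT W)" "y \<in> carrier (sub_GT W)" "s \<in> ?\<Omega>" for x y s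
    proof -
      interpret ga: group_action "sub_GT W" ?\<Omega> Act
        using Act(1) GW.group_GT by (simp add: group_action_def group_hom_def group_hom_axioms_def group_BijGroup)
      show ?thesis using ga.composition_rule that by blast
    qed
    show "Act (I b h) s = A.act b h s" if "h \<in> carrier (H b)" "s \<in> ?\<Omega>" for b h s
      using that Act_I by (simp add: rho_def)
  qed
  have fT: "AA.factor True = j ` carrier (sub_GT W')" by (simp add: AA.factor_def I_def)
  have fF: "AA.factor False = sub_emb W v ` carrier (Gv v)"
  proof -
    have "AA.factor False = j' ` eB ` carrier (Gv v)" using eB_bij by (simp add: AA.factor_def I_def bij_betw_def)
    then show ?thesis using j'(2) by (simp add: image_image)
  qed
  have factor: "AA.factor = (\<lambda>b. if b then j ` carrier (sub_GT W') else sub_emb W v ` carrier (Gv v))"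
    by (rule ext) (simp add: fT fF)
  have inter: "j ` carrier (sub_GT W') \<inter> sub_emb W v ` carrier (Gv v)
      = (\<lambda>c. sub_emb W v (phi {v, par v} v c)) ` carrier (Ge {v, par v})"
  proof -
    have "j ` carrier (sub_GT W') \<inter> sub_emb W v ` carrier (Gv v) = I False ` A.core False"
      using AA.I_core[of False] fT fF by simp
    also have "\<dots> = (\<lambda>c. sub_emb W v (phi {v, par v} v c)) ` carrier (Ge {v, par v})"
      using j'(2) v_car by (simp add: A.core_def I_def image_image)
    finally show ?thesis .
  qed
  have "amalgam_length (sub_GT W) AA.factor AA.len"
  proof (intro amalgam_length.intro amalgam_length_axioms.intro)
    show "group (sub_GT W)" by (rule GW.group_GT)
    show "subgroup (AA.factor b) (sub_GT W)" for b by (rule AA.subgroup_factor)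
    show "AA.len (AA.word_prod xs \<otimes>\<^bsub>sub_GT W\<^esub> z) = length xs"
      if "alternating AA.factor b xs" "z \<in> AA.factor True \<inter> AA.factor False" for b xs z
      using AA.len_alternating that .
    let ?U = "AA.factor True \<union> AA.factor False"
    have U: "?U \<subseteq> carrier (sub_GT W)" using AA.subgroup_factor subgroup.subset by blast
    have "x \<in> generate (sub_GT W) ?U" if "x \<in> carrier (sub_GT W)" for x
      using that
    proof (induction rule: GW.GT_induct)
      case one
      show ?case by (rule generate.one)
    next
      case (mult u g y)
      have "sub_emb W u g \<in> ?U"
      proof (cases "u = v")
        case True
        then show ?thesis using mult fF by blast
      next
        case False
        then have "sub_emb W u g = j (sub_emb W' u g)" "sub_emb W' u g \<in> carrier (sub_GT W')"
          using mult j(2) W'(2) GW'.emb_closed by auto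
        then show ?thesis using fT by blast
      qed
      then show ?case by (rule generate.eng[OF generate.incl mult.IH])
    qed
    then show "carrier (sub_GT W) = generate (sub_GT W) ?U"
      using AA.generate_incl[OF U] by blast
  qed
  moreover have "inj_on j (carrier (sub_GT W'))" using AA.I_inj[of True] by (simp add: I_def)
  moreover have "inj_on (sub_emb W v) (carrier (Gv v))"
  proof -
    have "inj_on (j' \<circ> eB) (carrier (Gv v))"
      using AA.I_inj[of False] eB_bij by (intro comp_inj_on) (auto simp: I_def bij_betw_def)
    then show ?thesis using j'(2) by (simp add: inj_on_def)
  qed
  ultimately show thesis using that[OF j(1) _ j(2)] inter factor by simp
qed

lemma gens_mono: "W' \<subseteq> W \<Longrightarrow> gens W' \<subseteq> gens W"
  unfolding gens_def by blast

text \<open>The first factor is the completion of \<open>W'\<close>, covered by the hypothesis, the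
  second the vertex group at \<open>v\<close>. Fusion follows from \<open>amalgam_fusion\<close>
  with \<open>realised W FS\<close> in the place of \<open>M\<close>.\<close>

lemma good_step:
  assumes W: "closed_set W" and v: "v \<in> W" "v \<noteq> r" and W': "closed_set W'" "W' = W - {v}"
    and good: "good W'"
  shows "good W"
proof -
  let ?e = "{v, par v}" and ?w = "par v"
  have vV: "v \<in> V" using closed_V W v by blast
  have wW': "?w \<in> W'"
    using W v W' dep_par[OF vV v(2)] by (auto simp: closed_set_def)
  have rW': "r \<in> W'" and rW: "r \<in> W" using W W' by (auto simp: closed_set_def)
  have inj': "inj_on (sub_emb W' u) (carrier (Gv u))" if "u \<in> W'" for u using good that by (simp add: good_def)
  obtain j len where j: "j \<in> hom (sub_GT W') (sub_GT W)" "inj_on j (carrier (sub_GT W'))"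
    "\<And>u g. u \<in> W' \<Longrightarrow> g \<in> carrier (Gv u) \<Longrightarrow> j (sub_emb W' u g) = sub_emb W u g"
    and inj_v: "inj_on (sub_emb W v) (carrier (Gv v))"
    and AL: "amalgam_length (sub_GT W) (\<lambda>b. if b then j ` carrier (sub_GT W') else sub_emb W v ` carrier (Gv v)) len"
    and inter: "j ` carrier (sub_GT W') \<inter> sub_emb W v ` carrier (Gv v)
      = (\<lambda>c. sub_emb W v (phi ?e v c)) ` carrier (Ge ?e)"
    using peel[OF W v W' inj'] by blast
  interpret GW: graph_of_groups W "edges W" Gv Ge phi using W by (rule closed_graph)
  interpret GW': graph_of_groups W' "edges W'" Gv Ge phi using W'(1) by (rule closed_graph)
  define F where "F b = (if b then j ` carrier (sub_GT W') else sub_emb W v ` carrier (Gv v))" for b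
  interpret AL: amalgam_length "sub_GT W" F len using AL unfolding F_def .
  have F_simps: "F True = j ` carrier (sub_GT W')" "F False = sub_emb W v ` carrier (Gv v)" by (simp_all add: F_def)
  define S where "S = sub_emb W r ` Sv r"
  define S' where "S' = sub_emb W' r ` Sv r"
  have rV: "r \<in> V" by (rule r_V)
  have S_eq: "S = j ` S'" unfolding S_def S'_def image_image
    using j(3)[OF rW'] Sv_carrier[OF rV] by (intro image_cong) auto
  have S'_sub: "S' \<subseteq> carrier (sub_GT W')" using GW'.emb_closed[OF rW'] Sv_carrier[OF rV] by (auto simp: S'_def)
  have inj: "inj_on (sub_emb W u) (carrier (Gv u))" if u: "u \<in> W" for u
  proof (cases "u = v")
    case False
    then have uW': "u \<in> W'" using u W'(2) by simp
    have "inj_on (j \<circ> sub_emb W' u) (carrier (Gv u))"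
      using inj'[OF uW'] GW'.emb_closed[OF uW'] j(2) by (intro comp_inj_on) (auto intro: inj_on_subset)
    then show ?thesis using j(3)[OF uW'] by (simp add: inj_on_def)
  qed (use inj_v in simp)
  have inj_r: "inj_on (sub_emb W r) (carrier (Gv r))" by (rule inj[OF rW])
  obtain t' where t': "t' \<in> carrier (sub_GT W')" "\<And>x. x \<in> Sv ?w \<Longrightarrow> psi ?w x \<in> Sv r
      \<and> sub_emb W' r (psi ?w x) = conj (sub_GT W') t' (sub_emb W' ?w x)"
    using psi_conj[OF W'(1) wW'] by blast
  \<comment> \<open>For edge elements seen at \<open>v\<close>, conjugation by \<open>a\<close>
    leads to \<open>Sv v\<close> and conjugation by \<open>u\<close> leads to \<open>S\<close> by
    way of the parent; so \<open>t\<close> leads from \<open>Sv v\<close> to \<open>S\<close>. The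
    element \<open>u\<close> lies in the first factor, as \<open>amalgam_fusion\<close>
    requires.\<close>
  define a where "a = sub_emb W v (gg ?e v)"
  define u where "u = sub_emb W ?w (gg ?e ?w) \<otimes>\<^bsub>sub_GT W\<^esub> j t'"
  define t where "t = inv\<^bsub>sub_GT W\<^esub> a \<otimes>\<^bsub>sub_GT W\<^esub> u"
  have ggw: "gg ?e ?w \<in> carrier (Gv ?w)" and ggv: "gg ?e v \<in> carrier (Gv v)"
    using gg_closed[OF vV v(2)] by auto
  have wW: "?w \<in> W" using wW' W'(2) by simp
  have wV: "?w \<in> V" using closed_V[OF W wW] .
  have a: "a \<in> carrier (sub_GT W)" unfolding a_def by (rule GW.emb_closed[OF v(1) ggv])
  have b: "sub_emb W ?w (gg ?e ?w) \<in> carrier (sub_GT W)" by (rule GW.emb_closed[OF wW ggw])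
  have jt: "j t' \<in> carrier (sub_GT W)" using hom_in_carrier[OF j(1) t'(1)] .
  have uF: "u \<in> F True"
  proof -
    have "sub_emb W ?w (gg ?e ?w) = j (sub_emb W' ?w (gg ?e ?w))" using j(3)[OF wW' ggw] by simp
    then have "sub_emb W ?w (gg ?e ?w) \<in> F True" using GW'.emb_closed[OF wW' ggw] F_simps by blast
    moreover have "j t' \<in> F True" using t'(1) F_simps by blast
    ultimately show ?thesis unfolding u_def by (rule AL.F_mult)
  qed
  have uG: "u \<in> carrier (sub_GT W)" by (rule AL.F_carrier[OF uF])
  have tG: "t \<in> carrier (sub_GT W)" unfolding t_def using a uG by simp
  have vs_car: "sub_emb W v (phi ?e v s) \<in> carrier (sub_GT W)" if "s \<in> Se ?e" for s
    using GW.emb_closed[OF v(1)] hom_in_carrier[OF edge_hom[OF vV v(2)] Se_carrier[OF vV v(2) that]] by blast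
  have u_conj: "psi v (conj (Gv v) (gg ?e v) (phi ?e v s)) \<in> Sv r \<and>
      sub_emb W r (psi v (conj (Gv v) (gg ?e v) (phi ?e v s))) = conj (sub_GT W) u (sub_emb W v (phi ?e v s))"
    if s: "s \<in> Se ?e" for s
  proof -
    define y where "y = conj (Gv ?w) (gg ?e ?w) (phi ?e ?w s)"
    have y: "y \<in> Sv ?w" unfolding y_def using gg_Sv[OF vV v(2) _ s] by blast
    have yc: "y \<in> carrier (Gv ?w)" by (rule Sv_carrier[OF wV y])
    have psi: "psi v (conj (Gv v) (gg ?e v) (phi ?e v s)) = psi ?w y"
      unfolding y_def by (rule psi_edge[OF vV v(2) s])
    have pr: "psi ?w y \<in> Sv r" using t'(2)[OF y] by simp
    have "sub_emb W r (psi ?w y) = j (conj (sub_GT W') t' (sub_emb W' ?w y))"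
      using t'(2)[OF y] j(3)[OF rW' Sv_carrier[OF rV pr]] by simp
    also have "\<dots> = conj (sub_GT W) (j t') (sub_emb W ?w y)"
      using hom_conj[OF GW'.group_GT GW.group_GT j(1) t'(1) GW'.emb_closed[OF wW' yc]] j(3)[OF wW' yc] by simp
    also have "sub_emb W ?w y = conj (sub_GT W) (sub_emb W ?w (gg ?e ?w)) (sub_emb W v (phi ?e v s))"
      unfolding y_def by (rule transport_edge[OF W v s]) simp
    also have "conj (sub_GT W) (j t') \<dots> = conj (sub_GT W) u (sub_emb W v (phi ?e v s))"
      unfolding u_def using b jt vs_car[OF s] by (simp add: AL.conj_mult)
    finally show ?thesis using psi pr by simp
  qed
  have t_conj: "psi v x \<in> Sv r \<and> sub_emb W r (psi v x) = conj (sub_GT W) t (sub_emb W v x)" if x: "x \<in> Sv v" for x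
  proof -
    obtain s where s: "s \<in> Se ?e" "x = conj (Gv v) (gg ?e v) (phi ?e v s)" using Sv_onto[OF vV v(2) x] by blast
    have "sub_emb W v x = conj (sub_GT W) a (sub_emb W v (phi ?e v s))"
      unfolding s(2) a_def by (rule transport_edge[OF W v s(1)]) simp
    then show ?thesis using u_conj[OF s(1)] a uG vs_car[OF s(1)] by (simp add: s(2)[symmetric] t_def AL.conj_mult)
  qed
  define T where "T = (\<lambda>s. sub_emb W v (phi ?e v s)) ` Se ?e"
  \<comment> \<open>Here (H) is used: every element of \<open>Sv v\<close> comes from the edge, so
    the translate of \<open>T\<close> is all of the identified Sylow group of
    \<open>v\<close>.\<close>
  have uT: "conj (sub_GT W) u ` T = sub_emb W r ` psi v ` Sv v"
  proof -
    have "Sv v = (\<lambda>s. conj (Gv v) (gg ?e v) (phi ?e v s)) ` Se ?e"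
      using Sv_onto[OF vV v(2)] gg_Sv[OF vV v(2)] by blast
    then show ?thesis unfolding T_def using u_conj by (simp add: image_image)
  qed
  have sylow_T: "\<exists>c\<in>AL.core. conj (sub_GT W) c ` Q \<subseteq> T"
    if Q: "finite_p_subgroup (sub_GT W) p Q" "Q \<subseteq> AL.core" for Q
  proof -
    let ?f = "\<lambda>c. sub_emb W v (phi ?e v c)"
    have hom: "?f \<in> hom (Ge ?e) (sub_GT W)"
      using hom_compose[OF edge_hom[OF vV v(2)] GW.emb_hom[OF v(1)]] by (simp add: comp_def)
    have "inj_on (sub_emb W v \<circ> phi ?e v) (carrier (Ge ?e))"
      using edge_inj[OF vV v(2), of v] inj_v hom_in_carrier[OF edge_hom[OF vV v(2), of v]]
      by (intro comp_inj_on) (auto intro: inj_on_subset)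
    then have i: "inj_on ?f (carrier (Ge ?e))" by (simp add: comp_def)
    have core: "AL.core = ?f ` carrier (Ge ?e)" using inter F_simps by simp
    obtain c where "c \<in> carrier (Ge ?e)" "conj (sub_GT W) (?f c) ` Q \<subseteq> ?f ` Se ?e"
      using sylow_gen_image[OF edge_group[OF vV v(2)] GW.group_GT hom i Se_sylow_gen[OF vV v(2)] Q(1)] Q(2)
      unfolding core by blast
    then show ?thesis unfolding core T_def by blast
  qed
  have sylow: "sylow_gen (sub_GT W) p S"
    unfolding sylow_gen_def
  proof (intro conjI allI impI)
    have "finite_p_subgroup (Gv r) p (Sv r)" using Sv_sylow_gen[OF rV] by (simp add: sylow_gen_def)
    then show "finite_p_subgroup (sub_GT W) p S" unfolding S_def
      by (rule finite_p_subgroup_image[OF vertex_group[OF rV] GW.group_GT GW.emb_hom[OF rW] inj_r])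
    fix P assume P: "finite_p_subgroup (sub_GT W) p P"
    then have PG: "P \<subseteq> carrier (sub_GT W)" by (simp add: finite_p_subgroup_def subgroup.subset)
    obtain g d where g: "g \<in> carrier (sub_GT W)" "conj (sub_GT W) g ` P \<subseteq> F d"
      using AL.finite_subgroup_conj_factor P unfolding finite_p_subgroup_def by blast
    let ?P = "conj (sub_GT W) g ` P"
    have P': "finite_p_subgroup (sub_GT W) p ?P" by (rule AL.finite_p_subgroup_conj[OF P g(1)])
    have P'G: "?P \<subseteq> carrier (sub_GT W)" by (rule AL.conj_image_subset_carrier[OF g(1) PG])
    \<comment> \<open>A subgroup of the first factor is handled by the hypothesis on
      \<open>W'\<close>; one of the vertex group goes into \<open>Sv v\<close> by the Sylow theorem
      for finite groups and from there into \<open>S\<close> by \<open>t\<close>.\<close>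
    have "\<exists>h\<in>carrier (sub_GT W). conj (sub_GT W) h ` ?P \<subseteq> S"
    proof (cases d)
      case True
      have "sylow_gen (sub_GT W') p S'" using good by (simp add: good_def S'_def)
      then obtain h where "h \<in> carrier (sub_GT W')" "conj (sub_GT W) (j h) ` ?P \<subseteq> j ` S'"
        using sylow_gen_image[OF GW'.group_GT GW.group_GT j(1,2) _ P'] g(2) True F_simps by metis
      then show ?thesis using hom_in_carrier[OF j(1)] S_eq by blast
    next
      case False
      then obtain k where k: "k \<in> carrier (Gv v)" "conj (sub_GT W) (sub_emb W v k) ` ?P \<subseteq> sub_emb W v ` Sv v"
        using sylow_gen_image[OF vertex_group[OF vV] GW.group_GT GW.emb_hom[OF v(1)] inj_v Sv_sylow_gen[OF vV] P']
          g(2) F_simps by metis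
      have kG: "sub_emb W v k \<in> carrier (sub_GT W)" by (rule GW.emb_closed[OF v(1) k(1)])
      have "conj (sub_GT W) t ` sub_emb W v ` Sv v \<subseteq> S"
      proof -
        have "conj (sub_GT W) t (sub_emb W v x) \<in> S" if "x \<in> Sv v" for x
        proof -
          have "sub_emb W r (psi v x) \<in> S" using t_conj[OF that] unfolding S_def by blast
          then show ?thesis using t_conj[OF that] by simp
        qed
        then show ?thesis by blast
      qed
      then have "conj (sub_GT W) (sub_emb W v k \<otimes>\<^bsub>sub_GT W\<^esub> t) ` ?P \<subseteq> S"
        unfolding AL.conj_image_mult[OF kG tG P'G] by (rule order_trans[OF image_mono[OF k(2)]])
      then show ?thesis using kG tG AL.m_closed by blast
    qed
    then obtain h where h: "h \<in> carrier (sub_GT W)" "conj (sub_GT W) h ` ?P \<subseteq> S" by blast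
    then have "conj (sub_GT W) (g \<otimes>\<^bsub>sub_GT W\<^esub> h) ` P \<subseteq> S" by (simp only: AL.conj_image_mult[OF g(1) h(1) PG])
    then show "\<exists>g\<in>carrier (sub_GT W). conj (sub_GT W) g ` P \<subseteq> S" using g(1) h(1) AL.m_closed by blast
  qed
  have fusion: "realised W FS P g"
    if FS: "fusion_system (Gv r) (Sv r) FS" "gens W \<subseteq> FS" and P: "finite_p_subgroup (sub_GT W) p P" "P \<subseteq> S"
      and g: "g \<in> carrier (sub_GT W)" "conj (sub_GT W) g ` P \<subseteq> S" for FS P g
  proof -
    have "amalgam_fusion (sub_GT W) F len p S T u (realised W FS)"
    proof (intro amalgam_fusion.intro amalgam_fusion_axioms.intro)
      show "amalgam_length (sub_GT W) F len" by (rule AL.amalgam_length_axioms)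
      show "S \<subseteq> F True" unfolding S_eq F_simps by (rule image_mono[OF S'_sub])
      show "T \<subseteq> AL.core" unfolding F_simps inter T_def using Se_carrier[OF vV v(2)] by (intro image_mono) blast
      show "u \<in> F True" by (rule uF)
      show "conj (sub_GT W) u ` T \<subseteq> S" unfolding uT S_def using t_conj by blast
      show "\<exists>c\<in>AL.core. conj (sub_GT W) c ` Q \<subseteq> T"
        if "finite_p_subgroup (sub_GT W) p Q" "Q \<subseteq> AL.core" for Q
        using sylow_T that .
      show "realised W FS P (g \<otimes>\<^bsub>sub_GT W\<^esub> h)"
        if "g \<in> carrier (sub_GT W)" "h \<in> carrier (sub_GT W)" "realised W FS P g"
          "realised W FS (conj (sub_GT W) g ` P) h" for g h P
        using realised_comp[OF W inj_r FS(1)] that .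
      \<comment> \<open>The question is pulled back along \<open>j\<close>, answered in the
        completion of \<open>W'\<close>, and the resulting morphism is read again in that of
        \<open>W\<close>; this works because \<open>j\<close> carries one embedding of the root
        group to the other.\<close>
      show "realised W FS P a"
        if aF: "a \<in> F True" and P: "finite_p_subgroup (sub_GT W) p P" "P \<subseteq> S" "conj (sub_GT W) a ` P \<subseteq> S" for a P
      proof -
        obtain a' where a': "a' \<in> carrier (sub_GT W')" "a = j a'" using aF unfolding F_simps by blast
        have "P \<subseteq> j ` carrier (sub_GT W')"
          using order_trans[OF P(2)[unfolded S_eq] image_mono[OF S'_sub]] .
        then obtain P' where P': "finite_p_subgroup (sub_GT W') p P'" "P = j ` P'"
          using finite_p_subgroup_vimage[OF GW'.group_GT GW.group_GT j(1,2) P(1)] by blast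
        have P'G: "P' \<subseteq> carrier (sub_GT W')" using P'(1) by (simp add: finite_p_subgroup_def subgroup.subset)
        have mem: "x \<in> S'" if "j x \<in> S" "x \<in> carrier (sub_GT W')" for x
          using that S'_sub j(2) unfolding S_eq by (auto simp: inj_on_def subset_eq)
        have jc: "j (conj (sub_GT W') a' x) = conj (sub_GT W) a (j x)" if "x \<in> carrier (sub_GT W')" for x
          using hom_conj[OF GW'.group_GT GW.group_GT j(1) a'(1) that] a'(2) by simp
        have sub: "P' \<subseteq> S'" using P(2) P'(2) P'G mem by blast
        have "conj (sub_GT W') a' ` P' \<subseteq> S'"
        proof
          fix y assume "y \<in> conj (sub_GT W') a' ` P'"
          then obtain x where x: "x \<in> P'" "y = conj (sub_GT W') a' x" by blast
          have xG: "x \<in> carrier (sub_GT W')" using x P'G by blast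
          have "j y \<in> S" using jc[OF xG] x P(3) P'(2) by blast
          then show "y \<in> S'" using mem x xG group.conj_closed[OF GW'.group_GT a'(1) xG] by simp
        qed
        moreover have "gens W' \<subseteq> FS" using gens_mono[of W' W] W'(2) FS(2) by blast
        ultimately have "realised W' FS P' a'" using good FS(1) P'(1) sub a'(1) by (auto simp: good_def S'_def)
        then obtain P0 f where f: "P' = sub_emb W' r ` P0" "(P0, Sv r, f) \<in> FS"
          "\<And>x. x \<in> P0 \<Longrightarrow> sub_emb W' r (f x) = conj (sub_GT W') a' (sub_emb W' r x)"
          unfolding realised_def by blast
        have P0: "P0 \<subseteq> Sv r" "f ` P0 \<subseteq> Sv r" using fusion_system_mor(2,5)[OF FS(1) f(2)] by blast+
        have car: "x \<in> carrier (Gv r)" "f x \<in> carrier (Gv r)" if "x \<in> P0" for x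
          using that P0 Sv_carrier[OF rV] by blast+
        have "P = sub_emb W r ` P0" unfolding P'(2) f(1) image_image using j(3)[OF rW'] car by (intro image_cong) auto
        moreover have "sub_emb W r (f x) = conj (sub_GT W) a (sub_emb W r x)" if x: "x \<in> P0" for x
        proof -
          have "sub_emb W r (f x) = j (conj (sub_GT W') a' (sub_emb W' r x))"
            using f(3)[OF x] j(3)[OF rW' car(2)[OF x]] by simp
          then show ?thesis using jc[OF GW'.emb_closed[OF rW' car(1)[OF x]]] j(3)[OF rW' car(1)[OF x]] by simp
        qed
        ultimately show ?thesis unfolding realised_def using f(2) by blast
      qed
      show "realised W FS P (inv\<^bsub>sub_GT W\<^esub> u \<otimes>\<^bsub>sub_GT W\<^esub> b \<otimes>\<^bsub>sub_GT W\<^esub> u)"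
        if bF: "b \<in> F False" and P: "finite_p_subgroup (sub_GT W) p P" "P \<subseteq> conj (sub_GT W) u ` T"
          "conj (sub_GT W) (inv\<^bsub>sub_GT W\<^esub> u \<otimes>\<^bsub>sub_GT W\<^esub> b \<otimes>\<^bsub>sub_GT W\<^esub> u) ` P \<subseteq> conj (sub_GT W) u ` T" for b P
      proof -
        obtain k where k: "k \<in> carrier (Gv v)" "b = sub_emb W v k" using bF F_simps by blast
        have bG: "b \<in> carrier (sub_GT W)" using AL.F_carrier[OF bF] .
        \<comment> \<open>Substituting u = a t turns the element into t^-1 (a^-1 b a) t, so
          \<open>realised_gens\<close> has to be fed with the \<open>gg\<close>-conjugate of
          \<open>k\<close>.\<close>
        let ?k = "conj (Gv v) (gg ?e v) k"
        have kc: "?k \<in> carrier (Gv v)" using group.conj_closed[OF vertex_group[OF vV] ggv k(1)] .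
        have "sub_emb W v ?k = conj (sub_GT W) a b"
          unfolding a_def k(2) by (rule hom_conj[OF vertex_group[OF vV] GW.group_GT GW.emb_hom[OF v(1)] ggv k(1)])
        then have eq: "inv\<^bsub>sub_GT W\<^esub> u \<otimes>\<^bsub>sub_GT W\<^esub> b \<otimes>\<^bsub>sub_GT W\<^esub> u
          = inv\<^bsub>sub_GT W\<^esub> t \<otimes>\<^bsub>sub_GT W\<^esub> sub_emb W v ?k \<otimes>\<^bsub>sub_GT W\<^esub> t"
          using a bG uG by (simp add: t_def conj_def AL.inv_mult_group AL.m_assoc)
        have "subgroup P (sub_GT W)" using P(1) by (simp add: finite_p_subgroup_def)
        then show ?thesis
          using realised_gens[OF W v(1) inj_r inj_v FS tG t_conj kc eq] P(2,3) unfolding uT by blast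
      qed
    qed
    then show ?thesis by (rule amalgam_fusion.M_all) (use P g in blast)+
  qed
  show ?thesis unfolding good_def using inj sylow fusion unfolding S_def by blast
qed

lemma good_closed: "closed_set W \<Longrightarrow> good W"
proof (induction "card W" arbitrary: W rule: less_induct)
  case less
  have fin: "finite W" using less.prems fin_V by (auto simp: closed_set_def intro: finite_subset)
  have rW: "r \<in> W" using less.prems by (simp add: closed_set_def)
  show ?case
  proof (cases "W = {r}")
    case True
    then show ?thesis using good_root by simp
  next
    case False
    then have ne: "W - {r} \<noteq> {}" using rW by blast
    have "dep ` (W - {r}) \<noteq> {}" using ne by simp
    then have "Max (dep ` (W - {r})) \<in> dep ` (W - {r})" using fin by (intro Max_in) auto
    then obtain v where v: "v \<in> W - {r}" "dep v = Max (dep ` (W - {r}))" by (metis imageE)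
    have vmax: "dep u \<le> dep v" if "u \<in> W - {r}" for u using that fin v(2) by simp
    have cl: "closed_set (W - {v})"
    proof -
      \<comment> \<open>Maximal depth makes \<open>v\<close> a leaf: a vertex with parent
        \<open>v\<close> would be deeper.\<close>
      have "par u \<noteq> v" if "u \<in> W" "u \<noteq> r" for u
        using vmax[of u] that dep_par[OF closed_V[OF less.prems that(1)] that(2)] by auto
      then show ?thesis using less.prems v(1) by (auto simp: closed_set_def)
    qed
    have "card (W - {v}) < card W" using fin v(1) by (intro psubset_card_mono) auto
    then have "good (W - {v})" using less.hyps cl by blast
    then show ?thesis using good_step[OF less.prems _ _ cl refl] v(1) by blast
  qed
qed

lemma closed_set_V: "closed_set V"
  using r_V par_V by (auto simp: closed_set_def)

section \<open>Conjugation in the full completion against the generated fusion system\<close>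

abbreviation "GG \<equiv> sub_GT V"
abbreviation "\<iota> \<equiv> sub_emb V r"

text \<open>The fusion of the completion, pulled back to the root group where
  \<open>gen_fusion\<close> lives. Being a fusion system that contains the generators, it bounds the
  generated one from above.\<close>

definition ambient_fusion :: "'a fmor set" where
  "ambient_fusion = {(P, Q, f). subgroup P (Gv r) \<and> P \<subseteq> Sv r \<and> subgroup Q (Gv r) \<and> Q \<subseteq> Sv r \<and> f ` P \<subseteq> Q \<and>
    f = restrict f P \<and> (\<exists>g\<in>carrier GG. \<forall>x\<in>P. \<iota> (f x) = conj GG g (\<iota> x))}"

lemma ambient_fusionI:
  assumes "subgroup P (Gv r)" "P \<subseteq> Sv r" "subgroup Q (Gv r)" "Q \<subseteq> Sv r" "g \<in> carrier GG"
    and "\<And>x. x \<in> P \<Longrightarrow> f x \<in> Q" "\<And>x. x \<in> P \<Longrightarrow> \<iota> (f x) = conj GG g (\<iota> x)"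
  shows "(P, Q, restrict f P) \<in> ambient_fusion"
  unfolding ambient_fusion_def using assms by auto

lemma ambient_fusionE:
  assumes "(P, Q, f) \<in> ambient_fusion"
  obtains g where "subgroup P (Gv r)" "P \<subseteq> Sv r" "subgroup Q (Gv r)" "Q \<subseteq> Sv r"
    "\<And>x. x \<in> P \<Longrightarrow> f x \<in> Q" "f = restrict f P" "g \<in> carrier GG" "\<And>x. x \<in> P \<Longrightarrow> \<iota> (f x) = conj GG g (\<iota> x)"
  using assms unfolding ambient_fusion_def by blast

lemma group_GG: "group GG"
  by (rule graph_of_groups.group_GT[OF closed_graph[OF closed_set_V]])

lemma emb_hom_GG: "v \<in> V \<Longrightarrow> sub_emb V v \<in> hom (Gv v) GG"
  by (rule graph_of_groups.emb_hom[OF closed_graph[OF closed_set_V]])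

lemma emb_inj_GG: "v \<in> V \<Longrightarrow> inj_on (sub_emb V v) (carrier (Gv v))"
  using good_closed[OF closed_set_V] by (simp add: good_def)

lemma \<iota>_closed: "x \<in> Sv r \<Longrightarrow> \<iota> x \<in> carrier GG"
  using hom_in_carrier[OF emb_hom_GG[OF r_V] Sv_carrier[OF r_V]] .

lemma fusion_system_ambient: "fusion_system (Gv r) (Sv r) ambient_fusion"
  unfolding fusion_system_def
proof (intro conjI allI impI)
  interpret GG: group GG by (rule group_GG)
  interpret Gr: group "Gv r" by (rule vertex_group[OF r_V])
  note pb = conj_pullback[OF Gr.is_group Gr.is_group GG.is_group emb_hom_GG[OF r_V] emb_inj_GG[OF r_V] emb_hom_GG[OF r_V]]
  show "\<forall>(P, Q, f) \<in> ambient_fusion. subgroup P (Gv r) \<and> P \<subseteq> Sv r \<and> subgroup Q (Gv r) \<and> Q \<subseteq> Sv r \<and>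
        f ` P \<subseteq> Q \<and> inj_on f P \<and> (\<forall>x\<in>P. \<forall>y\<in>P. f (x \<otimes>\<^bsub>Gv r\<^esub> y) = f x \<otimes>\<^bsub>Gv r\<^esub> f y) \<and> f = restrict f P"
  proof safe
    fix P Q f assume "(P, Q, f) \<in> ambient_fusion"
    then obtain g where *: "subgroup P (Gv r)" "P \<subseteq> Sv r" "subgroup Q (Gv r)" "Q \<subseteq> Sv r"
      "\<And>x. x \<in> P \<Longrightarrow> f x \<in> Q" "f = restrict f P" "g \<in> carrier GG" "\<And>x. x \<in> P \<Longrightarrow> \<iota> (f x) = conj GG g (\<iota> x)"
      by (rule ambient_fusionE) blast
    have fc: "f x \<in> carrier (Gv r)" if "x \<in> P" for x using that *(5) subgroup.mem_carrier[OF *(3)] by blast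
    show "subgroup P (Gv r)" "\<And>x. x \<in> P \<Longrightarrow> x \<in> Sv r" "subgroup Q (Gv r)" "\<And>x. x \<in> Q \<Longrightarrow> x \<in> Sv r"
      "\<And>x. x \<in> P \<Longrightarrow> f x \<in> Q" "f = restrict f P" using * by blast+
    show "inj_on f P" by (rule pb(3)[OF *(7) *(1) fc *(8) emb_inj_GG[OF r_V]])
    show "f (x \<otimes>\<^bsub>Gv r\<^esub> y) = f x \<otimes>\<^bsub>Gv r\<^esub> f y" if "x \<in> P" "y \<in> P" for x y
      by (rule pb(1)[OF *(7) *(1) fc *(8) that])
  qed
  fix P Q R f f' s P' Q'
  {
    assume "subgroup P (Gv r) \<and> P \<subseteq> Sv r \<and> subgroup Q (Gv r) \<and> Q \<subseteq> Sv r \<and> s \<in> Sv r \<and> conj (Gv r) s ` P \<subseteq> Q"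
    then have *: "subgroup P (Gv r)" "P \<subseteq> Sv r" "subgroup Q (Gv r)" "Q \<subseteq> Sv r" "s \<in> Sv r" "conj (Gv r) s ` P \<subseteq> Q"
      by blast+
    show "(P, Q, restrict (conj (Gv r) s) P) \<in> ambient_fusion"
    proof (rule ambient_fusionI[OF *(1-4) \<iota>_closed[OF *(5)]])
      show "\<iota> (conj (Gv r) s x) = conj GG (\<iota> s) (\<iota> x)" if "x \<in> P" for x
        using hom_conj[OF Gr.is_group GG.is_group emb_hom_GG[OF r_V]] Sv_carrier[OF r_V] *(2,5) that by blast
    qed (use *(6) in blast)
  next
    assume "(P, Q, f) \<in> ambient_fusion \<and> (Q, R, f') \<in> ambient_fusion"
    then have 1: "(P, Q, f) \<in> ambient_fusion" and 2: "(Q, R, f') \<in> ambient_fusion" by blast+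
    from 1 obtain g where *: "subgroup P (Gv r)" "P \<subseteq> Sv r" "\<And>x. x \<in> P \<Longrightarrow> f x \<in> Q" "g \<in> carrier GG"
      "\<And>x. x \<in> P \<Longrightarrow> \<iota> (f x) = conj GG g (\<iota> x)" by (rule ambient_fusionE) blast
    from 2 obtain h where **: "subgroup R (Gv r)" "R \<subseteq> Sv r" "\<And>x. x \<in> Q \<Longrightarrow> f' x \<in> R" "h \<in> carrier GG"
      "\<And>x. x \<in> Q \<Longrightarrow> \<iota> (f' x) = conj GG h (\<iota> x)" by (rule ambient_fusionE) blast
    show "(P, R, restrict (f' \<circ> f) P) \<in> ambient_fusion"
    proof (rule ambient_fusionI[OF *(1,2) **(1,2) GG.m_closed[OF *(4) **(4)]])
      fix x assume x: "x \<in> P"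
      show "(f' \<circ> f) x \<in> R" using *(3)[OF x] **(3) by simp
      have "\<iota> x \<in> carrier GG" using \<iota>_closed *(2) x by blast
      then show "\<iota> ((f' \<circ> f) x) = conj GG (g \<otimes>\<^bsub>GG\<^esub> h) (\<iota> x)"
        using *(5)[OF x] **(5)[OF *(3)[OF x]] *(4) **(4) by (simp add: GG.conj_mult)
    qed
  next
    assume asm: "(P, Q, f) \<in> ambient_fusion \<and> subgroup P' (Gv r) \<and> P' \<subseteq> P \<and> subgroup Q' (Gv r) \<and> Q' \<subseteq> Sv r \<and> f ` P' \<subseteq> Q'"
    then have "(P, Q, f) \<in> ambient_fusion" by blast
    then obtain g where *: "P \<subseteq> Sv r" "g \<in> carrier GG" "\<And>x. x \<in> P \<Longrightarrow> \<iota> (f x) = conj GG g (\<iota> x)"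
      by (rule ambient_fusionE) blast
    show "(P', Q', restrict f P') \<in> ambient_fusion"
      using asm * by (intro ambient_fusionI[of P' Q' g f]) blast+
  next
    assume "(P, Q, f) \<in> ambient_fusion"
    then obtain g where *: "subgroup P (Gv r)" "P \<subseteq> Sv r" "subgroup Q (Gv r)" "Q \<subseteq> Sv r"
      "\<And>x. x \<in> P \<Longrightarrow> f x \<in> Q" "f = restrict f P" "g \<in> carrier GG" "\<And>x. x \<in> P \<Longrightarrow> \<iota> (f x) = conj GG g (\<iota> x)"
      by (rule ambient_fusionE) blast
    have fc: "f x \<in> carrier (Gv r)" if "x \<in> P" for x using that *(5) subgroup.mem_carrier[OF *(3)] by blast
    have inj: "inj_on f P" by (rule pb(3)[OF *(7) *(1) fc *(8) emb_inj_GG[OF r_V]])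
    have sub: "subgroup (f ` P) (Gv r)" by (rule pb(2)[OF *(7) *(1) fc *(8)])
    have fS: "f ` P \<subseteq> Sv r" using *(4,5) by blast
    show "(f ` P, P, restrict (inv_into P f) (f ` P)) \<in> ambient_fusion"
    proof (rule ambient_fusionI[OF sub fS *(1,2) GG.inv_closed[OF *(7)]])
      fix y assume "y \<in> f ` P"
      then obtain x where x: "x \<in> P" "y = f x" by blast
      have inv: "inv_into P f y = x" using x inj by simp
      show "inv_into P f y \<in> P" using inv x by simp
      have "\<iota> x \<in> carrier GG" using \<iota>_closed *(2) x by blast
      then show "\<iota> (inv_into P f y) = conj GG (inv\<^bsub>GG\<^esub> g) (\<iota> y)" using inv *(8)[OF x(1)] x(2) *(7) by simp
    qed
  }
qed

text \<open>The generator coming from \<open>k\<close> at \<open>v\<close> is conjugation by t^-1 k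
  t, with \<open>t\<close> from \<open>psi_conj\<close>.\<close>

lemma gens_ambient: "gens V \<subseteq> ambient_fusion"
proof
  interpret GG: group GG by (rule group_GG)
  fix m assume "m \<in> gens V"
  then obtain v P k where m: "m = (psi v ` P, psi v ` Sv v,
      restrict (psi v \<circ> conj (Gv v) k \<circ> inv_into (Sv v) (psi v)) (psi v ` P))"
    and v: "v \<in> V" and P: "subgroup P (Gv v)" "P \<subseteq> Sv v" and k: "k \<in> carrier (Gv v)" "conj (Gv v) k ` P \<subseteq> Sv v"
    unfolding gens_def by blast
  obtain t where t: "t \<in> carrier GG" "\<And>x. x \<in> Sv v \<Longrightarrow> psi v x \<in> Sv r \<and> \<iota> (psi v x) = conj GG t (sub_emb V v x)"
    using psi_conj[OF closed_set_V v] by blast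
  note pb = conj_pullback[OF vertex_group[OF v] vertex_group[OF r_V] group_GG emb_hom_GG[OF r_V] emb_inj_GG[OF r_V]
      emb_hom_GG[OF v] t(1)]
  have pc: "psi v x \<in> carrier (Gv r)" if "x \<in> Sv v" for x using t(2)[OF that] Sv_carrier[OF r_V] by blast
  have pt: "\<iota> (psi v x) = conj GG t (sub_emb V v x)" if "x \<in> Sv v" for x using t(2)[OF that] by blast
  have subS: "subgroup (psi v ` Sv v) (Gv r)" by (rule pb(2)[OF Sv_subgroup[OF v] pc pt])
  have subP: "subgroup (psi v ` P) (Gv r)" by (rule pb(2)[OF P(1)]) (use P(2) pc pt in blast)+
  have inj: "inj_on (psi v) (Sv v)" by (rule pb(3)[OF Sv_subgroup[OF v] pc pt emb_inj_GG[OF v]])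
  have ps: "psi v ` Sv v \<subseteq> Sv r" using t(2) by blast
  let ?k = "sub_emb V v k" and ?f = "psi v \<circ> conj (Gv v) k \<circ> inv_into (Sv v) (psi v)"
  have kc: "?k \<in> carrier GG" by (rule hom_in_carrier[OF emb_hom_GG[OF v] k(1)])
  have pP: "psi v ` P \<subseteq> Sv r" using ps P(2) by blast
  show "m \<in> ambient_fusion" unfolding m
  proof (rule ambient_fusionI[OF subP pP subS ps, of "inv\<^bsub>GG\<^esub> t \<otimes>\<^bsub>GG\<^esub> ?k \<otimes>\<^bsub>GG\<^esub> t"])
    show "inv\<^bsub>GG\<^esub> t \<otimes>\<^bsub>GG\<^esub> ?k \<otimes>\<^bsub>GG\<^esub> t \<in> carrier GG" using t(1) kc by simp
    fix y assume "y \<in> psi v ` P"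
    then obtain x where x: "x \<in> P" "y = psi v x" by blast
    have xS: "x \<in> Sv v" using x P(2) by blast
    have kx: "conj (Gv v) k x \<in> Sv v" using k(2) x by blast
    have f: "?f y = psi v (conj (Gv v) k x)" using x(2) xS inj by simp
    show "?f y \<in> psi v ` Sv v" unfolding f using kx by blast
    have xc: "x \<in> carrier (Gv v)" by (rule Sv_carrier[OF v xS])
    have ec: "sub_emb V v x \<in> carrier GG" by (rule hom_in_carrier[OF emb_hom_GG[OF v] xc])
    have "\<iota> (?f y) = conj GG t (conj GG ?k (sub_emb V v x))"
      unfolding f pt[OF kx] hom_conj[OF vertex_group[OF v] group_GG emb_hom_GG[OF v] k(1) xc] by simp
    then show "\<iota> (?f y) = conj GG (inv\<^bsub>GG\<^esub> t \<otimes>\<^bsub>GG\<^esub> ?k \<otimes>\<^bsub>GG\<^esub> t) (\<iota> y)"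
      unfolding x(2) pt[OF xS] using t(1) kc ec by (simp add: GG.conj_mult)
  qed
qed

lemma sylow_GG: "sylow_gen GG p (\<iota> ` Sv r)"
  using good_closed[OF closed_set_V] by (simp add: good_def)

lemma map_fusion_subset: "map_fusion \<iota> (gen_fusion (Gv r) (Sv r) (gens V)) \<subseteq> fusion_of GG (\<iota> ` Sv r)"
proof
  interpret em: group_hom "Gv r" GG \<iota>
    by (simp add: group_hom_def group_hom_axioms_def vertex_group[OF r_V] group_GG emb_hom_GG[OF r_V])
  fix m assume "m \<in> map_fusion \<iota> (gen_fusion (Gv r) (Sv r) (gens V))"
  then obtain P Q f where m: "m = (\<iota> ` P, \<iota> ` Q, restrict (\<iota> \<circ> f \<circ> inv_into P \<iota>) (\<iota> ` P))"
    and "(P, Q, f) \<in> gen_fusion (Gv r) (Sv r) (gens V)" unfolding map_fusion_def by blast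
  then have "(P, Q, f) \<in> ambient_fusion"
    using fusion_system_ambient gens_ambient unfolding gen_fusion_def by blast
  then obtain g where *: "subgroup P (Gv r)" "P \<subseteq> Sv r" "subgroup Q (Gv r)" "Q \<subseteq> Sv r"
    "\<And>x. x \<in> P \<Longrightarrow> f x \<in> Q" "g \<in> carrier GG" "\<And>x. x \<in> P \<Longrightarrow> \<iota> (f x) = conj GG g (\<iota> x)"
    by (rule ambient_fusionE) blast
  have injP: "inj_on \<iota> P" using emb_inj_GG[OF r_V] subgroup.subset[OF *(1)] by (rule inj_on_subset)
  have "restrict (\<iota> \<circ> f \<circ> inv_into P \<iota>) (\<iota> ` P) = restrict (conj GG g) (\<iota> ` P)"
    using injP *(7) by (intro restrict_ext) auto
  moreover have "conj GG g ` \<iota> ` P \<subseteq> \<iota> ` Q"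
  proof -
    have "conj GG g (\<iota> x) \<in> \<iota> ` Q" if "x \<in> P" for x using *(5)[OF that] unfolding *(7)[OF that, symmetric] by blast
    then show ?thesis by blast
  qed
  moreover have "subgroup (\<iota> ` P) GG" "subgroup (\<iota> ` Q) GG" using em.subgroup_img_is_subgroup *(1,3) by auto
  moreover have "\<iota> ` P \<subseteq> \<iota> ` Sv r" "\<iota> ` Q \<subseteq> \<iota> ` Sv r" using *(2,4) by auto
  ultimately show "m \<in> fusion_of GG (\<iota> ` Sv r)" unfolding m fusion_of_def using *(6) by blast
qed

text \<open>Membership in the intersection is tested one fusion system at a time. In each,
  \<open>good\<close> provides a morphism realising \<open>g\<close>; as the embedding is injective
  on \<open>Sv r\<close>, this morphism agrees with a map \<open>f\<close> fixed independently of
  the system.\<close>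

lemma fusion_of_subset: "fusion_of GG (\<iota> ` Sv r) \<subseteq> map_fusion \<iota> (gen_fusion (Gv r) (Sv r) (gens V))"
proof
  interpret GG: group GG by (rule group_GG)
  interpret Gr: group "Gv r" by (rule vertex_group[OF r_V])
  interpret em: group_hom "Gv r" GG \<iota>
    by (simp add: group_hom_def group_hom_axioms_def Gr.is_group group_GG emb_hom_GG[OF r_V])
  fix m assume "m \<in> fusion_of GG (\<iota> ` Sv r)"
  then obtain P Q g where m: "m = (P, Q, restrict (conj GG g) P)"
    and P: "subgroup P GG" "P \<subseteq> \<iota> ` Sv r" and Q: "subgroup Q GG" "Q \<subseteq> \<iota> ` Sv r"
    and g: "g \<in> carrier GG" "conj GG g ` P \<subseteq> Q"
    unfolding fusion_of_def by (elim CollectE exE conjE)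
  have inj: "inj_on \<iota> (Sv r)" using emb_inj_GG[OF r_V] Sv_carrier[OF r_V] by (auto intro: inj_on_subset)
  define P0 where "P0 = {x \<in> Sv r. \<iota> x \<in> P}"
  define Q0 where "Q0 = {x \<in> Sv r. \<iota> x \<in> Q}"
  have PP: "P = \<iota> ` P0" and QQ: "Q = \<iota> ` Q0" using P(2) Q(2) by (auto simp: P0_def Q0_def)
  have sub: "subgroup {x \<in> Sv r. \<iota> x \<in> R} (Gv r)" if R: "subgroup R GG" for R
  proof (rule Gr.subgroupI)
    show "{x \<in> Sv r. \<iota> x \<in> R} \<subseteq> carrier (Gv r)" using Sv_carrier[OF r_V] by blast
    show "{x \<in> Sv r. \<iota> x \<in> R} \<noteq> {}"
      using subgroup.one_closed[OF R] subgroup.one_closed[OF Sv_subgroup[OF r_V]] em.hom_one by force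
  qed (use R Sv_subgroup[OF r_V] Sv_carrier[OF r_V] in \<open>auto simp: subgroup.m_inv_closed subgroup.m_closed\<close>)
  have P0: "subgroup P0 (Gv r)" "P0 \<subseteq> Sv r" and Q0: "subgroup Q0 (Gv r)" "Q0 \<subseteq> Sv r"
    using sub[OF P(1)] sub[OF Q(1)] by (auto simp: P0_def Q0_def)
  have Pp: "finite_p_subgroup GG p P"
    using GG.finite_p_subgroup_subset[OF _ P prime_p] sylow_GG by (simp add: sylow_gen_def)
  define f where "f = restrict (inv_into (Sv r) \<iota> \<circ> conj GG g \<circ> \<iota>) P0"
  have f: "f x \<in> Q0" "\<iota> (f x) = conj GG g (\<iota> x)" if "x \<in> P0" for x
  proof -
    have "conj GG g (\<iota> x) \<in> \<iota> ` Q0" using g(2) that unfolding PP QQ by blast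
    then obtain y where y: "y \<in> Q0" "conj GG g (\<iota> x) = \<iota> y" by blast
    then have "f x = y" using that inj Q0(2) by (auto simp: f_def)
    then show "f x \<in> Q0" "\<iota> (f x) = conj GG g (\<iota> x)" using y by auto
  qed
  have "(P0, Q0, f) \<in> F" if F: "fusion_system (Gv r) (Sv r) F" "gens V \<subseteq> F" for F
  proof -
    have "realised V F P g"
      using good_closed[OF closed_set_V] F Pp P(2) g Q(2) unfolding good_def by blast
    then obtain P1 f1 where f1: "P = \<iota> ` P1" "(P1, Sv r, f1) \<in> F" "\<And>x. x \<in> P1 \<Longrightarrow> \<iota> (f1 x) = conj GG g (\<iota> x)"
      unfolding realised_def by blast
    note mor = fusion_system_mor[OF F(1) f1(2)]
    have "P1 = P0" using f1(1) unfolding PP using inj_on_image_eq_iff[OF inj mor(2) P0(2)] by simp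
    have "f1 = f"
    proof
      fix x
      show "f1 x = f x"
      proof (cases "x \<in> P0")
        case True
        have "f1 x \<in> Sv r" "f x \<in> Sv r" using mor(5) True \<open>P1 = P0\<close> f(1)[OF True] Q0(2) by blast+
        moreover have "\<iota> (f1 x) = \<iota> (f x)" using f1(3) f(2) True \<open>P1 = P0\<close> by simp
        ultimately show ?thesis using inj_onD[OF inj] by blast
      next
        case False
        have "f1 x = restrict f1 P1 x" using mor(7) by (rule fun_cong)
        then show ?thesis using False \<open>P1 = P0\<close> by (simp add: f_def)
      qed
    qed
    then have "(P0, Sv r, f) \<in> F" using f1(2) \<open>P1 = P0\<close> by simp
    then have "(P0, Q0, restrict f P0) \<in> F"
      by (rule fusion_system_restrict[OF F(1) _ P0(1) order_refl Q0]) (use f(1) in blast)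
    then show ?thesis by (simp add: f_def)
  qed
  then have "(P0, Q0, f) \<in> gen_fusion (Gv r) (Sv r) (gens V)" unfolding gen_fusion_def by blast
  moreover have "restrict (conj GG g) P = restrict (\<iota> \<circ> f \<circ> inv_into P0 \<iota>) (\<iota> ` P0)"
    unfolding PP using f(2) inj_on_subset[OF inj P0(2)] by (intro restrict_ext) auto
  ultimately show "m \<in> map_fusion \<iota> (gen_fusion (Gv r) (Sv r) (gens V))"
    unfolding m map_fusion_def PP QQ by blast
qed

theorem fusion_GG: "fusion_of GG (\<iota> ` Sv r) = map_fusion \<iota> (gen_fusion (Gv r) (Sv r) (gens V))"
  using fusion_of_subset map_fusion_subset by blast

end

section \<open>From the given tree of fusion systems to the rooted form\<close>

theorem theoremA:
  fixes p :: nat and V :: "'v set" and E :: "'v set set"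
    and Gv :: "'v \<Rightarrow> 'a monoid" and Ge :: "'v set \<Rightarrow> 'a monoid"
    and phi :: "'v set \<Rightarrow> 'v \<Rightarrow> 'a \<Rightarrow> 'a"
    and Sv :: "'v \<Rightarrow> 'a set" and Se :: "'v set \<Rightarrow> 'a set" and gg :: "'v set \<Rightarrow> 'v \<Rightarrow> 'a"
    and vs :: 'v
  assumes "Factorial_Ring.prime p"
    and "tree_of_groups V E Gv Ge phi"
    and "finite_groups V E Gv Ge"
    and "induced_tree_fusion p V E Gv Ge phi Sv Se gg"
    and "hypH V E Gv phi Sv Se gg vs"
  shows "group (completion V E Gv Ge phi)
    \<and> sylow_gen (completion V E Gv Ge phi) p (completion_emb V E Gv Ge phi vs ` Sv vs)
    \<and> fusion_of (completion V E Gv Ge phi) (completion_emb V E Gv Ge phi vs ` Sv vs)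
        = map_fusion (completion_emb V E Gv Ge phi vs) (tree_fusion_completion V E Gv phi Sv Se gg vs)"
proof -
  have T: "is_tree V E" using assms(2) by (simp add: tree_of_groups_def)
  have r: "vs \<in> V" using assms(5) by (simp add: hypH_def)
  define par where "par = parent V E vs"
  define psi where "psi = ident V E Gv phi Se gg vs"
  have path: "path_to V E v vs = v # path_to V E (par v) vs" and parV: "par v \<in> V" and parE: "{v, par v} \<in> E"
    if "v \<in> V" "v \<noteq> vs" for v
    using path_to_parent[OF T that(1) r that(2)] by (auto simp: par_def)
  have hd_path: "\<exists>ys. path_to V E v vs = v # ys" if "v \<in> V" for v
    using path[OF that] path_to_self[OF T r] by (cases "v = vs") auto
  have bij: "bij_betw (Sf Gv phi Se gg {v, par v} v) (Se {v, par v}) (Sv v)" if v: "v \<in> V" "v \<noteq> vs" for v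
  proof -
    have "path_to V E v vs ! 0 = v" using path[OF v] by simp
    then show ?thesis using assms(5) v unfolding hypH_def Let_def par_def parent_def by metis
  qed
  have Sf: "Sf Gv phi Se gg e w s = conj (Gv w) (gg e w) (phi e w s)" if "s \<in> Se e" for e w s
    using that by (simp add: Sf_def)
  have edge: "group (Ge e)" "finite (carrier (Ge e))" "sylow_finite (Ge e) p (Se e)" if "e \<in> E" for e
    using assms(2-4) that by (auto simp: tree_of_groups_def finite_groups_def induced_tree_fusion_def)
  have incid: "phi e w \<in> hom (Ge e) (Gv w)" "inj_on (phi e w) (carrier (Ge e))" "gg e w \<in> carrier (Gv w)"
    "\<And>s. s \<in> Se e \<Longrightarrow> conj (Gv w) (gg e w) (phi e w s) \<in> Sv w" if "e \<in> E" "w \<in> e" for e w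
    using assms(2,4) that unfolding tree_of_groups_def induced_tree_fusion_def by blast+
  interpret R: rooted_tree_fusion p V vs par "\<lambda>v. length (path_to V E v vs)" Gv Ge phi Sv Se gg psi
  proof (rule rooted_tree_fusion.intro)
    show "Factorial_Ring.prime p" by fact
    show "finite V" using T by (simp add: is_tree_def)
    show "vs \<in> V" by fact
    show "group (Gv v)" "finite (carrier (Gv v))" "sylow_finite (Gv v) p (Sv v)" if "v \<in> V" for v
      using assms(2-4) that by (auto simp: tree_of_groups_def finite_groups_def induced_tree_fusion_def)
    show "psi vs x = x" for x by (simp add: psi_def ident_def path_to_self[OF T r])
    fix v assume v: "v \<in> V" "v \<noteq> vs"
    show "par v \<in> V" by (rule parV[OF v])
    show "length (path_to V E (par v) vs) < length (path_to V E v vs)" using path[OF v] by simp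
    show "group (Ge {v, par v})" "finite (carrier (Ge {v, par v}))" "sylow_finite (Ge {v, par v}) p (Se {v, par v})"
      using edge[OF parE[OF v]] by auto
    show "phi {v, par v} w \<in> hom (Ge {v, par v}) (Gv w)" "inj_on (phi {v, par v} w) (carrier (Ge {v, par v}))"
      "gg {v, par v} w \<in> carrier (Gv w)" if "w \<in> {v, par v}" for w
      using incid[OF parE[OF v] that] by auto
    show "conj (Gv w) (gg {v, par v} w) (phi {v, par v} w s) \<in> Sv w" if "w \<in> {v, par v}" "s \<in> Se {v, par v}" for w s
      using incid(4)[OF parE[OF v] that] .
    show "\<exists>s\<in>Se {v, par v}. x = conj (Gv v) (gg {v, par v} v) (phi {v, par v} v s)" if "x \<in> Sv v" for x
    proof -
      have "x \<in> Sf Gv phi Se gg {v, par v} v ` Se {v, par v}" using bij[OF v] that by (simp add: bij_betw_def)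
      then obtain s where "s \<in> Se {v, par v}" "x = Sf Gv phi Se gg {v, par v} v s" by (rule imageE)
      then show ?thesis using Sf[of s "{v, par v}" v] by blast
    qed
    show "psi v (conj (Gv v) (gg {v, par v} v) (phi {v, par v} v s))
        = psi (par v) (conj (Gv (par v)) (gg {v, par v} (par v)) (phi {v, par v} (par v) s))"
      if s: "s \<in> Se {v, par v}" for s
    proof -
      obtain ys where ys: "path_to V E (par v) vs = par v # ys" using hd_path[OF parV[OF v]] by blast
      \<comment> \<open>By (H) the map at \<open>v\<close> is bijective, so the preimage chosen by
        \<open>transport\<close> is \<open>s\<close> itself, and one step of
        \<open>transport\<close> is the recursion \<open>psi_edge\<close>.\<close>
      have "inv_into (Se {v, par v}) (Sf Gv phi Se gg {v, par v} v) (Sf Gv phi Se gg {v, par v} v s) = s"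
        using bij[OF v] s by (simp add: bij_betw_def)
      then show ?thesis using ys path[OF v] Sf[OF s] by (simp add: psi_def ident_def)
    qed
  qed
  \<comment> \<open>Equality of the edge sets makes the two completions literally the same group, so
    no isomorphism has to be carried along.\<close>
  have E: "R.edges V = E"
  proof
    show "R.edges V \<subseteq> E" using parE by (auto simp: R.edges_def)
    show "E \<subseteq> R.edges V"
    proof
      fix e assume "e \<in> E"
      then obtain v where v: "v \<in> V" "v \<noteq> vs" "e = {v, par v}" unfolding par_def by (rule tree_edge_parent[OF T r])
      show "e \<in> R.edges V" unfolding R.edges_def v(3) using v(1,2) by (intro imageI) simp
    qed
  qed
  have "tree_fusion_completion V E Gv phi Sv Se gg vs = gen_fusion (Gv vs) (Sv vs) (R.gens V)"
    unfolding tree_fusion_completion_def tree_fusion_gens_def R.gens_def Let_def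
    by (simp only: psi_def)
  then show ?thesis using R.group_GG R.sylow_GG R.fusion_GG unfolding E by simp
qed

end
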